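(* Let $n\ge 2$, let $\Omega\subset\mathbb{R}^n$ be a bounded open set, let $\alpha\in(0,n)$, let $1<q<\infty$, and set $q'=q/(q-1)$. Let $\nu$ be a positive Borel measure on $\Omega$ such that, for some $d\in(0,n]$, (i) there is a constant $C_d'>0$ with $\nu(B(x,r))\le C_d' r^d$ for all $x\in\mathbb{R}^n$ and all $r>0$; (ii) there exist $x_0\in\Omega$, $\varrho_0>0$ and $C_0>0$ such that $C_0\varrho^d\le \nu(B(x_0,\varrho)\cap\Omega)$ for all $0<\varrho\le\varrho_0$. Then there exists a positive constant $C=C(n,\alpha,\Omega,C_d',q)$ such that $$\int_\Omega \exp\left(\beta|I_\alpha f(x)|^{q'}\right)\,d\nu\le C$$ for every $\beta\le \frac dn\,\gamma(\alpha)^{q'}\,\omega_n^{-\frac{n-\alpha}{n}q'}$ and every $f\in L^{\frac n\alpha,q}(\Omega)$ with $\|\,|f|\,\|_{L^{\frac n\alpha,q}(\Omega)}\le 1$. Moreover, the result is sharp in the sense that for any $\beta>\frac dn\,\gamma(\alpha)^{q'}\,\omega_n^{-\frac{n-\alpha}{n}q'}$ the integral $\int_\Omega \exp(\beta|I_\alpha f(x)|^{q'})\,d\nu$ cannot be uniformly bounded over all $f\in L^{\frac n\alpha,q}(\Omega)$ with $\|\,|f|\,\|_{L^{\frac n\alpha,q}(\Omega)}\le 1$.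
   Context: $B(x,r)$ is the ball of radius $r$ centered at $x$; $\nu$ is regarded as a measure on $\mathbb{R}^n$ vanishing outside $\Omega$, so $\nu(B(x,r))=\nu(B(x,r)\cap\Omega)$. $|E|$ is the Lebesgue measure of $E$, and $\omega_n$ is the Lebesgue measure of the unit ball of $\mathbb{R}^n$. $C=C(\dots)$ means a constant depending only on the listed quantities (dependence on $C_d'$ being understood together with its exponent $d$). For $\alpha\in(0,n)$, the Riesz potential is $I_\alpha f(x)=\frac1{\gamma(\alpha)}\int_{\mathbb{R}^n}\frac{f(y)}{|x-y|^{n-\alpha}}\,dy$ with $\gamma(\alpha)=\frac{\pi^{n/2}2^\alpha\Gamma(\alpha/2)}{\Gamma\left(\frac{n-\alpha}{2}\right)}$; a function $f$ on $\Omega$ is extended by $0$ to $\mathbb{R}^n$. For a measurable function $g$ on $\Omega$, its non-increasing rearrangement is $g^*(t)=\inf\{\lambda>0:\ |\{x\in\Omega:|g(x)|>\lambda\}|\le t\}$, $t>0$. For $1\le p<\infty$ and $1\le q<\infty$, $L^{p,q}(\Omega)$ is the space of measurable $g$ with $\|g\|_{L^{p,q}(\Omega)}=\left(\int_0^{|\Omega|}(s^{1/p}g^*(s))^q\,\frac{ds}{s}\right)^{1/q}<\infty$. *)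

theory Defs
  imports "HOL-Analysis.Analysis"
begin

(* Power with real exponent p > 0 on [0,\<infinity>]; the library's powr does not cover ennreal. *)
definition ennreal_pow :: "ennreal \<Rightarrow> real \<Rightarrow> ennreal" where
  "ennreal_pow a p = (if a = \<infinity> then \<infinity> else ennreal (enn2real a powr p))"

(* The infimum is taken in [0,\<infinity>], so it is \<infinity> when no level l qualifies. *)
definition rearrangement :: "(real ^ 'n) set \<Rightarrow> (real ^ 'n \<Rightarrow> real) \<Rightarrow> real \<Rightarrow> ennreal" where
  "rearrangement \<Omega> g t =
     (INF l \<in> {l::real. 0 < l \<and> emeasure lebesgue {x \<in> \<Omega>. l < \<bar>g x\<bar>} \<le> ennreal t}. ennreal l)"

(* The quasi-norm for 1 \<le> p, q < \<infinity>, with value \<infinity> when the defining integral diverges. *)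
definition lorentz_norm :: "real \<Rightarrow> real \<Rightarrow> (real ^ 'n) set \<Rightarrow> (real ^ 'n \<Rightarrow> real) \<Rightarrow> ennreal" where
  "lorentz_norm p q \<Omega> g =
     ennreal_pow
       (\<integral>\<^sup>+ s \<in> {s. 0 < s \<and> ennreal s < emeasure lebesgue \<Omega>}.
          ennreal_pow (ennreal (s powr (1 / p)) * rearrangement \<Omega> g s) q * ennreal (1 / s) \<partial>lborel)
       (1 / q)"

definition lorentz_space :: "real \<Rightarrow> real \<Rightarrow> (real ^ 'n) set \<Rightarrow> (real ^ 'n \<Rightarrow> real) set" where
  "lorentz_space p q \<Omega> =
     {g. g \<in> borel_measurable (lebesgue_on \<Omega>) \<and> lorentz_norm p q \<Omega> g < \<infinity>}"

definition zero_ext :: "(real ^ 'n) set \<Rightarrow> (real ^ 'n \<Rightarrow> real) \<Rightarrow> real ^ 'n \<Rightarrow> real" where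
  "zero_ext \<Omega> f = (\<lambda>y. if y \<in> \<Omega> then f y else 0)"

definition riesz_gamma :: "nat \<Rightarrow> real \<Rightarrow> real" where
  "riesz_gamma n \<alpha> = pi powr (real n / 2) * 2 powr \<alpha> * Gamma (\<alpha> / 2) / Gamma ((real n - \<alpha>) / 2)"

definition riesz_integrand ::
    "real \<Rightarrow> (real ^ 'n \<Rightarrow> real) \<Rightarrow> real ^ 'n \<Rightarrow> real ^ 'n \<Rightarrow> real" where
  "riesz_integrand \<alpha> f x y = f y / norm (x - y) powr (real CARD('n) - \<alpha>)"

(* The Bochner integral returns 0 at points x where the integrand is not absolutely integrable,
   so statements about riesz_potential should be accompanied by riesz_converges. *)
definition riesz_potential :: "real \<Rightarrow> (real ^ 'n \<Rightarrow> real) \<Rightarrow> real ^ 'n \<Rightarrow> real" where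
  "riesz_potential \<alpha> f x =
     1 / riesz_gamma CARD('n) \<alpha> * (\<integral> y. riesz_integrand \<alpha> f x y \<partial>lebesgue)"

definition riesz_converges :: "real \<Rightarrow> (real ^ 'n \<Rightarrow> real) \<Rightarrow> real ^ 'n \<Rightarrow> bool" where
  "riesz_converges \<alpha> f x \<longleftrightarrow> integrable lebesgue (riesz_integrand \<alpha> f x)"

(* A positive Borel measure on \<Omega>, regarded as a measure on the whole space vanishing outside \<Omega>. *)
definition borel_measure_on :: "(real ^ 'n) set \<Rightarrow> (real ^ 'n) measure \<Rightarrow> bool" where
  "borel_measure_on \<Omega> \<nu> \<longleftrightarrow> sets \<nu> = sets borel \<and> emeasure \<nu> (- \<Omega>) = 0"

definition upper_growth :: "real \<Rightarrow> real \<Rightarrow> (real ^ 'n) measure \<Rightarrow> bool" where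
  "upper_growth d C' \<nu> \<longleftrightarrow>
     (\<forall>x. \<forall>r>0. emeasure \<nu> (ball x r) \<le> ennreal (C' * r powr d))"

definition lower_growth_somewhere ::
    "real \<Rightarrow> (real ^ 'n) set \<Rightarrow> (real ^ 'n) measure \<Rightarrow> bool" where
  "lower_growth_somewhere d \<Omega> \<nu> \<longleftrightarrow>
     (\<exists>x\<^sub>0\<in>\<Omega>. \<exists>\<rho>\<^sub>0>0. \<exists>C\<^sub>0>0. \<forall>\<rho>. 0 < \<rho> \<and> \<rho> \<le> \<rho>\<^sub>0 \<longrightarrow>
        ennreal (C\<^sub>0 * \<rho> powr d) \<le> emeasure \<nu> (ball x\<^sub>0 \<rho> \<inter> \<Omega>))"

definition critical_beta :: "'n::finite itself \<Rightarrow> real \<Rightarrow> real \<Rightarrow> real \<Rightarrow> real" where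
  "critical_beta _ \<alpha> q' d =
     d / real CARD('n) * riesz_gamma CARD('n) \<alpha> powr q' *
     measure lebesgue (ball (0 :: real ^ 'n) 1) powr (- ((real CARD('n) - \<alpha>) / real CARD('n)) * q')"

definition exp_integral ::
    "(real ^ 'n) set \<Rightarrow> (real ^ 'n) measure \<Rightarrow> real \<Rightarrow> real \<Rightarrow> real \<Rightarrow> (real ^ 'n \<Rightarrow> real) \<Rightarrow> ennreal"
  where
  "exp_integral \<Omega> \<nu> \<alpha> q' \<beta> f =
     (\<integral>\<^sup>+ x \<in> \<Omega>. ennreal (exp (\<beta> * \<bar>riesz_potential \<alpha> (zero_ext \<Omega> f) x\<bar> powr q')) \<partial>\<nu>)"

end

(* The potential is estimated at the logarithmic scales V e^-k, where V is the volume of the domain.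
   Splitting |f| at the level f^*(V e^-k), the Hardy-Littlewood inequality bounds the potential of the
   lower part by w^((n-alpha)/n) (P k + O(eps k)), where w is the volume of the unit ball, P k is the
   integral of f^*(z) z^(alpha/n - 1) over (V e^-k, V), and eps k is the Lorentz norm of f^* on (0, V e^-k).
   The potential of the upper part is O(eps k) outside a set of nu-measure O(e^(-k d/n)): near x one
   distributes the kernel by Hoelder's inequality between Lebesgue measure and nu and uses the growth of
   nu. The factor eps k, rather than a constant, in the error is what makes the sum of
   exp(d/n ((P k + O(eps k))^q' - k)) bounded, by a discrete version of Adams' lemma.

   Sharpness is tested with |y - x0|^(-alpha) truncated to rho <= |y - x0| < r and normalised,
   whose potential on a ball of radius e rho around x0 is asymptotically extremal as rho -> 0. *)

theory Submission
  imports Defs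
begin

subsection \<open>A discrete Adams lemma\<close>

text \<open>The critical beta comes from an exact balance. The rearranged kernel |x|^(alpha-n) is
  (z/w)^((alpha-n)/n), so I_alpha f is to leading order at most w^((n-alpha)/n) P k / gamma, and
  Hoelder in dz/z gives (P k)^q' \<le> k because each scale has logarithmic length 1. At critical
  beta the exponent is then at most (d/n) k, precisely what the nu-measure e^(-k d/n) of the
  exceptional set compensates. At equality no exponential decay is left, so the lower order terms
  decide: a fixed error c would change (P k)^q' by about k^(1/q), and even a single term of the sum
  would be unbounded in k. The way out is that energy spent on the first k scales is no longer
  available later. If P k is close to its maximum k^(1/q'), the remaining energy (eps k)^q is
  O(1/k), so k^(1/q) eps k stays bounded. For the same reason the nearly extremal k beyond a
  threshold fill only a bounded block, and this makes the sum converge. None of the constants in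
  this argument depends on f or nu.\<close>

lemma powr_holder_two:
  fixes a b x y p q :: real
  assumes pq: "1 < p" "1 < q" "1 / p + 1 / q = 1" and nn: "0 \<le> a" "0 \<le> b" "0 \<le> x" "0 \<le> y"
  shows "a powr (1/p) * x powr (1/q) + b powr (1/p) * y powr (1/q)
           \<le> (a + b) powr (1/p) * (x + y) powr (1/q)"
proof (cases "a + b = 0 \<or> x + y = 0")
  case True
  then show ?thesis using nn by (auto simp: add_nonneg_eq_0_iff)
next
  case False
  then have pos: "0 < a + b" "0 < x + y" using nn by linarith+
  have Y: "s powr (1/p) * t powr (1/q) \<le> s / p + t / q" if "0 \<le> s" "0 \<le> t" for s t
    using Youngs_inequality[of p q "s powr (1/p)" "t powr (1/q)"] pq that by (simp add: powr_powr)
  have "(a / (a+b)) powr (1/p) * (x / (x+y)) powr (1/q) + (b / (a+b)) powr (1/p) * (y / (x+y)) powr (1/q)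
      \<le> (a/(a+b)) / p + (x/(x+y)) / q + ((b/(a+b)) / p + (y/(x+y)) / q)"
    using nn pos by (intro add_mono Y) auto
  also have "\<dots> = (a/(a+b) + b/(a+b)) / p + (x/(x+y) + y/(x+y)) / q" by (simp add: add_divide_distrib)
  also have "\<dots> = ((a+b)/(a+b)) / p + ((x+y)/(x+y)) / q" by (simp only: add_divide_distrib)
  also have "\<dots> = 1" using pos pq by simp
  finally have "(a powr (1/p) * x powr (1/q) + b powr (1/p) * y powr (1/q))
      / ((a + b) powr (1/p) * (x + y) powr (1/q)) \<le> 1"
    using nn pos by (simp add: powr_divide add_divide_distrib)
  then show ?thesis using pos by (simp add: divide_le_eq split: if_splits)
qed

text \<open>Concavity: the power lies below its tangent at 1. The linear gap converts remaining
  energy (in \<open>energy_small\<close>) and a ratio of scale indices (in \<open>gap_bound\<close>)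
  into a proportional loss.\<close>

lemma powr_bernoulli_le:
  fixes a x :: real
  assumes "0 \<le> a" "a \<le> 1" "0 \<le> x"
  shows "x powr a \<le> 1 - a * (1 - x)"
proof (cases "x = 0")
  case False
  then show ?thesis using Youngs_inequality_0[of a "1-a" x 1] assms by (simp add: algebra_simps)
qed (use assms in auto)

lemma powr_ge_self:
  fixes a x :: real
  assumes "0 \<le> a" "a \<le> 1" "0 \<le> x" "x \<le> 1"
  shows "x \<le> x powr a"
proof (cases "x = 0")
  case False
  then show ?thesis using powr_mono'[of a 1 x] assms by simp
qed auto

text \<open>\<open>P k\<close> is the part of the potential carried by the first \<open>k\<close> scales and \<open>E k\<close> the energy left at the
  remaining ones; \<open>Pinc\<close> is what the Hoelder inequality gives on a block of scales.\<close>

locale adams_seq =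
  fixes q q' D :: real and P E :: "nat \<Rightarrow> real"
  assumes q: "1 < q" and q': "q' = q / (q - 1)" and D: "0 \<le> D"
    and E0: "E 0 \<le> 1" and Enn: "\<And>k. 0 \<le> E k" and Edec: "\<And>k m. k \<le> m \<Longrightarrow> E m \<le> E k"
    and P0: "P 0 = 0" and Pnn: "\<And>k. 0 \<le> P k"
    and Pinc: "\<And>k m. k \<le> m \<Longrightarrow> P m \<le> P k + real (m - k) powr (1/q') * (E k - E m) powr (1/q)"
begin

definition S where "S k = P k + D * E k powr (1/q)"
text \<open>Up to a positive factor, \<open>- F k\<close> is the exponent with which scale k enters
  the final sum, so \<open>F\<close> measures the distance from extremality.\<close>

definition F where "F k = real k - S k powr q'"
text \<open>Since \<open>D = b powr (1/q')\<close>, the error \<open>D * E k powr (1/q)\<close>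
  looks like the Hoelder bound for \<open>b\<close> fictitious further scales that use up all the
  remaining energy.\<close>

definition b where "b = D powr q'"

lemma exponents: "1 < q'" "1/q' + 1/q = 1" "1/q + 1/q' = 1" "1 / q' < 1" "0 < 1 / q'" "1 / q < 1" "0 < 1 / q"
  using q unfolding q' by (auto simp: field_simps)

lemma E1: "E k \<le> 1" using E0 Edec[of 0 k] by simp
lemma Snn: "0 \<le> S k" unfolding S_def using Pnn Enn D by simp
lemma bnn: "0 \<le> b" unfolding b_def by simp
lemma D_eq: "D = b powr (1/q')" using exponents D unfolding b_def by (simp add: powr_powr)

lemma P_le: "P k \<le> real k powr (1/q') * (1 - E k) powr (1/q)"
proof -
  have "P k \<le> real k powr (1/q') * (E 0 - E k) powr (1/q)" using Pinc[of 0 k] P0 by simp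
  also have "\<dots> \<le> real k powr (1/q') * (1 - E k) powr (1/q)"
    using E0 Edec[of 0 k] exponents by (intro mult_left_mono powr_mono2) auto
  finally show ?thesis .
qed

text \<open>The two-term Hoelder inequality merges the real scales between k and m with the
  \<open>b\<close> fictitious ones, and the energies \<open>E k - E m\<close> and \<open>E m\<close>
  add up to \<open>E k\<close>.\<close>

lemma S_le_tail:
  assumes "k \<le> m" shows "S m \<le> P k + (real (m - k) + b) powr (1/q') * E k powr (1/q)"
proof -
  have "S m \<le> P k + (real (m - k) powr (1/q') * (E k - E m) powr (1/q) + b powr (1/q') * E m powr (1/q))"
    unfolding S_def using Pinc[OF assms] D_eq by simp
  also have "\<dots> \<le> P k + (real (m - k) + b) powr (1/q') * (E k - E m + E m) powr (1/q)"
    using exponents q bnn Enn Edec[OF assms] by (intro add_left_mono powr_holder_two) auto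
  finally show ?thesis by simp
qed

lemma F_ge: "- b \<le> F k"
proof -
  have "S k \<le> (real k + b) powr (1/q') * E 0 powr (1/q)" using S_le_tail[of 0 k] P0 by simp
  also have "\<dots> \<le> (real k + b) powr (1/q') * 1"
    using powr_mono2[of "1/q" "E 0" 1] E0 Enn exponents by (intro mult_left_mono) auto
  finally have "S k powr q' \<le> ((real k + b) powr (1/q')) powr q'"
    using Snn exponents by (intro powr_mono2) auto
  also have "\<dots> = real k + b" using exponents bnn by (simp add: powr_powr)
  finally show ?thesis unfolding F_def by simp
qed

section \<open>Counting the nearly extremal scales\<close>

text \<open>Chosen to dominate both outcomes of solving
  \<open>Y \<le> q * l + q * D * Y powr (1/q)\<close> for Y in \<open>energy_small\<close>.\<close>

definition A where "A = 2*q + (2*q*D) powr q' + 1"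

lemma root_le_S:
  assumes "F k \<le> l" "l \<le> real k" shows "(real k - l) powr (1/q') \<le> S k"
proof -
  have "(real k - l) powr (1/q') \<le> (S k powr q') powr (1/q')"
    using assms exponents unfolding F_def by (intro powr_mono2) auto
  also have "\<dots> = S k" using exponents Snn by (simp add: powr_powr)
  finally show ?thesis .
qed

text \<open>Near extremality leaves little energy: with E k unspent, P k is at most
  \<open>real k powr (1/q') * (1 - E k / q)\<close>, while S k must reach
  \<open>(real k - l) powr (1/q')\<close>. Multiplying the comparison by
  \<open>real k powr (1/q)\<close> gives an inequality for Y = k * E k alone, in which the error
  term is only Y^(1/q).\<close>

lemma energy_small:
  assumes l: "0 \<le> l" "F k \<le> l" and k: "0 < k"
  shows "real k * E k \<le> A * (1 + l)"
proof (cases "l \<le> real k")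
  case False
  have "real k * E k \<le> real k * 1" using E1 by (intro mult_left_mono) auto
  also have "\<dots> \<le> 1 * (1 + l)" using False by simp
  also have "\<dots> \<le> A * (1+l)" unfolding A_def using q l by (intro mult_right_mono) auto
  finally show ?thesis .
next
  case True
  define Y where "Y = real k * E k"
  have Y: "0 \<le> Y" unfolding Y_def using Enn by simp
  have kk: "real k = real k powr (1/q') * real k powr (1/q)"
    using k unfolding powr_add[symmetric] exponents(2) by simp
  have "real k powr (1/q') * (1 - l / real k) \<le> real k powr (1/q') * (1 - l / real k) powr (1/q')"
    using powr_ge_self[of "1/q'" "1 - l/real k"] exponents l True k by (intro mult_left_mono) (auto simp: field_simps)
  also have "\<dots> = (real k - l) powr (1/q')"
  proof -
    have "real k * (1 - l / real k) = real k - l" using k by (simp add: field_simps)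
    then show ?thesis using k True by (subst powr_mult[symmetric]) (auto simp: divide_le_eq)
  qed
  also have "\<dots> \<le> S k" by (rule root_le_S) (use assms True in auto)
  also have "\<dots> \<le> real k powr (1/q') * (1 - E k) powr (1/q) + D * E k powr (1/q)"
    unfolding S_def using P_le by simp
  also have "\<dots> \<le> real k powr (1/q') * (1 - E k / q) + D * E k powr (1/q)"
    using powr_bernoulli_le[of "1/q" "1 - E k"] exponents E1[of k] D by (intro add_mono mult_left_mono) auto
  finally have "real k powr (1/q') * (E k / q) \<le> real k powr (1/q') * (l / real k) + D * E k powr (1/q)"
    by (simp add: algebra_simps)
  then have "real k powr (1/q) * (real k powr (1/q') * (E k / q))
     \<le> real k powr (1/q) * (real k powr (1/q') * (l / real k) + D * E k powr (1/q))"
    by (intro mult_left_mono) auto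
  also have "\<dots> = (real k powr (1/q') * real k powr (1/q)) * (l / real k)
       + D * (real k powr (1/q) * E k powr (1/q))" by (simp add: algebra_simps)
  also have "\<dots> = l + D * Y powr (1/q)"
    unfolding kk[symmetric] Y_def using k Enn by (simp add: powr_mult)
  also have "real k powr (1/q) * (real k powr (1/q') * (E k / q)) = Y / q"
    unfolding Y_def by (subst (2) kk) simp
  finally have Yq: "Y \<le> q * l + q * D * Y powr (1/q)" using q by (simp add: field_simps)
  have "Y \<le> 2*q*l + (2*q*D) powr q'"
  \<comment> \<open>Above this threshold the term \<open>q * D * Y powr (1/q)\<close> is at most Y /
    2 and is absorbed on the left.\<close>
  proof (cases "Y \<le> (2*q*D) powr q'")
    case True
    have "0 \<le> 2*q*l" using q l by simp
    then show ?thesis using True by linarith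
  next
    case False
    have "2*q*D = ((2*q*D) powr q') powr (1/q')" using q D exponents by (simp add: powr_powr)
    also have "\<dots> \<le> Y powr (1/q')" using False exponents by (intro powr_mono2) auto
    finally have "2*q*D * Y powr (1/q) \<le> Y powr (1/q') * Y powr (1/q)" by (intro mult_right_mono) auto
    also have "\<dots> = Y" using Y unfolding powr_add[symmetric] exponents(2) by simp
    finally show ?thesis using Yq powr_ge_zero[of "2*q*D" q'] by linarith
  qed
  also have "\<dots> \<le> A * (1 + l)" 
  proof -
    have "0 \<le> 2*q" "0 \<le> (2*q*D) powr q' * l" using q l by auto
    then show ?thesis unfolding A_def using l by (simp add: algebra_simps)
  qed
  finally show ?thesis unfolding Y_def .
qed

text \<open>Fixed by the Young step of \<open>gap_bound\<close>: with the weight 4^(q/q'), both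
  terms containing h become h / (4 * q'), so that only half of h is lost and can be
  absorbed.\<close>

definition K where "K = 4 powr (q/q') * (4 * q') / q"
definition B where "B = 2 * b + 2 + 2 * q' * 4 powr (q/q') / q * A"

text \<open>By \<open>energy_small\<close> at most \<theta> / k of energy is left after scale k. To
  be nearly extremal again at m, S must grow by about z^(1/q') - k^(1/q'), but that energy only pays
  for h^(1/q') (\<theta>/k)^(1/q). Concavity and multiplication by z^(1/q) turn this into a linear
  inequality for the gap.\<close>

lemma gap_bound:
  assumes l: "0 \<le> l" "F k \<le> l" "F m \<le> l" and km: "k \<le> m" and k: "K * A * (1 + l) \<le> real k"
  shows "real (m - k) \<le> B * (1 + l)"
proof -
  define \<theta> where "\<theta> = A * (1 + l)"
  define h where "h = real (m - k) + b"
  define M where "M = (4::real) powr (q/q')"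
  have A1: "1 \<le> A" unfolding A_def using q by simp
  then have th: "1 \<le> \<theta>" unfolding \<theta>_def using l mult_mono[of 1 A 1 "1+l"] by auto
  have M0: "0 < M" unfolding M_def by simp
  have K0: "0 < K" unfolding K_def using q exponents by simp
  have kpos: "0 < real k" using k th K0 unfolding \<theta>_def by (smt (verit) mult.assoc mult_pos_pos)
  have h0: "0 \<le> h" unfolding h_def using bnn by simp
  have mk: "real (m-k) = real m - real k" using km by simp
  have BB: "2*b + 2*l + 2*(q'*M/q*\<theta>) \<le> B * (1+l)"
  proof -
    have "0 \<le> b * l" using bnn l by simp
    then show ?thesis unfolding B_def \<theta>_def M_def using l by (simp add: algebra_simps)
  qed
  have nn: "0 \<le> q' * M / q * \<theta>" using exponents M0 th q by simp
  show ?thesis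
  proof (cases "real m - l \<le> real k")
    case True
    then show ?thesis using BB mk nn bnn l by simp
  next
    case False
    define z where "z = real m - l"
    have z: "real k < z" "0 < z" using False kpos unfolding z_def by linarith+
    have "E k \<le> \<theta> / real k" using energy_small[of l k] l kpos unfolding \<theta>_def by (simp add: field_simps)
    then have Ek: "E k powr (1/q) \<le> (\<theta> / real k) powr (1/q)" using Enn exponents by (intro powr_mono2) auto
    have Pk: "P k \<le> real k powr (1/q')"
    proof -
      have "(1 - E k) powr (1/q) \<le> 1 powr (1/q)" using E1 Enn exponents by (intro powr_mono2) auto
      then show ?thesis using P_le[of k] mult_left_mono[of "(1 - E k) powr (1/q)" 1 "real k powr (1/q')"] by simp
    qed
    have "z powr (1/q') \<le> S m" unfolding z_def by (rule root_le_S) (use l z z_def in auto)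
    also have "\<dots> \<le> real k powr (1/q') + h powr (1/q') * (\<theta> / real k) powr (1/q)"
      using S_le_tail[OF km] Pk mult_left_mono[OF Ek, of "h powr (1/q')"] unfolding h_def by simp
    also have "real k powr (1/q') = z powr (1/q') * (real k / z) powr (1/q')"
      using kpos z by (simp add: powr_divide)
    also have "\<dots> \<le> z powr (1/q') * (1 - (1/q') * (1 - real k / z))"
      using exponents z kpos by (intro mult_left_mono powr_bernoulli_le) auto
    finally have "z powr (1/q') * ((z - real k) / (q' * z)) \<le> h powr (1/q') * (\<theta> / real k) powr (1/q)"
      using z exponents by (simp add: field_simps)
    then have "z powr (1/q) * (z powr (1/q') * ((z - real k) / (q' * z)))
        \<le> z powr (1/q) * (h powr (1/q') * (\<theta> / real k) powr (1/q))" by (intro mult_left_mono) auto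
    moreover have "z powr (1/q) * z powr (1/q') = z" using z unfolding powr_add[symmetric] exponents(3) by simp
    ultimately have "z * ((z - real k) / (q' * z)) \<le> h powr (1/q') * (z powr (1/q) * (\<theta> / real k) powr (1/q))"
      by (simp only: mult.assoc[symmetric]) (simp only: mult.commute mult.left_commute)
    then have "(z - real k) / q' \<le> h powr (1/q') * (z powr (1/q) * (\<theta> / real k) powr (1/q))"
      using z exponents by simp
    also have "z powr (1/q) * (\<theta> / real k) powr (1/q) = (\<theta> * z / real k) powr (1/q)"
      using z th kpos by (simp add: powr_mult powr_divide)
    also have "h powr (1/q') * (\<theta> * z / real k) powr (1/q) \<le> h powr (1/q') * (\<theta> + h / K) powr (1/q)"
    proof (intro mult_left_mono powr_mono2)
      \<comment> \<open>Here z \<le> m \<le> k + h, and the lower bound on k makes the part of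
        \<theta> * z / k proportional to h as small as h / K.\<close>
      have "\<theta> * z \<le> \<theta> * (real k + h)" using z th l mk bnn unfolding z_def h_def by (intro mult_left_mono) auto
      moreover have "\<theta> * h \<le> real k * h / K"
        using k K0 h0 mult_right_mono[of "K * \<theta>" "real k" "h"] unfolding \<theta>_def by (simp add: field_simps)
      ultimately have "\<theta> * z \<le> (\<theta> + h / K) * real k" by (simp add: algebra_simps)
      then show "\<theta> * z / real k \<le> \<theta> + h / K" using kpos by (simp add: divide_le_eq)
    qed (use z th kpos exponents in auto)
    also have "\<dots> = (h/4) powr (1/q') * (M * (\<theta> + h/K)) powr (1/q)"
    proof -
      have "M powr (1/q) = 4 powr (1/q')" unfolding M_def using q by (simp add: powr_powr)
      then show ?thesis using h0 M0 th K0 by (simp add: powr_mult powr_divide)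
    qed
    also have "\<dots> \<le> (h/4)/q' + M * (\<theta> + h/K) / q"
      using Youngs_inequality[of q' q "(h/4) powr (1/q')" "(M * (\<theta> + h/K)) powr (1/q)"] exponents q h0 M0 th K0
      by (simp add: powr_powr)
    also have "M * (\<theta> + h/K) / q = M * \<theta> / q + h / (4 * q')"
      unfolding K_def M_def[symmetric] using q exponents M0 by (simp add: field_simps)
    finally have "(z - real k) / q' * q' \<le> (h/4/q' + (M * \<theta> / q + h / (4 * q'))) * q'"
      using exponents by (intro mult_right_mono) auto
    also have "(z - real k) / q' * q' = z - real k" using exponents by simp
    also have "(h/4/q' + (M * \<theta> / q + h / (4 * q'))) * q' = h/2 + q' * M / q * \<theta>"
      using exponents by (simp add: distrib_right)
    finally have "z - real k \<le> h/2 + q' * M / q * \<theta>" .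
    then have "real (m-k) \<le> 2*b + 2*l + 2*(q'*M/q*\<theta>)" 
      using mk bnn unfolding z_def h_def by argo
    then show ?thesis using BB by linarith
  qed
qed

definition G where "G = B + K * A + 2"

text \<open>Indices below \<open>T\<close> are counted trivially. Those above it lie in one
  interval, because \<open>gap_bound\<close> applies between the least of them and any
  other.\<close>

lemma sublevel_card:
  assumes l: "0 \<le> l" shows "finite {k. F k \<le> l}" "real (card {k. F k \<le> l}) \<le> G * (1 + l)"
proof -
  define T where "T = K * A * (1 + l)"
  have T0: "0 \<le> T" unfolding T_def K_def A_def using exponents l q by simp
  have B0: "0 \<le> B * (1+l)" unfolding B_def A_def using exponents l q bnn by (simp add: add_nonneg_nonneg)
  have c1: "real (card {..nat \<lfloor>T\<rfloor>}) \<le> T + 1" using T0 by (simp add: )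
  have *: "\<exists>I. finite I \<and> real (card I) \<le> B * (1+l) + 1 \<and> {k. F k \<le> l \<and> T \<le> real k} \<subseteq> I"
  proof (cases "{k. F k \<le> l \<and> T \<le> real k} = {}")
    case True
    then show ?thesis using B0 by (intro exI[of _ "{}"]) auto
  next
    case False
    define k0 where "k0 = (LEAST k. F k \<le> l \<and> T \<le> real k)"
    have k0: "F k0 \<le> l" "T \<le> real k0" using False LeastI_ex[of "\<lambda>k. F k \<le> l \<and> T \<le> real k"] unfolding k0_def by auto
    have "{k. F k \<le> l \<and> T \<le> real k} \<subseteq> {k0..k0 + nat \<lfloor>B * (1+l)\<rfloor>}"
    proof safe
      fix m assume m: "F m \<le> l" "T \<le> real m"
      have km: "k0 \<le> m" unfolding k0_def using m by (intro Least_le) auto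
      have "real (m - k0) \<le> B * (1+l)" by (rule gap_bound) (use l k0 m km T_def in auto)
      then have "m - k0 \<le> nat \<lfloor>B * (1+l)\<rfloor>" by (simp add: le_nat_floor)
      then show "m \<in> {k0..k0 + nat \<lfloor>B * (1+l)\<rfloor>}" using km by auto
    qed
    moreover have "real (card {k0..k0 + nat \<lfloor>B * (1+l)\<rfloor>}) \<le> B * (1+l) + 1" using B0 by simp
    ultimately show ?thesis by blast
  qed
  then obtain I where I: "finite I" "real (card I) \<le> B * (1+l) + 1" "{k. F k \<le> l \<and> T \<le> real k} \<subseteq> I" by blast
  have sub: "{k. F k \<le> l} \<subseteq> {..nat \<lfloor>T\<rfloor>} \<union> I"
  proof
    fix k assume "k \<in> {k. F k \<le> l}"
    then show "k \<in> {..nat \<lfloor>T\<rfloor>} \<union> I" using I(3) le_nat_floor[of k T] by (cases "T \<le> real k") auto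
  qed
  show "finite {k. F k \<le> l}" by (rule finite_subset[OF sub]) (use I in auto)
  have "card {k. F k \<le> l} \<le> card ({..nat \<lfloor>T\<rfloor>} \<union> I)" using sub I by (intro card_mono) auto
  also have "\<dots> \<le> card {..nat \<lfloor>T\<rfloor>} + card I" by (rule card_Un_le)
  finally have "real (card {k. F k \<le> l}) \<le> real (card {..nat \<lfloor>T\<rfloor>}) + real (card I)" by linarith
  also have "\<dots> \<le> T + B * (1+l) + 2" using c1 I by simp
  also have "\<dots> \<le> G * (1+l)" unfolding G_def T_def using l by (simp add: algebra_simps)
  finally show "real (card {k. F k \<le> l}) \<le> G * (1 + l)" .
qed

text \<open>A layer-cake sum: level m of \<open>F\<close> carries weight exp(-c m) and contains at
  most G (1 + m) indices, so linear growth meets geometric decay. The bound involves neither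
  \<open>P\<close> nor \<open>E\<close> nor \<open>N\<close>.\<close>

lemma exp_sum_le:
  assumes c: "0 < c"
  shows "(\<Sum>k<N. exp (c * (S k powr q' - real k))) \<le> exp (c * (b + 1)) * (G * (\<Sum>m. (1 + real m) * exp (- c) ^ m))"
proof -
  \<comment> \<open>Negative values of \<open>F\<close> are clipped to 0. By \<open>F_ge\<close> the
    clipping costs at most \<open>b\<close>, and rounding up costs at most 1, whence the factor
    \<open>exp (c * (b + 1))\<close>.\<close>
  define g where "g k = nat \<lceil>F k\<rceil>" for k
  define M where "M = Max (insert 0 (g ` {..<N}))"
  have gM: "g k \<le> M" if "k < N" for k unfolding M_def using that by (intro Max_ge) auto
  have G0: "0 \<le> G" using sublevel_card(2)[of 0] of_nat_0_le_iff[of "card {k. F k \<le> 0}"] by simp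
  have gF: "F k \<le> real (g k)" for k unfolding g_def by linarith
  have *: "exp (c * (S k powr q' - real k)) \<le> exp (c * (b + 1)) * exp (- c) ^ g k" for k
  proof -
    have "c * (S k powr q' - real k) = c * (- F k)" unfolding F_def by (simp add: algebra_simps)
    also have "\<dots> \<le> c * (b + 1 - real (g k))"
    proof (intro mult_left_mono)
      show "- F k \<le> b + 1 - real (g k)"
      proof (cases "0 \<le> F k")
        case True
        then have "real (g k) \<le> F k + 1" unfolding g_def by linarith
        then show ?thesis using bnn by linarith
      next
        case False
        then have "g k = 0" unfolding g_def by auto
        then show ?thesis using F_ge[of k] by simp
      qed
    qed (use c in auto)
    also have "\<dots> = c * (b + 1) + real (g k) * (- c)" by (simp add: algebra_simps)
    finally show ?thesis by (simp add: exp_add[symmetric] exp_of_nat_mult[symmetric])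
  qed
  have summ: "summable (\<lambda>m. (1 + real m) * exp (- c) ^ m)"
    using termdiff_converges[of "exp (-c)" 1 "\<lambda>_. 1"] c by (simp add: diffs_def summable_geometric)
  have "(\<Sum>k<N. exp (c * (S k powr q' - real k))) \<le> (\<Sum>k<N. exp (c * (b + 1)) * exp (- c) ^ g k)"
    by (intro sum_mono *)
  also have "\<dots> = exp (c * (b+1)) * (\<Sum>k<N. exp (- c) ^ g k)" by (simp add: sum_distrib_left)
  also have "\<dots> \<le> exp (c * (b+1)) * (G * (\<Sum>m. (1 + real m) * exp (- c) ^ m))"
  proof (intro mult_left_mono)
    \<comment> \<open>Each weight is kept as the term m = g k of a sum over all levels m with F k
      \<le> m. After the swap the inner sum only counts indices.\<close>
    have "(\<Sum>k<N. exp (- c) ^ g k) \<le> (\<Sum>k<N. \<Sum>m\<le>M. if F k \<le> real m then exp (-c) ^ m else 0)"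
    proof (intro sum_mono)
      fix k assume "k \<in> {..<N}"
      then have "(if F k \<le> real (g k) then exp (-c) ^ g k else 0) \<le> (\<Sum>m\<le>M. if F k \<le> real m then exp (-c) ^ m else 0)"
        using gM by (intro member_le_sum) auto
      then show "exp (- c) ^ g k \<le> (\<Sum>m\<le>M. if F k \<le> real m then exp (-c) ^ m else 0)" using gF by simp
    qed
    also have "\<dots> = (\<Sum>m\<le>M. \<Sum>k<N. if F k \<le> real m then exp (-c) ^ m else 0)" by (rule sum.swap)
    also have "\<dots> \<le> (\<Sum>m\<le>M. G * ((1 + real m) * exp (-c) ^ m))"
    proof (intro sum_mono)
      fix m
      have "(\<Sum>k<N. if F k \<le> real m then exp (-c) ^ m else 0) = (\<Sum>k | k < N \<and> F k \<le> real m. exp (-c) ^ m)"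
        by (simp add: sum.If_cases Int_def)
      also have "\<dots> = real (card {k. k < N \<and> F k \<le> real m}) * exp (-c) ^ m" by simp
      also have "\<dots> \<le> real (card {k. F k \<le> real m}) * exp (-c) ^ m"
        using sublevel_card(1)[of "real m"] by (intro mult_right_mono of_nat_mono card_mono) auto
      also have "\<dots> \<le> G * (1 + real m) * exp (-c) ^ m"
        using sublevel_card(2)[of "real m"] by (intro mult_right_mono) auto
      finally show "(\<Sum>k<N. if F k \<le> real m then exp (-c) ^ m else 0) \<le> G * ((1 + real m) * exp (-c) ^ m)" by simp
    qed
    also have "\<dots> = G * (\<Sum>m\<le>M. (1 + real m) * exp (-c) ^ m)" by (simp add: sum_distrib_left)
    also have "\<dots> \<le> G * (\<Sum>m. (1 + real m) * exp (-c) ^ m)"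
      using summ G0 by (intro mult_left_mono sum_le_suminf) auto
    finally show "(\<Sum>k<N. exp (- c) ^ g k) \<le> G * (\<Sum>m. (1 + real m) * exp (-c) ^ m)" .
  qed simp
  finally show ?thesis .
qed

end

subsection \<open>Inequalities for nonnegative integrals\<close>

lemma nn_integral_holder_pos:
  fixes f g :: "'a \<Rightarrow> real"
  assumes pq: "1 < p" "1 < q" "1 / p + 1 / q = 1"
    and [measurable]: "f \<in> borel_measurable M" "g \<in> borel_measurable M"
    and nn: "\<And>x. 0 \<le> f x" "\<And>x. 0 \<le> g x" and AB: "0 < A" "0 < B"
    and f: "(\<integral>\<^sup>+ x. ennreal (f x powr p) \<partial>M) \<le> ennreal (A powr p)"
    and g: "(\<integral>\<^sup>+ x. ennreal (g x powr q) \<partial>M) \<le> ennreal (B powr q)"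
  shows "(\<integral>\<^sup>+ x. ennreal (f x * g x) \<partial>M) \<le> ennreal (A * B)"
proof -
  \<comment> \<open>The weights come from Young's inequality for f / A and g / B, multiplied back by
    A * B.\<close>
  define a where "a = A * B / (p * A powr p)"
  define b where "b = A * B / (q * B powr q)"
  have ab: "0 \<le> a" "0 \<le> b" unfolding a_def b_def using AB pq by auto
  have pt: "f x * g x \<le> a * f x powr p + b * g x powr q" for x
  proof -
    have "(f x / A) * (g x / B) \<le> (f x / A) powr p / p + (g x / B) powr q / q"
      using nn AB pq by (intro Youngs_inequality) auto
    then have "A * B * ((f x / A) * (g x / B)) \<le> A * B * ((f x / A) powr p / p + (g x / B) powr q / q)"
      using AB by (intro mult_left_mono) auto
    also have "A * B * ((f x / A) * (g x / B)) = f x * g x" using AB by simp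
    also have "A * B * ((f x / A) powr p / p + (g x / B) powr q / q) = a * f x powr p + b * g x powr q"
      unfolding a_def b_def using nn AB by (simp add: powr_divide field_simps)
    finally show ?thesis .
  qed
  have "(\<integral>\<^sup>+ x. ennreal (f x * g x) \<partial>M) \<le> (\<integral>\<^sup>+ x. ennreal a * ennreal (f x powr p) + ennreal b * ennreal (g x powr q) \<partial>M)"
    using pt ab by (intro nn_integral_mono) (simp add: ennreal_mult[symmetric] ennreal_plus[symmetric] del: ennreal_plus)
  also have "\<dots> = ennreal a * (\<integral>\<^sup>+ x. ennreal (f x powr p) \<partial>M) + ennreal b * (\<integral>\<^sup>+ x. ennreal (g x powr q) \<partial>M)"
    by (simp add: nn_integral_add nn_integral_cmult)
  also have "\<dots> \<le> ennreal a * ennreal (A powr p) + ennreal b * ennreal (B powr q)"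
    using f g by (intro add_mono mult_left_mono) auto
  also have "\<dots> = ennreal (a * A powr p + b * B powr q)"
    using ab by (simp add: ennreal_mult[symmetric] ennreal_plus[symmetric] del: ennreal_plus)
  also have "a * A powr p + b * B powr q = A * B * (1 / p + 1 / q)"
    unfolding a_def b_def using AB pq by (simp add: field_simps)
  finally show ?thesis using pq by simp
qed

lemma ennreal_le_of_right_limit:
  fixes x :: ennreal and f :: "real \<Rightarrow> real"
  assumes "\<And>e. 0 < e \<Longrightarrow> x \<le> ennreal (f e)" "(f \<longlongrightarrow> l) (at_right 0)"
  shows "x \<le> ennreal l"
proof (rule tendsto_lowerbound[of "\<lambda>e. ennreal (f e)" _ "at_right (0::real)"])
  show "((\<lambda>e. ennreal (f e)) \<longlongrightarrow> ennreal l) (at_right 0)" using assms(2) by (intro tendsto_ennrealI)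
  show "\<forall>\<^sub>F e in at_right 0. x \<le> ennreal (f e)"
    using assms(1) by (auto simp: eventually_at_right_field intro!: exI[of _ 1])
qed simp

text \<open>The bounds may vanish, which happens for blocks carrying no energy. They are increased
  by e > 0, and e tends to 0.\<close>

lemma nn_integral_holder:
  fixes f g :: "'a \<Rightarrow> real"
  assumes pq: "1 < p" "1 < q" "1 / p + 1 / q = 1"
    and meas: "f \<in> borel_measurable M" "g \<in> borel_measurable M"
    and nn: "\<And>x. 0 \<le> f x" "\<And>x. 0 \<le> g x" and AB: "0 \<le> A" "0 \<le> B"
    and f: "(\<integral>\<^sup>+ x. ennreal (f x powr p) \<partial>M) \<le> ennreal A"
    and g: "(\<integral>\<^sup>+ x. ennreal (g x powr q) \<partial>M) \<le> ennreal B"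
  shows "(\<integral>\<^sup>+ x. ennreal (f x * g x) \<partial>M) \<le> ennreal (A powr (1/p) * B powr (1/q))"
proof (rule ennreal_le_of_right_limit)
  fix e :: real assume e: "0 < e"
  show "(\<integral>\<^sup>+ x. ennreal (f x * g x) \<partial>M) \<le> ennreal ((A + e) powr (1/p) * (B + e) powr (1/q))"
  proof (rule nn_integral_holder_pos[OF pq meas nn])
    show "(\<integral>\<^sup>+ x. ennreal (f x powr p) \<partial>M) \<le> ennreal (((A + e) powr (1/p)) powr p)"
      using f AB e pq by (auto simp: powr_powr intro: order_trans ennreal_leI)
    show "(\<integral>\<^sup>+ x. ennreal (g x powr q) \<partial>M) \<le> ennreal (((B + e) powr (1/q)) powr q)"
      using g AB e pq by (auto simp: powr_powr intro: order_trans ennreal_leI)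
  qed (use AB e in auto)
next
  have "((\<lambda>e. (A + e) powr (1/p) * (B + e) powr (1/q)) \<longlongrightarrow> (A + 0) powr (1/p) * (B + 0) powr (1/q)) (at_right 0)"
    using pq AB by (intro tendsto_intros tendsto_powr') (auto simp: eventually_at_right_field intro!: exI[of _ 1])
  then show "((\<lambda>e. (A + e) powr (1/p) * (B + e) powr (1/q)) \<longlongrightarrow> A powr (1/p) * B powr (1/q)) (at_right 0)"
    by simp
qed

lemma nn_integral_powr_0:
  fixes a c :: real
  assumes "a < 1" "0 \<le> c"
  shows "(\<integral>\<^sup>+ z. ennreal (z powr (- a)) * indicator {0<..<c} z \<partial>lborel) = ennreal (c powr (1 - a) / (1 - a))"
proof -
  have "((\<lambda>z. z powr (- a)) has_integral (c powr (1 - a) / (1 - a))) {0..c}"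
    using has_integral_powr_from_0[of "-a" c] assms by simp
  then have 1: "((\<lambda>z. if z \<in> {0..c} then z powr (- a) else 0) has_integral (c powr (1 - a) / (1 - a))) UNIV"
    by (subst has_integral_restrict_UNIV)
  have "(\<integral>\<^sup>+ z. ennreal (z powr (- a)) * indicator {0<..<c} z \<partial>lborel)
      = (\<integral>\<^sup>+ z. ennreal (if z \<in> {0..c} then z powr (- a) else 0) \<partial>lborel)"
  proof (rule nn_integral_cong_AE)
    show "AE z in lborel. ennreal (z powr (- a)) * indicator {0<..<c} z = ennreal (if z \<in> {0..c} then z powr (- a) else 0)"
      using AE_lborel_singleton[of c] AE_lborel_singleton[of 0]
      by eventually_elim (auto simp: indicator_def)
  qed
  also have "\<dots> = ennreal (c powr (1 - a) / (1 - a))"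
    by (intro nn_integral_has_integral_lborel 1) auto
  finally show ?thesis .
qed

lemma nn_integral_inverse_Icc:
  fixes a b :: real
  assumes "0 < a" "a \<le> b"
  shows "(\<integral>\<^sup>+ z. ennreal (1 / z) * indicator {a..b} z \<partial>lborel) = ennreal (ln (b / a))"
proof -
  have "(\<integral>\<^sup>+ z. ennreal (1 / z) * indicator {a..b} z \<partial>lborel) = ennreal (ln b - ln a)"
    using assms by (intro nn_integral_FTC_Icc) (auto intro!: derivative_eq_intros DERIV_subset[OF DERIV_ln_divide] simp: has_real_derivative_iff_has_vector_derivative[symmetric])
  then show ?thesis using assms by (simp add: ln_div)
qed

section \<open>Layer-cake formulas and rearrangement\<close>

text \<open>Writes an extended value as the length of an interval, so that a minimum of two
  distribution functions becomes an integral of a product of indicators.\<close>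

lemma nn_integral_layer:
  fixes a :: ennreal
  shows "(\<integral>\<^sup>+ z. indicator {z. 0 < z \<and> ennreal z < a} z \<partial>lborel) = a"
proof (cases a)
  case (real r)
  have "{z. 0 < z \<and> ennreal z < a} = {0<..<r}" using real by (auto simp: ennreal_less_iff)
  then show ?thesis using real by simp
next
  case top
  have "{z. 0 < z \<and> ennreal z < a} = {0<..}" using top by auto
  moreover have "emeasure lborel {0::real<..} = top"
  proof (rule ccontr)
    assume "emeasure lborel {0::real<..} \<noteq> top"
    then obtain x where x: "emeasure lborel {0::real<..} = ennreal x" "0 \<le> x"
      by (cases "emeasure lborel {0::real<..}") auto
    have "emeasure lborel {0<..x+1} \<le> emeasure lborel {0::real<..}" by (intro emeasure_mono) auto
    then show False using x by simp
  qed
  ultimately show ?thesis using top by simp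
qed

lemma nn_integral_layer_real:
  fixes a :: real
  shows "(\<integral>\<^sup>+ z. indicator {z. 0 < z \<and> z < a} z \<partial>lborel) = ennreal a"
proof (cases "0 \<le> a")
  case True
  have "{z. 0 < z \<and> z < a} = {0<..<a}" by auto
  then show ?thesis using True by simp
next
  case False
  then have "{z. 0 < z \<and> z < a} = {}" by auto
  then show ?thesis using False by (simp add: ennreal_neg)
qed

lemma measurable_distribution [measurable]:
  fixes H :: "'a \<Rightarrow> real"
  assumes "sigma_finite_measure M" and [measurable]: "H \<in> borel_measurable M"
  shows "(\<lambda>s. emeasure M {y \<in> space M. s < H y}) \<in> borel_measurable borel"
proof -
  interpret sigma_finite_measure M by fact
  have "(\<lambda>s. emeasure M {y \<in> space M. (s, y) \<in> {sy \<in> space (borel \<Otimes>\<^sub>M M). fst sy < H (snd sy)}}) \<in> borel_measurable borel"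
    using measurable_emeasure_Pair[of "{sy \<in> space (borel \<Otimes>\<^sub>M M). fst sy < H (snd sy)}" borel]
    by (simp add: space_pair_measure vimage_def Int_def)
  then show ?thesis by (simp add: space_pair_measure cong: conj_cong)
qed

text \<open>The majorants stand for decreasing rearrangements, of which only one inequality is ever needed.\<close>

lemma hardy_littlewood:
  fixes H K :: "'a \<Rightarrow> real" and r \<kappa> :: "real \<Rightarrow> real"
  assumes sf: "sigma_finite_measure M"
    and [measurable]: "H \<in> borel_measurable M" "K \<in> borel_measurable M" "r \<in> borel_measurable borel" "\<kappa> \<in> borel_measurable borel"
    and nn: "\<And>y. 0 \<le> H y" "\<And>y. 0 \<le> K y"
    and r: "\<And>z s. 0 < z \<Longrightarrow> 0 < s \<Longrightarrow> ennreal z < emeasure M {y \<in> space M. s < H y} \<Longrightarrow> s \<le> r z"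
    and \<kappa>: "\<And>z s. 0 < z \<Longrightarrow> 0 < s \<Longrightarrow> ennreal z < emeasure M {y \<in> space M. s < K y} \<Longrightarrow> s \<le> \<kappa> z"
  shows "(\<integral>\<^sup>+ y. ennreal (H y * K y) \<partial>M) \<le> (\<integral>\<^sup>+ z. ennreal (r z) * ennreal (\<kappa> z) * indicator {0<..} z \<partial>lborel)"
proof -
  interpret sigma_finite_measure M by fact
  interpret LM: pair_sigma_finite lborel M by (simp add: pair_sigma_finite_def sf sigma_finite_lborel)
  define mH where "mH s = emeasure M {y \<in> space M. s < H y}" for s
  define mK where "mK s = emeasure M {y \<in> space M. s < K y}" for s
  have [measurable]: "mH \<in> borel_measurable borel" "mK \<in> borel_measurable borel"
    unfolding mH_def mK_def using sf by (auto intro!: measurable_distribution)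
  define a where "a s y = (indicator {s. 0 < s \<and> s < H y} s :: ennreal)" for s y
  define b where "b s y = (indicator {s. 0 < s \<and> s < K y} s :: ennreal)" for s y
  define c where "c z s = (indicator {z. 0 < z \<and> ennreal z < mH s} z :: ennreal)" for z s
  define d where "d z s = (indicator {z. 0 < z \<and> ennreal z < mK s} z :: ennreal)" for z s
  \<comment> \<open>Levels s \<le> 0 contribute nothing to \<open>a\<close> and \<open>b\<close>,
    but \<open>c\<close> and \<open>d\<close> need not vanish there. The factor \<open>P\<close>
    removes them before the order of integration changes.\<close>
  define P where "P s = (indicator {0<..} s :: ennreal)" for s :: real
  have [measurable]: "(\<lambda>(s,y). a s y) \<in> borel_measurable (lborel \<Otimes>\<^sub>M M)" "(\<lambda>(s,y). b s y) \<in> borel_measurable (lborel \<Otimes>\<^sub>M M)"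
    "(\<lambda>(z,s). c z s) \<in> borel_measurable (lborel \<Otimes>\<^sub>M lborel)" "(\<lambda>(z,s). d z s) \<in> borel_measurable (lborel \<Otimes>\<^sub>M lborel)"
    "P \<in> borel_measurable borel"
    unfolding a_def b_def c_def d_def P_def indicator_def by measurable
  have [measurable]: "(\<lambda>z. c z s) \<in> borel_measurable borel" "(\<lambda>z. d z s) \<in> borel_measurable borel"
    "(\<lambda>s. c z s) \<in> borel_measurable borel" "(\<lambda>s. d z s) \<in> borel_measurable borel" for s z
    unfolding c_def d_def indicator_def by measurable
  have "(\<integral>\<^sup>+ y. ennreal (H y * K y) \<partial>M) = (\<integral>\<^sup>+ y. (\<integral>\<^sup>+ s. a s y \<partial>lborel) * (\<integral>\<^sup>+ t. b t y \<partial>lborel) \<partial>M)"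
    unfolding a_def b_def nn_integral_layer_real using nn by (simp add: ennreal_mult)
  also have "\<dots> = (\<integral>\<^sup>+ y. (\<integral>\<^sup>+ s. (\<integral>\<^sup>+ t. a s y * b t y \<partial>lborel) \<partial>lborel) \<partial>M)"
  proof (intro nn_integral_cong)
    fix y
    have [measurable]: "(\<lambda>s. a s y) \<in> borel_measurable borel" "(\<lambda>s. b s y) \<in> borel_measurable borel"
      unfolding a_def b_def indicator_def by measurable
    show "(\<integral>\<^sup>+ s. a s y \<partial>lborel) * (\<integral>\<^sup>+ t. b t y \<partial>lborel) = (\<integral>\<^sup>+ s. (\<integral>\<^sup>+ t. a s y * b t y \<partial>lborel) \<partial>lborel)"
      by (simp add: nn_integral_cmult nn_integral_multc)
  qed
  also have "\<dots> = (\<integral>\<^sup>+ s. (\<integral>\<^sup>+ y. (\<integral>\<^sup>+ t. a s y * b t y \<partial>lborel) \<partial>M) \<partial>lborel)"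
    by (rule LM.Fubini') measurable
  also have "\<dots> = (\<integral>\<^sup>+ s. (\<integral>\<^sup>+ t. (\<integral>\<^sup>+ y. a s y * b t y \<partial>M) \<partial>lborel) \<partial>lborel)"
    by (intro nn_integral_cong LM.Fubini') measurable
  \<comment> \<open>The only inequality of the rearrangement itself: an intersection of superlevel
    sets has at most the smaller of the two measures.\<close>
  also have "\<dots> \<le> (\<integral>\<^sup>+ s. (\<integral>\<^sup>+ t. P s * P t * (\<integral>\<^sup>+ z. c z s * d z t \<partial>lborel) \<partial>lborel) \<partial>lborel)"
  proof (intro nn_integral_mono)
    fix s t :: real
    have "(\<integral>\<^sup>+ y. a s y * b t y \<partial>M) \<le> P s * P t * min (mH s) (mK t)"
    proof (cases "0 < s \<and> 0 < t")
      case True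
      have "(\<integral>\<^sup>+ y. a s y * b t y \<partial>M) = (\<integral>\<^sup>+ y. indicator ({y \<in> space M. s < H y} \<inter> {y \<in> space M. t < K y}) y \<partial>M)"
        unfolding a_def b_def using True by (intro nn_integral_cong) (auto simp: indicator_def)
      also have "\<dots> = emeasure M ({y \<in> space M. s < H y} \<inter> {y \<in> space M. t < K y})"
        by (intro nn_integral_indicator) measurable
      also have "\<dots> \<le> min (mH s) (mK t)" unfolding mH_def mK_def by (auto intro!: emeasure_mono)
      finally show ?thesis using True by (simp add: P_def)
    next
      case False
      then have ab0: "a s y * b t y = 0" for y unfolding a_def b_def by (auto simp: indicator_def)
      show ?thesis unfolding ab0 by simp
    qed
    also have "min (mH s) (mK t) = (\<integral>\<^sup>+ z. indicator {z. 0 < z \<and> ennreal z < min (mH s) (mK t)} z \<partial>lborel)"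
      by (rule nn_integral_layer[symmetric])
    also have "\<dots> = (\<integral>\<^sup>+ z. c z s * d z t \<partial>lborel)"
      unfolding c_def d_def by (intro nn_integral_cong) (auto simp: indicator_def)
    finally show "(\<integral>\<^sup>+ y. a s y * b t y \<partial>M) \<le> P s * P t * (\<integral>\<^sup>+ z. c z s * d z t \<partial>lborel)" .
  qed
  also have "\<dots> = (\<integral>\<^sup>+ s. (\<integral>\<^sup>+ t. (\<integral>\<^sup>+ z. P s * P t * (c z s * d z t) \<partial>lborel) \<partial>lborel) \<partial>lborel)"
    by (intro nn_integral_cong nn_integral_cmult[symmetric]) measurable
  also have "\<dots> = (\<integral>\<^sup>+ s. (\<integral>\<^sup>+ z. (\<integral>\<^sup>+ t. P s * P t * (c z s * d z t) \<partial>lborel) \<partial>lborel) \<partial>lborel)"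
    by (intro nn_integral_cong lborel_pair.Fubini') measurable
  also have "\<dots> = (\<integral>\<^sup>+ z. (\<integral>\<^sup>+ s. (\<integral>\<^sup>+ t. P s * P t * (c z s * d z t) \<partial>lborel) \<partial>lborel) \<partial>lborel)"
    by (rule lborel_pair.Fubini') measurable
  also have "\<dots> = (\<integral>\<^sup>+ z. (\<integral>\<^sup>+ s. (\<integral>\<^sup>+ t. (P s * c z s) * (P t * d z t) \<partial>lborel) \<partial>lborel) \<partial>lborel)"
    by (intro nn_integral_cong) (simp only: ac_simps)
  also have "\<dots> = (\<integral>\<^sup>+ z. (\<integral>\<^sup>+ s. P s * c z s \<partial>lborel) * (\<integral>\<^sup>+ t. P t * d z t \<partial>lborel) \<partial>lborel)"
  proof (intro nn_integral_cong)
    fix z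
    have "(\<integral>\<^sup>+ s. (\<integral>\<^sup>+ t. (P s * c z s) * (P t * d z t) \<partial>lborel) \<partial>lborel)
        = (\<integral>\<^sup>+ s. (P s * c z s) * (\<integral>\<^sup>+ t. P t * d z t \<partial>lborel) \<partial>lborel)"
      by (intro nn_integral_cong nn_integral_cmult) measurable
    also have "\<dots> = (\<integral>\<^sup>+ s. P s * c z s \<partial>lborel) * (\<integral>\<^sup>+ t. P t * d z t \<partial>lborel)"
      by (intro nn_integral_multc) measurable
    finally show "(\<integral>\<^sup>+ s. (\<integral>\<^sup>+ t. (P s * c z s) * (P t * d z t) \<partial>lborel) \<partial>lborel)
        = (\<integral>\<^sup>+ s. P s * c z s \<partial>lborel) * (\<integral>\<^sup>+ t. P t * d z t \<partial>lborel)" .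
  qed
  also have "\<dots> \<le> (\<integral>\<^sup>+ z. ennreal (r z) * ennreal (\<kappa> z) * indicator {0<..} z \<partial>lborel)"
  proof (intro nn_integral_mono)
    fix z :: real
    have 1: "(\<integral>\<^sup>+ s. P s * c z s \<partial>lborel) \<le> ennreal (r z)" if "0 < z"
    proof -
      \<comment> \<open>For fixed z, every positive level s whose superlevel set has measure above z
        is at most r z, so these levels fill a set of length at most r z.\<close>
      have "(\<integral>\<^sup>+ s. P s * c z s \<partial>lborel) \<le> (\<integral>\<^sup>+ s. indicator {0..r z} s \<partial>lborel)"
        using r[of z] that by (intro nn_integral_mono) (auto simp: indicator_def P_def c_def mH_def)
      also have "\<dots> = ennreal (r z)" by (cases "0 \<le> r z") (auto simp: ennreal_neg)
      finally show ?thesis .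
    qed
    have 2: "(\<integral>\<^sup>+ s. P s * d z s \<partial>lborel) \<le> ennreal (\<kappa> z)" if "0 < z"
    proof -
      have "(\<integral>\<^sup>+ s. P s * d z s \<partial>lborel) \<le> (\<integral>\<^sup>+ s. indicator {0..\<kappa> z} s \<partial>lborel)"
        using \<kappa>[of z] that by (intro nn_integral_mono) (auto simp: indicator_def P_def d_def mK_def)
      also have "\<dots> = ennreal (\<kappa> z)" by (cases "0 \<le> \<kappa> z") (auto simp: ennreal_neg)
      finally show ?thesis .
    qed
    show "(\<integral>\<^sup>+ s. P s * c z s \<partial>lborel) * (\<integral>\<^sup>+ t. P t * d z t \<partial>lborel) \<le> ennreal (r z) * ennreal (\<kappa> z) * indicator {0<..} z"
    proof (cases "0 < z")
      case True
      then show ?thesis using mult_mono[OF 1 2] by simp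
    qed (simp add: c_def)
  qed
  finally show ?thesis .
qed

text \<open>The case K = 1 of the previous inequality. The constant 1 is a majorant because
  superlevel sets at levels s \<ge> 1 are empty.\<close>

lemma nn_integral_le_majorant:
  fixes H :: "'a \<Rightarrow> real" and r :: "real \<Rightarrow> real"
  assumes sf: "sigma_finite_measure M"
    and m: "H \<in> borel_measurable M" "r \<in> borel_measurable borel"
    and nn: "\<And>y. 0 \<le> H y"
    and r: "\<And>z s. 0 < z \<Longrightarrow> 0 < s \<Longrightarrow> ennreal z < emeasure M {y \<in> space M. s < H y} \<Longrightarrow> s \<le> r z"
  shows "(\<integral>\<^sup>+ y. ennreal (H y) \<partial>M) \<le> (\<integral>\<^sup>+ z. ennreal (r z) * indicator {0<..} z \<partial>lborel)"
proof -
  have "(\<integral>\<^sup>+ y. ennreal (H y * 1) \<partial>M) \<le> (\<integral>\<^sup>+ z. ennreal (r z) * ennreal 1 * indicator {0<..} z \<partial>lborel)"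
  proof (rule hardy_littlewood[OF sf m(1) _ m(2) _ nn _ r])
    fix z s :: real
    assume "ennreal z < emeasure M {y \<in> space M. s < 1}"
    then show "s \<le> 1" by (cases "s < 1") auto
  qed auto
  then show ?thesis by simp
qed

subsection \<open>Riesz kernels and Lorentz functions\<close>

lemma nn_integral_inverse_Ico:
  fixes a b :: real
  assumes "0 < a" "a \<le> b"
  shows "(\<integral>\<^sup>+ z. ennreal (1 / z) * indicator {a..<b} z \<partial>lborel) = ennreal (ln (b / a))"
proof -
  have "(\<integral>\<^sup>+ z. ennreal (1 / z) * indicator {a..<b} z \<partial>lborel) = (\<integral>\<^sup>+ z. ennreal (1 / z) * indicator {a..b} z \<partial>lborel)"
  proof (rule nn_integral_cong_AE)
    show "AE z in lborel. ennreal (1 / z) * indicator {a..<b} z = ennreal (1 / z) * indicator {a..b} z"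
      using AE_lborel_singleton[of b] by eventually_elim (auto simp: indicator_def)
  qed
  then show ?thesis using nn_integral_inverse_Icc[OF assms] by simp
qed

section \<open>Volumes of balls and power kernels\<close>

definition unit_vol :: "'n::finite itself \<Rightarrow> real" where
  "unit_vol _ = measure lebesgue (ball (0 :: real ^ 'n) 1)"

lemma unit_vol_pos: "0 < unit_vol TYPE('n::finite)"
  unfolding unit_vol_def by (simp add: content_ball_pos)

lemma emeasure_ball_unit_vol:
  fixes x :: "real ^ 'n"
  assumes "0 \<le> r" shows "emeasure lborel (ball x r) = ennreal (unit_vol TYPE('n) * r powr real CARD('n))"
proof (cases "r = 0")
  case False
  then show ?thesis using assms unfolding unit_vol_def
    by (simp add: emeasure_ball content_ball powr_realpow)
qed simp

lemma riesz_kernel_majorant: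
  fixes x :: "real ^ 'n"
  assumes a: "0 < \<alpha>" "\<alpha> < real CARD('n)" and z: "0 < z" and t: "0 < t"
    and less: "ennreal z < emeasure lborel {y. t < norm (x - y) powr (\<alpha> - real CARD('n))}"
  shows "t \<le> (z / unit_vol TYPE('n)) powr ((\<alpha> - real CARD('n)) / real CARD('n))"
proof -
  let ?n = "real CARD('n)" and ?w = "unit_vol TYPE('n)"
  define \<rho> where "\<rho> = t powr (1 / (\<alpha> - ?n))"
  have \<rho>: "0 < \<rho>" using t unfolding \<rho>_def by simp
  have n: "0 < ?n" using a by linarith
  have "{y. t < norm (x - y) powr (\<alpha> - ?n)} \<subseteq> ball x \<rho>"
  proof
    fix y assume "y \<in> {y. t < norm (x - y) powr (\<alpha> - ?n)}"
    then have ty: "t < norm (x - y) powr (\<alpha> - ?n)" by simp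
    \<comment> \<open>The centre y = x lies in no superlevel set, since 0 raised to any power is 0
      for \<open>powr\<close>.\<close>
    have pos: "0 < norm (x - y)"
    proof (rule ccontr)
      assume "\<not> 0 < norm (x - y)"
      then have "norm (x - y) = 0" by simp
      then show False using ty t by simp
    qed
    have "(norm (x - y) powr (\<alpha> - ?n)) powr (1 / (\<alpha> - ?n)) < t powr (1 / (\<alpha> - ?n))"
      using a t ty by (intro powr_less_mono2_neg) (auto simp: divide_neg_neg)
    then have "norm (x - y) < \<rho>" unfolding \<rho>_def using pos a by (simp add: powr_powr)
    then show "y \<in> ball x \<rho>" by (simp add: dist_norm)
  qed
  then have "emeasure lborel {y. t < norm (x - y) powr (\<alpha> - ?n)} \<le> emeasure lborel (ball x \<rho>)"
    by (intro emeasure_mono) auto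
  then have "ennreal z < ennreal (?w * \<rho> powr ?n)" using less \<rho> emeasure_ball_unit_vol[of \<rho> x] by simp
  then have "z / ?w < \<rho> powr ?n" using z unit_vol_pos[where 'n='n] by (simp add: ennreal_less_iff field_simps)
  then have "(\<rho> powr ?n) powr ((\<alpha> - ?n) / ?n) \<le> (z / ?w) powr ((\<alpha> - ?n) / ?n)"
    using a n z unit_vol_pos[where 'n='n] by (intro powr_mono2') (auto simp: divide_nonpos_pos)
  moreover have "(\<rho> powr ?n) powr ((\<alpha> - ?n) / ?n) = t"
    unfolding \<rho>_def using a n t by (simp add: powr_powr)
  ultimately show ?thesis by simp
qed

text \<open>A superlevel set of the truncated kernel lies in the ball of radius \<delta> and in that
  of radius s^(-1/a). Growth of order d on these balls yields the majorant C^(a/d) z^(-a/d) on (0,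
  T), integrable as a < d. The lemma is used both for nu with exponent d and for Lebesgue measure
  with exponent n.\<close>

lemma nn_integral_kernel_ball:
  fixes M :: "(real ^ 'n) measure"
  assumes sf: "sigma_finite_measure M" and [measurable_cong]: "sets M = sets borel"
    and growth: "\<And>\<rho>. 0 < \<rho> \<Longrightarrow> emeasure M (ball y \<rho>) \<le> ennreal (C * \<rho> powr d)"
    and C: "0 < C" and a: "0 < a" "a < d" and \<delta>: "0 < \<delta>"
  shows "(\<integral>\<^sup>+ x. ennreal (norm (x - y) powr (- a)) * indicator (ball y \<delta>) x \<partial>M)
           \<le> ennreal (C / (1 - a / d) * \<delta> powr (d - a))"
proof -
  have space: "space M = UNIV" using sets_eq_imp_space_eq[OF assms(2)] by simp
  define H where "H x = norm (x - y) powr (- a) * indicator (ball y \<delta>) x" for x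
  define T where "T = C * \<delta> powr d"
  have T: "0 < T" unfolding T_def using C \<delta> by simp
  define r where "r z = (C powr (a/d) * z powr (- (a / d))) * indicator {0<..<T} z" for z :: real
  have "H \<in> borel_measurable borel" unfolding H_def by (intro borel_measurable_times borel_measurable_indicator) auto
  then have [measurable]: "H \<in> borel_measurable M" by measurable
  have [measurable]: "r \<in> borel_measurable borel" unfolding r_def by measurable
  have ad: "a / d < 1" "0 < a / d" "0 < d" using a by auto
  have "(\<integral>\<^sup>+ x. ennreal (H x) \<partial>M) \<le> (\<integral>\<^sup>+ z. ennreal (r z) * indicator {0<..} z \<partial>lborel)"
  proof (rule nn_integral_le_majorant[OF sf])
    show "0 \<le> H x" for x unfolding H_def by simp
    fix z s :: real assume z: "0 < z" and s: "0 < s" and less: "ennreal z < emeasure M {x \<in> space M. s < H x}"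
    have 1: "{x \<in> space M. s < H x} \<subseteq> ball y \<delta>" unfolding H_def using s by (auto simp: indicator_def split: if_splits)
    have 2: "{x \<in> space M. s < H x} \<subseteq> ball y (s powr (- (1/a)))"
    proof
      fix x assume "x \<in> {x \<in> space M. s < H x}"
      then have sx: "s < norm (x - y) powr (- a)" unfolding H_def using s
        by (cases "x \<in> ball y \<delta>") auto
      have pos: "0 < norm (x - y)"
      proof (rule ccontr)
        assume "\<not> 0 < norm (x - y)"
        then have "norm (x - y) = 0" by simp
        then show False using sx s by simp
      qed
      have "(norm (x - y) powr (- a)) powr (- (1/a)) < s powr (- (1/a))"
        using a s sx by (intro powr_less_mono2_neg) auto
      then have "norm (x - y) < s powr (- (1/a))" using pos a by (simp add: powr_powr)
      then show "x \<in> ball y (s powr (- (1/a)))" by (simp add: dist_norm norm_minus_commute)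
    qed
    have "ennreal z < ennreal T"
      using less emeasure_mono[OF 1, of M] growth[OF \<delta>] unfolding T_def by (auto simp: assms(2))
    then have zT: "z < T" using z by (simp add: ennreal_less_iff)
    have "ennreal z < ennreal (C * (s powr (- (1/a))) powr d)"
      using less emeasure_mono[OF 2, of M] growth[of "s powr (- (1/a))"] s by (auto simp: assms(2))
    then have "z / C < s powr (- (d/a))" using z C by (simp add: ennreal_less_iff powr_powr field_simps)
    then have "(s powr (- (d/a))) powr (- (a/d)) \<le> (z / C) powr (- (a/d))"
      using z C ad by (intro powr_mono2') auto
    moreover have "(s powr (- (d/a))) powr (- (a/d)) = s" using s ad a by (simp add: powr_powr)
    moreover have "(z / C) powr (- (a/d)) = C powr (a/d) * z powr (- (a / d))"
      using z C by (simp add: powr_divide powr_minus divide_simps)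
    ultimately show "s \<le> r z" unfolding r_def using z zT by simp
  qed measurable
  also have "\<dots> = (\<integral>\<^sup>+ z. ennreal (C powr (a/d)) * (ennreal (z powr (- (a / d))) * indicator {0<..<T} z) \<partial>lborel)"
    unfolding r_def by (intro nn_integral_cong) (auto simp: indicator_def ennreal_mult)
  also have "\<dots> = ennreal (C powr (a/d)) * (\<integral>\<^sup>+ z. ennreal (z powr (- (a / d))) * indicator {0<..<T} z \<partial>lborel)"
    by (intro nn_integral_cmult) measurable
  also have "\<dots> = ennreal (C powr (a/d) * (T powr (1 - a/d) / (1 - a/d)))"
    using nn_integral_powr_0[of "a/d" T] ad T C
    by (simp add: ennreal_mult'[symmetric] order_less_imp_le del: times_divide_eq_right)
  also have "C powr (a/d) * (T powr (1 - a/d) / (1 - a/d)) = C / (1 - a / d) * \<delta> powr (d - a)"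
  proof -
    have "T powr (1 - a/d) = C powr (1 - a/d) * \<delta> powr (d - a)"
      unfolding T_def using C \<delta> ad by (simp add: powr_mult powr_powr right_diff_distrib)
    moreover have "C powr (a/d) * C powr (1 - a/d) = C" using C by (simp add: powr_add[symmetric])
    ultimately show ?thesis by (simp add: mult.assoc[symmetric])
  qed
  finally show ?thesis unfolding H_def by (simp add: ennreal_mult ennreal_indicator)
qed

text \<open>\<open>R\<close> plays the role of the decreasing rearrangement of \<open>h\<close>; the scale \<open>\<tau> k\<close> measures volume, not radius.\<close>

locale lorentz_majorant =
  fixes h :: "real ^ 'n \<Rightarrow> real" and R :: "real \<Rightarrow> real" and n \<alpha> q q' V w :: real
  assumes n_def: "n = real CARD('n)" and w_def: "w = unit_vol TYPE('n)"
    and \<alpha>: "0 < \<alpha>" "\<alpha> < n" and q: "1 < q" and q': "q' = q / (q - 1)" and V: "0 < V"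
    and h_meas [measurable]: "h \<in> borel_measurable borel" and h_nn: "\<And>y. 0 \<le> h y"
    and R_meas [measurable]: "R \<in> borel_measurable borel" and R_nn: "\<And>z. 0 \<le> R z"
    and R_dec: "\<And>z z'. 0 < z \<Longrightarrow> z \<le> z' \<Longrightarrow> R z' \<le> R z"
    and R_maj: "\<And>z s. 0 < z \<Longrightarrow> 0 < s \<Longrightarrow> ennreal z < emeasure lborel {y. s < h y} \<Longrightarrow> s \<le> R z"
    and h_supp: "\<And>s. 0 < s \<Longrightarrow> emeasure lborel {y. s < h y} \<le> ennreal V"
    and R_norm: "(\<integral>\<^sup>+ z. ennreal ((z powr (\<alpha> / n) * R z) powr q / z) * indicator {0<..<V} z \<partial>lborel) \<le> 1"
begin

lemma n_pos: "0 < n" using \<alpha> by simp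
lemma w_pos: "0 < w" unfolding w_def by (rule unit_vol_pos)
lemma conj_q: "1 < q'" "1/q + 1/q' = 1" "0 < 1/q" "0 < 1/q'" "1/q < 1"
  using q unfolding q' by (auto simp: field_simps)

definition W where "W z = (z powr (\<alpha> / n) * R z) powr q / z"
definition \<tau> where "\<tau> k = V * exp (- real k)" for k :: nat
text \<open>The q-th power of the quantity eps k of the overview. This form is additive over blocks
  of scales.\<close>

definition E where "E k = enn2real (\<integral>\<^sup>+ z. ennreal (W z) * indicator {0<..<\<tau> k} z \<partial>lborel)"
definition Q where "Q k = (\<integral>\<^sup>+ z. ennreal (R z * z powr (\<alpha> / n - 1)) * indicator {\<tau> k..<V} z \<partial>lborel)"
definition P where "P k = enn2real (Q k)"

lemma W_meas [measurable]: "W \<in> borel_measurable borel" unfolding W_def by measurable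

lemma \<tau>: "0 < \<tau> k" "\<tau> k \<le> V" "\<tau> 0 = V" "k \<le> m \<Longrightarrow> \<tau> m \<le> \<tau> k" unfolding \<tau>_def using V by auto

lemma E_eq: "(\<integral>\<^sup>+ z. ennreal (W z) * indicator {0<..<\<tau> k} z \<partial>lborel) = ennreal (E k)" "E k \<le> 1" "0 \<le> E k"
proof -
  have "(\<integral>\<^sup>+ z. ennreal (W z) * indicator {0<..<\<tau> k} z \<partial>lborel) \<le> (\<integral>\<^sup>+ z. ennreal (W z) * indicator {0<..<V} z \<partial>lborel)"
    using \<tau>(2)[of k] by (intro nn_integral_mono mult_left_mono) (auto simp: indicator_def)
  also have "\<dots> \<le> 1" using R_norm unfolding W_def .
  finally have *: "(\<integral>\<^sup>+ z. ennreal (W z) * indicator {0<..<\<tau> k} z \<partial>lborel) \<le> 1" .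
  then show "(\<integral>\<^sup>+ z. ennreal (W z) * indicator {0<..<\<tau> k} z \<partial>lborel) = ennreal (E k)"
    unfolding E_def by (subst ennreal_enn2real) (auto simp: less_top[symmetric] top_unique)
  with * show "E k \<le> 1" by (metis ennreal_le_1)
  show "0 \<le> E k" unfolding E_def by simp
qed

lemma W_interval:
  assumes "k \<le> m"
  shows "(\<integral>\<^sup>+ z. ennreal (W z) * indicator {\<tau> m..<\<tau> k} z \<partial>lborel) = ennreal (E k - E m)" "E m \<le> E k"
proof -
  let ?I = "\<integral>\<^sup>+ z. ennreal (W z) * indicator {\<tau> m..<\<tau> k} z \<partial>lborel"
  have "ennreal (E k) = (\<integral>\<^sup>+ z. ennreal (W z) * indicator {0<..<\<tau> m} z + ennreal (W z) * indicator {\<tau> m..<\<tau> k} z \<partial>lborel)"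
    unfolding E_eq(1)[symmetric] using \<tau>(1)[of m] \<tau>(4)[OF assms] by (intro nn_integral_cong) (auto simp: indicator_def)
  also have "\<dots> = ennreal (E m) + ?I" by (subst nn_integral_add) (auto simp: E_eq)
  finally have *: "ennreal (E k) = ennreal (E m) + ?I" .
  then obtain x where x: "?I = ennreal x" "0 \<le> x" by (cases ?I) auto
  have "E k = E m + x" using * x E_eq(3)[of m] E_eq(3)[of k] by (simp add: ennreal_plus[symmetric] del: ennreal_plus)
  then show "?I = ennreal (E k - E m)" "E m \<le> E k" using x by auto
qed

lemma log_interval:
  assumes "k \<le> m"
  shows "(\<integral>\<^sup>+ z. ennreal (1 / z) * indicator {\<tau> m..<\<tau> k} z \<partial>lborel) = ennreal (real (m - k))"
proof -
  have "\<tau> k / \<tau> m = exp (real (m - k))" unfolding \<tau>_def using V assms by (simp add: exp_minus exp_diff of_nat_diff field_simps)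
  then show ?thesis using nn_integral_inverse_Ico[OF \<tau>(1) \<tau>(4)[OF assms]] by simp
qed

text \<open>Hoelder with respect to dz/z: the energy of the block is the q-th power of one factor,
  and the other one is the logarithmic length m - k of the block. This is the source of
  \<open>Pinc\<close>.\<close>

lemma main_interval:
  assumes "k \<le> m"
  shows "(\<integral>\<^sup>+ z. ennreal (R z * z powr (\<alpha> / n - 1)) * indicator {\<tau> m..<\<tau> k} z \<partial>lborel)
           \<le> ennreal (real (m - k) powr (1/q') * (E k - E m) powr (1/q))"
proof -
  define f where "f z = z powr (\<alpha>/n) * R z * z powr (- (1/q)) * indicator {\<tau> m..<\<tau> k} z" for z
  define g where "g z = z powr (- (1/q')) * indicator {\<tau> m..<\<tau> k} z" for z :: real
  have pos: "0 < z" if "z \<in> {\<tau> m..<\<tau> k}" for z using that \<tau>(1)[of m] by auto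
  have "(\<integral>\<^sup>+ z. ennreal (R z * z powr (\<alpha> / n - 1)) * indicator {\<tau> m..<\<tau> k} z \<partial>lborel) = (\<integral>\<^sup>+ z. ennreal (f z * g z) \<partial>lborel)"
  proof (intro nn_integral_cong)
    fix z
    show "ennreal (R z * z powr (\<alpha> / n - 1)) * indicator {\<tau> m..<\<tau> k} z = ennreal (f z * g z)"
    proof (cases "z \<in> {\<tau> m..<\<tau> k}")
      case True
      have "z powr (\<alpha>/n) * z powr (- (1/q)) * z powr (- (1/q')) = z powr (\<alpha>/n - (1/q + 1/q'))"
        by (simp add: powr_add[symmetric] algebra_simps)
      then have "z powr (\<alpha>/n) * z powr (- (1/q)) * z powr (- (1/q')) = z powr (\<alpha>/n - 1)" unfolding conj_q .
      then show ?thesis using True unfolding f_def g_def by (simp add: mult_ac)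
    qed (auto simp: f_def)
  qed
  also have "\<dots> \<le> ennreal ((E k - E m) powr (1/q) * real (m - k) powr (1/q'))"
  proof (rule nn_integral_holder)
    have "ennreal (f z powr q) = ennreal (W z) * indicator {\<tau> m..<\<tau> k} z" for z
      using pos[of z] q R_nn[of z] unfolding f_def W_def
      by (auto simp: indicator_def powr_mult powr_powr powr_minus_divide powr_divide)
    then show "(\<integral>\<^sup>+ z. ennreal (f z powr q) \<partial>lborel) \<le> ennreal (E k - E m)"
      using W_interval(1)[OF assms] by simp
    have "ennreal (g z powr q') = ennreal (1 / z) * indicator {\<tau> m..<\<tau> k} z" for z
      using pos[of z] conj_q unfolding g_def by (auto simp: indicator_def powr_powr powr_minus_divide powr_divide)
    then show "(\<integral>\<^sup>+ z. ennreal (g z powr q') \<partial>lborel) \<le> ennreal (real (m - k))"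
      using log_interval[OF assms] by simp
  qed (use q conj_q W_interval(2)[OF assms] R_nn in \<open>auto simp: f_def g_def\<close>)
  finally show ?thesis by (simp add: mult.commute)
qed

lemma Q_split: assumes "k \<le> m"
  shows "Q m = Q k + (\<integral>\<^sup>+ z. ennreal (R z * z powr (\<alpha> / n - 1)) * indicator {\<tau> m..<\<tau> k} z \<partial>lborel)"
proof -
  have "Q m = (\<integral>\<^sup>+ z. ennreal (R z * z powr (\<alpha> / n - 1)) * indicator {\<tau> k..<V} z + ennreal (R z * z powr (\<alpha> / n - 1)) * indicator {\<tau> m..<\<tau> k} z \<partial>lborel)"
    unfolding Q_def using \<tau>(2)[of k] \<tau>(4)[OF assms] by (intro nn_integral_cong) (auto simp: indicator_def)
  then show ?thesis unfolding Q_def by (subst (asm) nn_integral_add) auto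
qed

lemma Q_eq: "Q k = ennreal (P k)" "0 \<le> P k" "Q 0 = 0" "P 0 = 0"
proof -
  show Q0: "Q 0 = 0" unfolding Q_def \<tau>(3) by simp
  then show "P 0 = 0" unfolding P_def by simp
  have "Q k < top" using Q_split[of 0 k] main_interval[of 0 k] Q0 by (simp add: order_le_less_trans)
  then show "Q k = ennreal (P k)" unfolding P_def by simp
  show "0 \<le> P k" unfolding P_def by simp
qed

lemma P_increment: assumes "k \<le> m" shows "P m \<le> P k + real (m - k) powr (1/q') * (E k - E m) powr (1/q)"
proof -
  have "ennreal (P m) \<le> ennreal (P k) + ennreal (real (m - k) powr (1/q') * (E k - E m) powr (1/q))"
    using Q_split[OF assms] main_interval[OF assms] unfolding Q_eq by (simp add: add_left_mono)
  then show ?thesis using Q_eq(2) by (simp add: ennreal_plus[symmetric] del: ennreal_plus)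
qed

text \<open>As R decreases, its value at s is a lower bound on [s/e, s). This interval has
  logarithmic length 1 and lies in the range of \<open>E k\<close>, so the energy there controls R
  s. Moving from s/e to s costs the factor exp(\<alpha>/n).\<close>

lemma R_pointwise:
  assumes s: "0 < s" "s \<le> \<tau> k"
  shows "R s \<le> exp (\<alpha>/n) * E k powr (1/q) * s powr (- (\<alpha>/n))"
proof -
  define B where "B = ((s / exp 1) powr (\<alpha>/n) * R s) powr q"
  have se: "0 < s / exp 1" "s / exp 1 \<le> s" using s by (auto simp: divide_le_eq)
  have "ennreal B = ennreal B * (\<integral>\<^sup>+ z. ennreal (1 / z) * indicator {s / exp 1..<s} z \<partial>lborel)"
    using nn_integral_inverse_Ico[OF se] s by simp
  also have "\<dots> = (\<integral>\<^sup>+ z. ennreal B * (ennreal (1 / z) * indicator {s / exp 1..<s} z) \<partial>lborel)"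
    by (intro nn_integral_cmult[symmetric]) measurable
  also have "\<dots> \<le> (\<integral>\<^sup>+ z. ennreal (W z) * indicator {0<..<\<tau> k} z \<partial>lborel)"
  proof (intro nn_integral_mono)
    fix z
    show "ennreal B * (ennreal (1 / z) * indicator {s / exp 1..<s} z) \<le> ennreal (W z) * indicator {0<..<\<tau> k} z"
    proof (cases "z \<in> {s / exp 1..<s}")
      case True
      then have z: "0 < z" "z < \<tau> k" using order_less_le_trans[OF se(1)] s by auto
      have "(s / exp 1) powr (\<alpha>/n) * R s \<le> z powr (\<alpha>/n) * R z"
        using True z \<alpha> n_pos se R_nn R_dec[of z s] by (intro mult_mono powr_mono2) auto
      then have "B \<le> (z powr (\<alpha>/n) * R z) powr q" unfolding B_def using q R_nn by (intro powr_mono2) auto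
      then have "B * (1/z) \<le> W z" unfolding W_def using z by (simp add: divide_right_mono)
      then have "ennreal (B * (1/z)) \<le> ennreal (W z)" by (rule ennreal_leI)
      then show ?thesis using True z by (simp add: ennreal_mult''[symmetric])
    qed simp
  qed
  finally have "ennreal B \<le> ennreal (E k)" unfolding E_eq .
  then have "B \<le> E k" using E_eq(3) by simp
  then have "B powr (1/q) \<le> E k powr (1/q)" using q unfolding B_def by (intro powr_mono2) auto
  then have 1: "(s / exp 1) powr (\<alpha>/n) * R s \<le> E k powr (1/q)" unfolding B_def using q R_nn se by (simp add: powr_powr)
  have "(s / exp 1) powr (\<alpha>/n) = s powr (\<alpha>/n) / exp (\<alpha>/n)" using s by (simp add: powr_divide exp_powr_real)
  with 1 have "s powr (\<alpha>/n) * R s \<le> exp (\<alpha>/n) * E k powr (1/q)" by (simp add: field_simps)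
  then show ?thesis using s by (simp add: powr_minus field_simps)
qed

text \<open>The level \<open>lam k\<close> is subtracted rather than used as a cut-off, so that the rearrangement of the
  upper part vanishes beyond \<open>\<tau> k\<close> without any right-continuity of distribution functions.\<close>

definition lam where "lam k = R (\<tau> k)"
definition f1 where "f1 k y = max (h y - lam k) 0"
definition f2 where "f2 k y = min (h y) (lam k)"
lemma lam_nn: "0 \<le> lam k" unfolding lam_def using R_nn .
lemma f_meas [measurable]: "f1 k \<in> borel_measurable borel" "f2 k \<in> borel_measurable borel"
  unfolding f1_def f2_def by measurable
lemma f_split: "h y = f2 k y + f1 k y" "0 \<le> f1 k y" "0 \<le> f2 k y"
  unfolding f1_def f2_def using h_nn lam_nn by (auto simp: min_def max_def)

text \<open>Above \<tau> k the rearrangement keeps R untouched, so \<open>P k\<close> appears with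
  the sharp constant. Below \<tau> k the truncation at \<open>lam k\<close> leaves an integrable
  power of z, and \<open>R_pointwise\<close> at s = \<tau> k bounds its contribution by the
  remaining energy.\<close>

lemma low_part:
  "(\<integral>\<^sup>+ y. ennreal (f2 k y * norm (x - y) powr (\<alpha> - n)) \<partial>lborel)
     \<le> ennreal (w powr ((n - \<alpha>) / n) * (P k + n / \<alpha> * exp (\<alpha>/n) * E k powr (1/q)))"
proof -
  let ?c = "w powr ((n - \<alpha>) / n)"
  define r where "r z = min (R z) (lam k) * indicator {0<..<V} z" for z
  define \<kappa> where "\<kappa> z = (z / w) powr ((\<alpha> - n) / n)" for z
  have [measurable]: "r \<in> borel_measurable borel" "\<kappa> \<in> borel_measurable borel" unfolding r_def \<kappa>_def by measurable
  have "(\<integral>\<^sup>+ y. ennreal (f2 k y * norm (x - y) powr (\<alpha> - n)) \<partial>lborel)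
      \<le> (\<integral>\<^sup>+ z. ennreal (r z) * ennreal (\<kappa> z) * indicator {0<..} z \<partial>lborel)"
  proof (rule hardy_littlewood)
    fix z s :: real assume z: "0 < z" and s: "0 < s"
    assume less: "ennreal z < emeasure lborel {y \<in> space lborel. s < norm (x - y) powr (\<alpha> - n)}"
    show "s \<le> \<kappa> z" unfolding \<kappa>_def w_def n_def
      by (rule riesz_kernel_majorant) (use \<alpha> z s less n_def in auto)
  next
    fix z s :: real assume z: "0 < z" and s: "0 < s"
    assume less: "ennreal z < emeasure lborel {y \<in> space lborel. s < f2 k y}"
    have sl: "s < lam k" using less unfolding f2_def by (cases "s < lam k") auto
    have eq: "{y \<in> space lborel. s < f2 k y} = {y. s < h y}" unfolding f2_def using sl by auto
    have "s \<le> R z" by (rule R_maj) (use z s less eq in auto)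
    moreover have "ennreal z < ennreal V" using less h_supp[OF s] unfolding eq by (rule order_less_le_trans)
    then have "z < V" using z by (simp add: ennreal_less_iff)
    ultimately show "s \<le> r z" unfolding r_def using sl z by simp
  qed (auto simp: f_split sigma_finite_lborel)
  also have "\<dots> \<le> (\<integral>\<^sup>+ z. ennreal ?c * (ennreal (lam k) * (ennreal (z powr (- (1 - \<alpha>/n))) * indicator {0<..<\<tau> k} z)
       + ennreal (R z * z powr (\<alpha> / n - 1)) * indicator {\<tau> k..<V} z) \<partial>lborel)"
  proof (intro nn_integral_mono)
    fix z :: real
    have \<kappa>: "\<kappa> z = ?c * z powr (\<alpha>/n - 1)" if "0 < z"
    proof -
      have e: "(\<alpha> - n) / n = \<alpha>/n - 1" "(n - \<alpha>) / n = - (\<alpha>/n - 1)" using n_pos by (auto simp: field_simps)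
      have "\<kappa> z = z powr (\<alpha>/n - 1) / w powr (\<alpha>/n - 1)" unfolding \<kappa>_def e using that w_pos by (simp add: powr_divide)
      then show ?thesis unfolding e powr_minus_divide by simp
    qed
    have \<kappa>0: "0 \<le> \<kappa> z" unfolding \<kappa>_def by simp
    have e: "- (1 - \<alpha>/n) = \<alpha>/n - 1" by simp
    consider "z \<le> 0 \<or> V \<le> z" | "0 < z" "z < \<tau> k" | "0 < z" "\<tau> k \<le> z" "z < V" by linarith
    then show "ennreal (r z) * ennreal (\<kappa> z) * indicator {0<..} z \<le> ennreal ?c * (ennreal (lam k) * (ennreal (z powr (- (1 - \<alpha>/n))) * indicator {0<..<\<tau> k} z)
       + ennreal (R z * z powr (\<alpha> / n - 1)) * indicator {\<tau> k..<V} z)"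
    proof cases
      case 1
      then show ?thesis unfolding r_def by (auto simp: indicator_def)
    next
      case 2
      have "r z * \<kappa> z \<le> lam k * \<kappa> z"
        using 2 \<tau>(2)[of k] \<kappa>0 unfolding r_def by (intro mult_right_mono) auto
      also have "\<dots> = ?c * (lam k * z powr (\<alpha>/n - 1))" unfolding \<kappa>[OF 2(1)] by simp
      finally have "ennreal (r z * \<kappa> z) \<le> ennreal (?c * (lam k * z powr (\<alpha>/n - 1)))" by (rule ennreal_leI)
      then show ?thesis using 2 lam_nn \<kappa>0 unfolding e by (simp add: ennreal_mult' ennreal_mult'')
    next
      case 3
      have "r z * \<kappa> z \<le> R z * \<kappa> z"
        using 3 \<kappa>0 unfolding r_def by (intro mult_right_mono) auto
      also have "\<dots> = ?c * (R z * z powr (\<alpha>/n - 1))" unfolding \<kappa>[OF 3(1)] by simp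
      finally have "ennreal (r z * \<kappa> z) \<le> ennreal (?c * (R z * z powr (\<alpha>/n - 1)))" by (rule ennreal_leI)
      then show ?thesis using 3 R_nn \<kappa>0 by (simp add: ennreal_mult' ennreal_mult'')
    qed
  qed
  also have "\<dots> = ennreal ?c * (ennreal (lam k) * (\<integral>\<^sup>+ z. ennreal (z powr (- (1 - \<alpha>/n))) * indicator {0<..<\<tau> k} z \<partial>lborel) + Q k)"
    unfolding Q_def by (simp add: nn_integral_cmult nn_integral_add)
  also have "\<dots> = ennreal (?c * (lam k * (\<tau> k powr (\<alpha>/n) / (\<alpha>/n)) + P k))"
  proof -
    have "(\<integral>\<^sup>+ z. ennreal (z powr (- (1 - \<alpha>/n))) * indicator {0<..<\<tau> k} z \<partial>lborel) = ennreal (\<tau> k powr (\<alpha>/n) / (\<alpha>/n))"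
      using nn_integral_powr_0[of "1 - \<alpha>/n" "\<tau> k"] \<alpha> n_pos \<tau>(1)[of k] by (simp add: order_less_imp_le)
    moreover have "0 \<le> lam k * (\<tau> k powr (\<alpha>/n) / (\<alpha>/n))" using lam_nn \<alpha> n_pos by simp
    ultimately show ?thesis unfolding Q_eq using lam_nn \<alpha> n_pos Q_eq(2)[of k]
      by (simp add: ennreal_mult[symmetric] ennreal_plus[symmetric] del: ennreal_plus)
  qed
  also have "\<dots> \<le> ennreal (?c * (P k + n / \<alpha> * exp (\<alpha>/n) * E k powr (1/q)))"
  proof (intro ennreal_leI mult_left_mono)
    have "lam k \<le> exp (\<alpha>/n) * E k powr (1/q) * \<tau> k powr (- (\<alpha>/n))"
      unfolding lam_def by (rule R_pointwise) (use \<tau> in auto)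
    then have "lam k * \<tau> k powr (\<alpha>/n) \<le> exp (\<alpha>/n) * E k powr (1/q) * \<tau> k powr (- (\<alpha>/n)) * \<tau> k powr (\<alpha>/n)"
      by (intro mult_right_mono) auto
    also have "\<dots> = exp (\<alpha>/n) * E k powr (1/q)" using \<tau>(1)[of k] by (simp add: powr_minus mult.assoc)
    finally have "n/\<alpha> * (lam k * \<tau> k powr (\<alpha>/n)) \<le> n/\<alpha> * (exp (\<alpha>/n) * E k powr (1/q))"
      using \<alpha> n_pos by (intro mult_left_mono) auto
    then show "lam k * (\<tau> k powr (\<alpha>/n) / (\<alpha>/n)) + P k \<le> P k + n / \<alpha> * exp (\<alpha>/n) * E k powr (1/q)"
      by (simp add: field_simps)
  qed simp
  finally show ?thesis .
qed

text \<open>The rearrangement of \<open>f1 k\<close> lives on (0, \<tau> k) and is at most R, hence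
  at most a multiple of z^(-\<alpha>/n). Its r-th power is integrable since r * \<alpha> < n. The
  exponent r > 1 serves near the singularity of the kernel, r = 1 away from it.\<close>

lemma high_part_power:
  assumes r: "1 \<le> r" "r * \<alpha> < n"
  shows "(\<integral>\<^sup>+ y. ennreal (f1 k y powr r) \<partial>lborel)
     \<le> ennreal ((exp (\<alpha>/n) * E k powr (1/q)) powr r * (\<tau> k powr (1 - r * \<alpha> / n) / (1 - r * \<alpha> / n)))"
proof -
  let ?c = "exp (\<alpha>/n) * E k powr (1/q)"
  define g where "g z = ?c powr r * z powr (- (r * \<alpha>/n)) * indicator {0<..<\<tau> k} z" for z
  have [measurable]: "g \<in> borel_measurable borel" unfolding g_def by measurable
  have "(\<integral>\<^sup>+ y. ennreal (f1 k y powr r) \<partial>lborel) \<le> (\<integral>\<^sup>+ z. ennreal (g z) * indicator {0<..} z \<partial>lborel)"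
  proof (rule nn_integral_le_majorant)
    fix z s :: real assume z: "0 < z" and s: "0 < s"
    assume less: "ennreal z < emeasure lborel {y \<in> space lborel. s < f1 k y powr r}"
    have "{y \<in> space lborel. s < f1 k y powr r} \<subseteq> {y. lam k + s powr (1/r) < h y}"
    proof safe
      fix y assume "s < f1 k y powr r"
      then have "s powr (1/r) < (f1 k y powr r) powr (1/r)" using s r by (intro powr_less_mono2) auto
      also have "\<dots> = f1 k y" using f_split r by (simp add: powr_powr)
      finally show "lam k + s powr (1/r) < h y" unfolding f1_def using powr_ge_zero[of s "1/r"] by (simp add: max_def split: if_splits)
    qed
    then have less': "ennreal z < emeasure lborel {y. lam k + s powr (1/r) < h y}"
      using less emeasure_mono[of "{y \<in> space lborel. s < f1 k y powr r}" "{y. lam k + s powr (1/r) < h y}" lborel]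
      by (auto intro: order_less_le_trans)
    have "lam k + s powr (1/r) \<le> R z" by (rule R_maj) (use z s less' lam_nn in \<open>auto intro: add_nonneg_pos\<close>)
    moreover have "0 < s powr (1/r)" using s by simp
    ultimately have sR: "s powr (1/r) \<le> R z" "lam k < R z" using lam_nn[of k] by linarith+
    \<comment> \<open>R exceeds its value \<open>lam k\<close> at \<tau> k strictly, so monotonicity
      places z to the left of \<tau> k.\<close>
    have zt: "z < \<tau> k" using sR(2) R_dec[of "\<tau> k" z] \<tau>(1)[of k] unfolding lam_def by (meson not_le)
    have "s = (s powr (1/r)) powr r" using s r by (simp add: powr_powr)
    also have "\<dots> \<le> (R z) powr r" using sR r by (intro powr_mono2) auto
    also have "\<dots> \<le> (?c * z powr (- (\<alpha>/n))) powr r"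
      using R_pointwise[of z k] z zt R_nn r by (intro powr_mono2) auto
    also have "\<dots> = g z" unfolding g_def using z zt by (simp add: powr_mult powr_powr mult.commute)
    finally show "s \<le> g z" .
  qed (auto simp: sigma_finite_lborel)
  also have "\<dots> = (\<integral>\<^sup>+ z. ennreal (?c powr r) * (ennreal (z powr (- (r * \<alpha>/n))) * indicator {0<..<\<tau> k} z) \<partial>lborel)"
    unfolding g_def by (intro nn_integral_cong) (auto simp: indicator_def ennreal_mult)
  also have "\<dots> = ennreal (?c powr r) * (\<integral>\<^sup>+ z. ennreal (z powr (- (r * \<alpha>/n))) * indicator {0<..<\<tau> k} z \<partial>lborel)"
    by (intro nn_integral_cmult) measurable
  also have "\<dots> = ennreal (?c powr r * (\<tau> k powr (1 - r * \<alpha> / n) / (1 - r * \<alpha> / n)))"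
    using nn_integral_powr_0[of "r * \<alpha>/n" "\<tau> k"] r n_pos \<tau>(1)[of k]
    by (simp add: ennreal_mult'[symmetric] order_less_imp_le del: times_divide_eq_right)
  finally show ?thesis .
qed

end

subsection \<open>Exponential integrability with respect to a growth measure\<close>

text \<open>Markov's inequality including the level L = 0, which occurs when no energy is left. The
  integral then vanishes and G is zero almost everywhere.\<close>

lemma markov_level:
  fixes G :: "'a \<Rightarrow> ennreal"
  assumes [measurable]: "G \<in> borel_measurable M" and L: "0 \<le> L" and K: "0 \<le> K"
    and int: "(\<integral>\<^sup>+ x. G x \<partial>M) \<le> ennreal (K * L)"
  shows "emeasure M {x \<in> space M. ennreal L < G x} \<le> ennreal K"
proof (cases "L = 0")
  case True
  then have "(\<integral>\<^sup>+ x. G x \<partial>M) = 0" using int by simp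
  then have "AE x in M. G x = 0" by (subst (asm) nn_integral_0_iff_AE) auto
  then have "emeasure M {x \<in> space M. \<not> G x = 0} = 0" by (subst (asm) AE_iff_measurable) auto
  moreover have "{x \<in> space M. \<not> G x = 0} = {x \<in> space M. ennreal L < G x}" using True by (auto simp: zero_less_iff_neq_zero)
  ultimately show ?thesis by simp
next
  case False
  then have L: "0 < L" using L by simp
  have "emeasure M {x \<in> space M. ennreal L < G x} \<le> emeasure M {x \<in> space M. 1 \<le> ennreal (1 / L) * G x}"
  proof (intro emeasure_mono subsetI)
    fix x assume "x \<in> {x \<in> space M. ennreal L < G x}"
    then have "x \<in> space M" "ennreal L \<le> G x" by auto
    then have "ennreal (1 / L) * ennreal L \<le> ennreal (1 / L) * G x" by (intro mult_left_mono) auto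
    moreover have "ennreal (1 / L) * ennreal L = 1" using L by (simp add: ennreal_mult[symmetric])
    ultimately show "x \<in> {x \<in> space M. 1 \<le> ennreal (1 / L) * G x}" using \<open>x \<in> space M\<close> by simp
  qed simp
  also have "\<dots> \<le> ennreal (1 / L) * (\<integral>\<^sup>+ x. G x * indicator (space M) x \<partial>M)"
    by (rule nn_integral_Markov_inequality) auto
  also have "(\<integral>\<^sup>+ x. G x * indicator (space M) x \<partial>M) = (\<integral>\<^sup>+ x. G x \<partial>M)"
    by (intro nn_integral_cong) auto
  also have "ennreal (1 / L) * (\<integral>\<^sup>+ x. G x \<partial>M) \<le> ennreal (1 / L) * ennreal (K * L)"
    using int by (intro mult_left_mono) auto
  also have "\<dots> = ennreal K" using L K by (simp add: ennreal_mult[symmetric])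
  finally show ?thesis .
qed

text \<open>Puts the constant in front of the quantifiers over \<open>P\<close> and
  \<open>E\<close>. The maximum with 0 gives its sign without having to exhibit an admissible pair
  of sequences.\<close>

lemma adams_sum:
  assumes "0 < c"
  shows "\<exists>C\<ge>0. \<forall>P E. adams_seq q q' D P E \<longrightarrow>
           (\<forall>N. (\<Sum>k<N. exp (c * ((P k + D * E k powr (1/q)) powr q' - real k))) \<le> C)"
proof -
  let ?C = "exp (c * (adams_seq.b q' D + 1)) * (adams_seq.G q q' D * (\<Sum>m. (1 + real m) * exp (- c) ^ m))"
  have "(\<Sum>k<N. exp (c * ((P k + D * E k powr (1/q)) powr q' - real k))) \<le> max ?C 0"
    if "adams_seq q q' D P E" for P E N
    using adams_seq.exp_sum_le[OF that assms, of N] adams_seq.S_def[OF that] by simp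
  then show ?thesis by (intro exI[of _ "max ?C 0"]) auto
qed

locale lorentz_trace = lorentz_majorant h R n \<alpha> q q' V w
  for h :: "real ^ 'n \<Rightarrow> real" and R :: "real \<Rightarrow> real" and n \<alpha> q q' V w :: real +
  fixes \<nu> :: "(real ^ 'n) measure" and d C' r :: real
  assumes sets_nu [measurable_cong]: "sets \<nu> = sets borel" and sf_nu: "sigma_finite_measure \<nu>"
    and growth: "\<And>y \<rho>. 0 < \<rho> \<Longrightarrow> emeasure \<nu> (ball y \<rho>) \<le> ennreal (C' * \<rho> powr d)"
    and d: "0 < d" "d \<le> n" and C': "0 < C'"
    and r: "1 < r" "r * \<alpha> < n" "n - d < r * \<alpha>"
begin

text \<open>The singularity of the kernel is shared as \<open>n - \<alpha> = a / r + b / r'\<close>, where \<open>a < d\<close> makes the first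
  factor integrable against \<open>\<nu>\<close> and \<open>b < n\<close> makes the second one integrable against Lebesgue measure;
  such a choice exists because \<open>n - d < r * \<alpha>\<close>.\<close>

definition r' where "r' = r / (r - 1)"
definition t where "t = (n - \<alpha>) / (n - (n - d) / r)"
definition a where "a = t * d"
definition b where "b = t * n"

lemma r_conj: "1 < r'" "1 / r + 1 / r' = 1" "1 / r' = (r - 1) / r"
  using r unfolding r'_def by (auto simp: field_simps)

text \<open>Both \<open>a\<close> and \<open>b\<close> are the same fraction t of their critical
  values d and n, so the single bound t < 1, equivalent to (n - d) / r < \<alpha>, secures both
  integrability conditions.\<close>

lemma t: "0 < t" "t < 1"
proof -
  have "(n - d) / r < \<alpha>" using r by (simp add: field_simps)
  then have 1: "n - \<alpha> < n - (n - d) / r" by simp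
  then show "0 < t" "t < 1" unfolding t_def using \<alpha> by auto
qed

lemma ab: "0 < a" "a < d" "0 < b" "b < n" "a + b * (r - 1) = r * (n - \<alpha>)"
proof -
  show "0 < a" "a < d" "0 < b" "b < n" unfolding a_def b_def using t d n_pos by auto
  have "(n - d) / r < \<alpha>" using r by (simp add: field_simps)
  then have "n - (n - d) / r \<noteq> 0" using \<alpha> by simp
  then have "t * (n - (n - d) / r) = n - \<alpha>" unfolding t_def by simp
  then have "r * (t * (n - (n - d) / r)) = r * (n - \<alpha>)" by simp
  moreover have "r * (t * (n - (n - d) / r)) = a + b * (r - 1)"
    unfolding a_def b_def using r by (simp add: field_simps)
  ultimately show "a + b * (r - 1) = r * (n - \<alpha>)" by simp
qed

lemma space_nu: "space \<nu> = UNIV" using sets_eq_imp_space_eq[OF sets_nu] by simp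

section \<open>Exceptional sets and the upper part of the potential\<close>

definition \<delta> where "\<delta> k = \<tau> k powr (1 / n)"
lemma \<delta>: "0 < \<delta> k" "\<tau> k = \<delta> k powr n" unfolding \<delta>_def using \<tau>(1)[of k] n_pos by (auto simp: powr_powr)

definition near where "near k x y = (if norm (x - y) < \<delta> k then 1 else 0 :: real)" for x y :: "real ^ 'n"
definition G where "G k x = (\<integral>\<^sup>+ y. ennreal (f1 k y powr r * (norm (x - y) powr (- a) * near k x y)) \<partial>lborel)"
text \<open>The threshold serves two purposes: \<open>G_integral\<close> is C2 \<delta>^d times it,
  so Markov gives measure O(\<delta>^d), and its r-th root cancels the power of \<delta> produced by
  the second Hoelder factor in \<open>local_part\<close>, leaving only E^(1/q).\<close>

definition L where "L k = E k powr (r/q) * \<delta> k powr (- ((n - b) * (r - 1)))"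
definition Bad where "Bad k = {x. ennreal (L k) < G k x}"

lemma near_meas [measurable]: "(\<lambda>(x, y). near k x y) \<in> borel_measurable (borel \<Otimes>\<^sub>M borel)"
  unfolding near_def by measurable

lemma G_meas: "G k \<in> borel_measurable borel"
proof -
  have "(\<lambda>(x, y). ennreal (f1 k y powr r * (norm (x - y) powr (- a) * near k x y))) \<in> borel_measurable (borel \<Otimes>\<^sub>M lborel)"
    by measurable
  then show ?thesis unfolding G_def by (rule lborel.borel_measurable_nn_integral)
qed

lemma G_meas' [measurable]: "G k \<in> borel_measurable \<nu>"
  using G_meas by (simp add: measurable_cong_sets[OF sets_nu refl])

lemma Bad_sets: "Bad k \<in> sets \<nu>"
proof -
  have "{x \<in> space \<nu>. ennreal (L k) < G k x} \<in> sets \<nu>" by measurable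
  then show ?thesis unfolding Bad_def space_nu by simp
qed

definition C2 where "C2 = C' / (1 - a / d) * (exp (\<alpha>/n) powr r / (1 - r * \<alpha> / n))"

lemma C2_nn: "0 \<le> C2" unfolding C2_def using C' ab d r n_pos by auto

text \<open>After Fubini, the kernel of order a < d is integrated against nu by the growth
  condition, uniformly in y. What remains is the r-th power integral of \<open>f1 k\<close>.\<close>

lemma G_integral: "(\<integral>\<^sup>+ x. G k x \<partial>\<nu>) \<le> ennreal (C2 * \<delta> k powr d * L k)"
proof -
  interpret pair_sigma_finite \<nu> lborel by (simp add: pair_sigma_finite_def sf_nu sigma_finite_lborel)
  have ra: "r * \<alpha> / n < 1" using r n_pos by simp
  have "(\<integral>\<^sup>+ x. G k x \<partial>\<nu>) = (\<integral>\<^sup>+ y. (\<integral>\<^sup>+ x. ennreal (f1 k y powr r * (norm (x - y) powr (- a) * near k x y)) \<partial>\<nu>) \<partial>lborel)"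
    unfolding G_def by (rule Fubini'[symmetric]) measurable
  also have "\<dots> = (\<integral>\<^sup>+ y. ennreal (f1 k y powr r) * (\<integral>\<^sup>+ x. ennreal (norm (x - y) powr (- a)) * indicator (ball y (\<delta> k)) x \<partial>\<nu>) \<partial>lborel)"
  proof (intro nn_integral_cong)
    fix y
    have "(\<integral>\<^sup>+ x. ennreal (f1 k y powr r * (norm (x - y) powr (- a) * near k x y)) \<partial>\<nu>)
      = (\<integral>\<^sup>+ x. ennreal (f1 k y powr r) * (ennreal (norm (x - y) powr (- a)) * indicator (ball y (\<delta> k)) x) \<partial>\<nu>)"
      unfolding near_def by (intro nn_integral_cong) (auto simp: ennreal_mult' indicator_def dist_norm norm_minus_commute)
    also have "\<dots> = ennreal (f1 k y powr r) * (\<integral>\<^sup>+ x. ennreal (norm (x - y) powr (- a)) * indicator (ball y (\<delta> k)) x \<partial>\<nu>)"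
    proof (rule nn_integral_cmult)
      have "(\<lambda>x. ennreal (norm (x - y) powr (- a)) * indicator (ball y (\<delta> k)) x) \<in> borel_measurable borel"
        by (intro borel_measurable_times_ennreal borel_measurable_indicator) auto
      then show "(\<lambda>x. ennreal (norm (x - y) powr (- a)) * indicator (ball y (\<delta> k)) x) \<in> borel_measurable \<nu>"
        by (simp add: measurable_cong_sets[OF sets_nu refl])
    qed
    finally show "(\<integral>\<^sup>+ x. ennreal (f1 k y powr r * (norm (x - y) powr (- a) * near k x y)) \<partial>\<nu>) = \<dots>" .
  qed
  also have "\<dots> \<le> (\<integral>\<^sup>+ y. ennreal (f1 k y powr r) * ennreal (C' / (1 - a / d) * \<delta> k powr (d - a)) \<partial>lborel)"
    using nn_integral_kernel_ball[OF sf_nu sets_nu growth C' ab(1,2) \<delta>(1)]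
    by (intro nn_integral_mono mult_left_mono) auto
  also have "\<dots> = (\<integral>\<^sup>+ y. ennreal (f1 k y powr r) \<partial>lborel) * ennreal (C' / (1 - a / d) * \<delta> k powr (d - a))"
    by (rule nn_integral_multc) measurable
  also have "\<dots> \<le> ennreal ((exp (\<alpha>/n) * E k powr (1/q)) powr r * (\<tau> k powr (1 - r * \<alpha> / n) / (1 - r * \<alpha> / n)))
      * ennreal (C' / (1 - a / d) * \<delta> k powr (d - a))"
    using high_part_power[of r k] r by (intro mult_right_mono) auto
  also have "\<dots> = ennreal ((exp (\<alpha>/n) * E k powr (1/q)) powr r * (\<tau> k powr (1 - r * \<alpha> / n) / (1 - r * \<alpha> / n))
      * (C' / (1 - a / d) * \<delta> k powr (d - a)))"
    using ra by (intro ennreal_mult[symmetric]) (use C' ab d in auto)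
  also have "(exp (\<alpha>/n) * E k powr (1/q)) powr r * (\<tau> k powr (1 - r * \<alpha> / n) / (1 - r * \<alpha> / n))
      * (C' / (1 - a / d) * \<delta> k powr (d - a)) = C2 * \<delta> k powr d * L k"
  proof -
    have e1: "(exp (\<alpha>/n) * E k powr (1/q)) powr r = exp (\<alpha>/n) powr r * E k powr (r/q)"
      by (simp add: powr_mult powr_powr)
    have "n * (1 - r * \<alpha> / n) = n - r * \<alpha>" using n_pos by (simp add: field_simps)
    then have e2: "\<tau> k powr (1 - r * \<alpha> / n) = \<delta> k powr (n - r * \<alpha>)" unfolding \<delta>(2) by (simp add: powr_powr)
    \<comment> \<open>The bookkeeping of powers of \<delta>. It closes because of a + b (r - 1) = r
      (n - \<alpha>), which is the splitting of the kernel exponent multiplied by r.\<close>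
    have "n - r * \<alpha> + (d - a) = d + - ((n - b) * (r - 1))" using ab(5) by (simp add: algebra_simps)
    then have "\<delta> k powr (n - r * \<alpha>) * \<delta> k powr (d - a) = \<delta> k powr d * \<delta> k powr (- ((n - b) * (r - 1)))"
      unfolding powr_add[symmetric] by (simp only:)
    then have "A * e * (\<delta> k powr (n - r * \<alpha>) / u) * (v * \<delta> k powr (d - a))
        = v * (A / u) * \<delta> k powr d * (e * \<delta> k powr (- ((n - b) * (r - 1))))" for A e u v
      by (simp add: mult.assoc mult.left_commute[of "\<delta> k powr (n - r * \<alpha>)"] mult_ac)
    then show ?thesis unfolding e1 e2 C2_def L_def by (simp only:)
  qed
  finally show ?thesis .
qed

lemma emeasure_Bad: "emeasure \<nu> (Bad k) \<le> ennreal (C2 * \<delta> k powr d)"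
  using markov_level[of "G k" \<nu> "L k" "C2 * \<delta> k powr d"] G_integral C2_nn
  unfolding Bad_def space_nu L_def by simp

text \<open>Hoelder with exponents r and r' on the split kernel: the first factor is
  \<open>G k x\<close>, below the threshold outside \<open>Bad k\<close>, and the second is a
  Lebesgue integral of |x - y|^(-b) with b < n.\<close>

lemma local_part:
  assumes x: "x \<notin> Bad k"
  shows "(\<integral>\<^sup>+ y. ennreal (f1 k y * norm (x - y) powr (\<alpha> - n) * near k x y) \<partial>lborel)
       \<le> ennreal ((w / (1 - b / n)) powr (1 / r') * E k powr (1/q))"
proof -
  have ar: "- (a / r) + - (b / r') = \<alpha> - n"
  proof -
    have "a / r + b / r' = a * (1 / r) + b * (1 / r')" by simp
    also have "\<dots> = (a + b * (r - 1)) / r" unfolding r_conj(3) by (simp add: add_divide_distrib)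
    also have "\<dots> = n - \<alpha>" unfolding ab(5) using r by simp
    finally show ?thesis by simp
  qed
  define f where "f y = f1 k y * norm (x - y) powr (- (a / r)) * near k x y" for y
  define g where "g y = norm (x - y) powr (- (b / r')) * near k x y" for y
  have [measurable]: "near k x \<in> borel_measurable borel" unfolding near_def by measurable
  have near: "near k x y powr s = near k x y" "near k x y * near k x y = near k x y" "0 \<le> near k x y" if "s \<noteq> 0" for y s
    unfolding near_def using that by auto
  have "(\<integral>\<^sup>+ y. ennreal (f1 k y * norm (x - y) powr (\<alpha> - n) * near k x y) \<partial>lborel) = (\<integral>\<^sup>+ y. ennreal (f y * g y) \<partial>lborel)"
  proof (intro nn_integral_cong arg_cong[of _ _ ennreal])
    fix y
    have "f y * g y = f1 k y * (norm (x - y) powr (- (a / r)) * norm (x - y) powr (- (b / r'))) * (near k x y * near k x y)"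
      unfolding f_def g_def by (simp add: mult_ac)
    then show "f1 k y * norm (x - y) powr (\<alpha> - n) * near k x y = f y * g y"
      unfolding powr_add[symmetric] ar by (simp add: near_def)
  qed
  also have "\<dots> \<le> ennreal (L k powr (1 / r) * (w / (1 - b / n) * \<delta> k powr (n - b)) powr (1 / r'))"
  proof (rule nn_integral_holder[OF r(1) r_conj(1,2)])
    show "(\<integral>\<^sup>+ y. ennreal (f y powr r) \<partial>lborel) \<le> ennreal (L k)"
    proof -
      have "f y powr r = f1 k y powr r * (norm (x - y) powr (- a) * near k x y)" for y
        unfolding f_def using f_split r near by (simp add: powr_mult powr_powr mult_ac)
      then have "(\<integral>\<^sup>+ y. ennreal (f y powr r) \<partial>lborel) = G k x" unfolding G_def by simp
      then show ?thesis using x unfolding Bad_def by simp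
    qed
    show "(\<integral>\<^sup>+ y. ennreal (g y powr r') \<partial>lborel) \<le> ennreal (w / (1 - b / n) * \<delta> k powr (n - b))"
    proof -
      have "(\<integral>\<^sup>+ y. ennreal (g y powr r') \<partial>lborel) = (\<integral>\<^sup>+ y. ennreal (norm (y - x) powr (- b)) * indicator (ball x (\<delta> k)) y \<partial>lborel)"
      proof (intro nn_integral_cong)
        fix y
        have "g y powr r' = norm (x - y) powr (- b) * near k x y"
          unfolding g_def using r_conj near by (simp add: powr_mult powr_powr)
        then show "ennreal (g y powr r') = ennreal (norm (y - x) powr (- b)) * indicator (ball x (\<delta> k)) y"
          unfolding near_def by (auto simp: indicator_def dist_norm norm_minus_commute)
      qed
      also have "\<dots> \<le> ennreal (w / (1 - b / n) * \<delta> k powr (n - b))"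
      proof (rule nn_integral_kernel_ball)
        show "emeasure lborel (ball x \<rho>) \<le> ennreal (w * \<rho> powr n)" if "0 < \<rho>" for \<rho>
          using that emeasure_ball_unit_vol[of \<rho> x] by (simp add: n_def w_def)
      qed (use ab(3,4) \<delta>(1) w_pos in \<open>auto simp: sigma_finite_lborel\<close>)
      finally show ?thesis .
    qed
  qed (use f_split w_pos ab n_pos in \<open>auto simp: f_def g_def L_def near_def\<close>)
  also have "L k powr (1 / r) * (w / (1 - b / n) * \<delta> k powr (n - b)) powr (1 / r') = (w / (1 - b / n)) powr (1 / r') * E k powr (1/q)"
  proof -
    have bn: "0 < 1 - b / n" using ab n_pos by simp
    have "\<delta> k powr (- ((n - b) * (r - 1) / r)) * \<delta> k powr ((n - b) / r') = 1"
      unfolding powr_add[symmetric] using r_conj(3) \<delta>(1)[of k] by (simp add: divide_inverse)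
    moreover have "(X * \<delta> k powr (n - b)) powr (1 / r') = X powr (1 / r') * \<delta> k powr ((n - b) / r')" if "0 \<le> X" for X
      using that by (simp add: powr_mult powr_powr)
    moreover have "L k powr (1 / r) = E k powr (1/q) * \<delta> k powr (- ((n - b) * (r - 1) / r))"
      unfolding L_def using r by (simp add: powr_mult powr_powr)
    ultimately show ?thesis using bn w_pos by (simp add: mult.assoc mult.left_commute del: times_divide_eq_left)
  qed
  finally show ?thesis .
qed

text \<open>At distance at least \<delta> the kernel is at most \<delta>^(\<alpha> - n), which
  exactly offsets the size of the integral of \<open>f1 k\<close>, so no exceptional set is required
  here.\<close>

lemma far_part:
  "(\<integral>\<^sup>+ y. ennreal (f1 k y * norm (x - y) powr (\<alpha> - n) * (1 - near k x y)) \<partial>lborel)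
       \<le> ennreal (exp (\<alpha>/n) / (1 - \<alpha>/n) * E k powr (1/q))"
proof -
  have an: "\<alpha> / n < 1" using \<alpha> n_pos by simp
  have "(\<integral>\<^sup>+ y. ennreal (f1 k y * norm (x - y) powr (\<alpha> - n) * (1 - near k x y)) \<partial>lborel)
      \<le> (\<integral>\<^sup>+ y. ennreal (\<delta> k powr (\<alpha> - n)) * ennreal (f1 k y powr 1) \<partial>lborel)"
  proof (intro nn_integral_mono)
    fix y
    have "norm (x - y) powr (\<alpha> - n) * (1 - near k x y) \<le> \<delta> k powr (\<alpha> - n)"
      unfolding near_def using \<delta>(1)[of k] \<alpha> by (auto intro!: powr_mono2')
    then have "f1 k y * (norm (x - y) powr (\<alpha> - n) * (1 - near k x y)) \<le> f1 k y * \<delta> k powr (\<alpha> - n)"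
      using f_split by (intro mult_left_mono) auto
    then show "ennreal (f1 k y * norm (x - y) powr (\<alpha> - n) * (1 - near k x y)) \<le> ennreal (\<delta> k powr (\<alpha> - n)) * ennreal (f1 k y powr 1)"
      using f_split by (simp add: ennreal_mult[symmetric] mult_ac)
  qed
  also have "\<dots> = ennreal (\<delta> k powr (\<alpha> - n)) * (\<integral>\<^sup>+ y. ennreal (f1 k y powr 1) \<partial>lborel)"
    by (rule nn_integral_cmult) measurable
  also have "\<dots> \<le> ennreal (\<delta> k powr (\<alpha> - n)) * ennreal ((exp (\<alpha>/n) * E k powr (1/q)) powr 1 * (\<tau> k powr (1 - 1 * \<alpha> / n) / (1 - 1 * \<alpha> / n)))"
    using \<alpha> by (intro mult_left_mono high_part_power) auto
  also have "\<dots> = ennreal (\<delta> k powr (\<alpha> - n) * ((exp (\<alpha>/n) * E k powr (1/q)) * (\<tau> k powr (1 - \<alpha> / n) / (1 - \<alpha> / n))))"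
    using an by (subst ennreal_mult[symmetric]) auto
  also have "\<delta> k powr (\<alpha> - n) * ((exp (\<alpha>/n) * E k powr (1/q)) * (\<tau> k powr (1 - \<alpha> / n) / (1 - \<alpha> / n))) = exp (\<alpha>/n) / (1 - \<alpha>/n) * E k powr (1/q)"
  proof -
    have "n * (1 - \<alpha> / n) = n - \<alpha>" using n_pos by (simp add: field_simps)
    then have "\<tau> k powr (1 - \<alpha> / n) = \<delta> k powr (n - \<alpha>)" unfolding \<delta>(2) by (simp add: powr_powr)
    moreover have "\<delta> k powr (\<alpha> - n) * \<delta> k powr (n - \<alpha>) = 1" unfolding powr_add[symmetric] using \<delta>(1)[of k] by simp
    ultimately show ?thesis by (simp add: mult_ac)
  qed
  finally show ?thesis .
qed

definition U where "U x = (\<integral>\<^sup>+ y. ennreal (h y * norm (x - y) powr (\<alpha> - n)) \<partial>lborel)"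
definition N where "N = w powr ((n - \<alpha>) / n)"
text \<open>Collects the errors of \<open>low_part\<close>, \<open>local_part\<close> and
  \<open>far_part\<close>. The last two are divided by \<open>N\<close> because they do not carry
  that factor. Neither h nor R nor nu enters, so one Adams constant serves all of them.\<close>

definition D where "D = n / \<alpha> * exp (\<alpha>/n) + ((w / (1 - b / n)) powr (1 / r') + exp (\<alpha>/n) / (1 - \<alpha>/n)) / N"

lemma N_pos: "0 < N" unfolding N_def using w_pos by simp
lemma D_nn: "0 \<le> D" unfolding D_def using N_pos \<alpha> n_pos by simp

lemma potential_bound:
  assumes x: "x \<notin> Bad k"
  shows "U x \<le> ennreal (N * (P k + D * E k powr (1/q)))"
proof -
  have [measurable]: "near k x \<in> borel_measurable borel" unfolding near_def by measurable
  let ?K = "\<lambda>y. norm (x - y) powr (\<alpha> - n)"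
  have an: "\<alpha> / n < 1" using \<alpha> n_pos by simp
  have "U x = (\<integral>\<^sup>+ y. ennreal (f2 k y * ?K y) + (ennreal (f1 k y * ?K y * near k x y) + ennreal (f1 k y * ?K y * (1 - near k x y))) \<partial>lborel)"
    unfolding U_def
  proof (intro nn_integral_cong)
    fix y
    have "h y * ?K y = f2 k y * ?K y + (f1 k y * ?K y * near k x y + f1 k y * ?K y * (1 - near k x y))"
      unfolding f_split(1)[of y k] by (simp add: algebra_simps)
    moreover have "0 \<le> f2 k y * ?K y" "0 \<le> f1 k y * ?K y * near k x y" "0 \<le> f1 k y * ?K y * (1 - near k x y)"
      using f_split by (auto simp: near_def)
    ultimately show "ennreal (h y * ?K y) = ennreal (f2 k y * ?K y) + (ennreal (f1 k y * ?K y * near k x y) + ennreal (f1 k y * ?K y * (1 - near k x y)))"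
      by (simp add: ennreal_plus)
  qed
  also have "\<dots> = (\<integral>\<^sup>+ y. ennreal (f2 k y * ?K y) \<partial>lborel) + ((\<integral>\<^sup>+ y. ennreal (f1 k y * ?K y * near k x y) \<partial>lborel)
      + (\<integral>\<^sup>+ y. ennreal (f1 k y * ?K y * (1 - near k x y)) \<partial>lborel))"
    by (subst nn_integral_add; simp)+
  also have "\<dots> \<le> ennreal (N * (P k + n / \<alpha> * exp (\<alpha>/n) * E k powr (1/q))) + (ennreal ((w / (1 - b / n)) powr (1 / r') * E k powr (1/q))
      + ennreal (exp (\<alpha>/n) / (1 - \<alpha>/n) * E k powr (1/q)))"
    unfolding N_def by (intro add_mono low_part local_part[OF x] far_part)
  also have "\<dots> = ennreal (N * (P k + n / \<alpha> * exp (\<alpha>/n) * E k powr (1/q)) + ((w / (1 - b / n)) powr (1 / r') * E k powr (1/q)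
      + exp (\<alpha>/n) / (1 - \<alpha>/n) * E k powr (1/q)))"
    using an Q_eq(2)[of k] N_pos \<alpha> n_pos by (simp add: ennreal_plus[symmetric] del: ennreal_plus)
  also have "N * (P k + n / \<alpha> * exp (\<alpha>/n) * E k powr (1/q)) + ((w / (1 - b / n)) powr (1 / r') * E k powr (1/q)
      + exp (\<alpha>/n) / (1 - \<alpha>/n) * E k powr (1/q)) = N * (P k + D * E k powr (1/q))"
  proof -
    have "N * (p + (A + (B + B') / N) * e) = N * (p + A * e) + (B * e + B' * e)" for p A B B' e
      using N_pos by (simp add: field_simps)
    then show ?thesis unfolding D_def by (simp only:)
  qed
  finally show ?thesis .
qed

lemma emeasure_Bad_exp: "emeasure \<nu> (Bad k) \<le> ennreal (C2 * V powr (d/n) * exp (- (d/n) * real k))"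
proof -
  have "\<delta> k powr d = \<tau> k powr (d / n)" unfolding \<delta>_def by (simp add: powr_powr)
  also have "\<dots> = V powr (d/n) * exp (- (d/n) * real k)" unfolding \<tau>_def using V by (simp add: powr_mult exp_powr_real mult.commute)
  finally show ?thesis using emeasure_Bad[of k] by (simp add: mult.assoc)
qed

text \<open>The measures of the sets \<open>Bad k\<close> tend to 0. Hence almost every x has a
  first good scale, and the potential converges there.\<close>

lemma AE_not_Bad: "AE x in \<nu>. \<exists>k. x \<notin> Bad k"
proof -
  let ?B = "\<Inter>k. Bad k"
  have le: "emeasure \<nu> ?B \<le> ennreal (C2 * V powr (d/n) * exp (- (d/n)) ^ k)" for k
  proof -
    have "emeasure \<nu> ?B \<le> emeasure \<nu> (Bad k)" using Bad_sets by (intro emeasure_mono) auto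
    also have "\<dots> \<le> ennreal (C2 * V powr (d/n) * exp (- (d/n)) ^ k)"
      using emeasure_Bad_exp[of k] by (simp add: exp_of_nat_mult[symmetric] mult.commute)
    finally show ?thesis .
  qed
  have "emeasure \<nu> ?B \<le> ennreal 0"
  proof (rule tendsto_lowerbound)
    have "(\<lambda>k. C2 * V powr (d/n) * exp (- (d/n)) ^ k) \<longlonglongrightarrow> C2 * V powr (d/n) * 0"
      using d n_pos by (intro tendsto_mult tendsto_const LIMSEQ_power_zero) auto
    then show "(\<lambda>k. ennreal (C2 * V powr (d/n) * exp (- (d/n)) ^ k)) \<longlonglongrightarrow> ennreal 0"
      by (intro tendsto_ennrealI) simp
  qed (use le in auto)
  then have "?B \<in> null_sets \<nu>" using Bad_sets by (intro null_setsI) auto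
  then show ?thesis by (rule AE_mp[OF AE_not_in]) auto
qed

lemma AE_U_finite: "AE x in \<nu>. U x < \<infinity>"
  using AE_not_Bad by eventually_elim (auto dest!: potential_bound intro: order_le_less_trans)

lemma adams: "adams_seq q q' D P E"
  by unfold_locales (use q q' D_nn E_eq W_interval Q_eq P_increment in auto)

text \<open>Decomposition by the first good scale k of x: the potential is then at most N * S k,
  while x still lies in the preceding bad set, of measure O(exp(-(d/n) k)). The product of the two
  is a term of the Adams sum.\<close>

lemma exp_bound:
  assumes M0: "0 \<le> M0" "emeasure \<nu> UNIV \<le> ennreal M0"
    and A0: "\<And>m. (\<Sum>k<m. exp (d/n * ((P k + D * E k powr (1/q)) powr q' - real k))) \<le> A0" "0 \<le> A0"
  shows "(\<integral>\<^sup>+ x. ennreal (exp (d / n * (enn2real (U x) / N) powr q')) \<partial>\<nu>)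
           \<le> ennreal ((M0 + C2 * V powr (d/n) * exp (d/n)) * A0)"
proof -
  define S where "S k = P k + D * E k powr (1/q)" for k
  \<comment> \<open>At k = 0 there is no preceding bad set, and the total mass M0 is used. The shift
    of the index by one is the origin of the factor exp(d/n) in \<open>C3\<close>.\<close>
  define B' where "B' k = (case k of 0 \<Rightarrow> UNIV | Suc j \<Rightarrow> Bad j)" for k
  define C3 where "C3 = M0 + C2 * V powr (d/n) * exp (d/n)"
  have C3: "0 \<le> C3" unfolding C3_def using M0 C2_nn by simp
  have S0: "0 \<le> S k" for k unfolding S_def using Q_eq D_nn by simp
  have B'_sets: "B' k \<in> sets \<nu>" for k unfolding B'_def using Bad_sets sets.top[of \<nu>] by (auto split: nat.split simp: space_nu)
  have B'_le: "emeasure \<nu> (B' k) \<le> ennreal (C3 * exp (- (d/n) * real k))" for k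
  proof (cases k)
    case 0
    have "M0 \<le> C3" unfolding C3_def using C2_nn by simp
    then show ?thesis using M0 0 by (simp add: B'_def order_trans ennreal_leI)
  next
    case (Suc j)
    have "C2 * V powr (d/n) * exp (- (d/n) * real j) = C2 * V powr (d/n) * exp (d/n) * exp (- (d/n) * real k)"
      unfolding Suc by (simp add: exp_add[symmetric] algebra_simps)
    also have "\<dots> \<le> C3 * exp (- (d/n) * real k)" unfolding C3_def using M0 by (intro mult_right_mono) auto
    finally have "ennreal (C2 * V powr (d/n) * exp (- (d/n) * real j)) \<le> ennreal (C3 * exp (- (d/n) * real k))" by (rule ennreal_leI)
    then show ?thesis using emeasure_Bad_exp[of j] unfolding Suc B'_def by (simp add: order_trans)
  qed
  have "(\<integral>\<^sup>+ x. ennreal (exp (d / n * (enn2real (U x) / N) powr q')) \<partial>\<nu>)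
      \<le> (\<integral>\<^sup>+ x. (\<Sum>k. ennreal (exp (d/n * S k powr q')) * indicator (B' k) x) \<partial>\<nu>)"
  proof (rule nn_integral_mono_AE)
    show "AE x in \<nu>. ennreal (exp (d / n * (enn2real (U x) / N) powr q')) \<le> (\<Sum>k. ennreal (exp (d/n * S k powr q')) * indicator (B' k) x)"
      using AE_not_Bad
    proof eventually_elim
      fix x assume ex: "\<exists>k. x \<notin> Bad k"
      define k where "k = (LEAST k. x \<notin> Bad k)"
      have k: "x \<notin> Bad k" unfolding k_def using ex by (rule LeastI_ex)
      have xB: "x \<in> B' k"
      proof (cases k)
        case (Suc j)
        then have "x \<in> Bad j" using not_less_Least[of j "\<lambda>k. x \<notin> Bad k"] unfolding k_def[symmetric] by simp
        then show ?thesis using Suc by (simp add: B'_def)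
      qed (simp add: B'_def)
      have "enn2real (U x) \<le> N * S k" using potential_bound[OF k] N_pos S0[of k]
        unfolding S_def[symmetric] by (intro enn2real_leI) auto
      then have "enn2real (U x) / N \<le> S k" using N_pos by (simp add: field_simps)
      then have "(enn2real (U x) / N) powr q' \<le> S k powr q'" using N_pos conj_q by (intro powr_mono2) auto
      then have "exp (d / n * (enn2real (U x) / N) powr q') \<le> exp (d / n * S k powr q')"
        using d n_pos by (simp add: divide_right_mono mult_left_mono)
      then have "ennreal (exp (d / n * (enn2real (U x) / N) powr q')) \<le> ennreal (exp (d/n * S k powr q')) * indicator (B' k) x"
        using xB by (simp add: ennreal_leI)
      also have "\<dots> = (\<Sum>i\<in>{k}. ennreal (exp (d/n * S i powr q')) * indicator (B' i) x)"
        by (simp only: sum.insert[OF finite.emptyI] sum.empty add_0_right empty_iff not_False_eq_True)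
      also have "\<dots> \<le> (\<Sum>k. ennreal (exp (d/n * S k powr q')) * indicator (B' k) x)" by (rule sum_le_suminf) auto
      finally show "ennreal (exp (d / n * (enn2real (U x) / N) powr q')) \<le> (\<Sum>k. ennreal (exp (d/n * S k powr q')) * indicator (B' k) x)" .
    qed
  qed
  also have "\<dots> = (\<Sum>k. \<integral>\<^sup>+ x. ennreal (exp (d/n * S k powr q')) * indicator (B' k) x \<partial>\<nu>)"
    using B'_sets by (intro nn_integral_suminf) auto
  also have "\<dots> = (\<Sum>k. ennreal (exp (d/n * S k powr q')) * emeasure \<nu> (B' k))"
    using B'_sets by (simp add: nn_integral_cmult_indicator)
  also have "\<dots> \<le> (\<Sum>k. ennreal (C3 * exp (d/n * (S k powr q' - real k))))"
  proof (intro suminf_le)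
    fix k
    have "ennreal (exp (d/n * S k powr q')) * emeasure \<nu> (B' k) \<le> ennreal (exp (d/n * S k powr q')) * ennreal (C3 * exp (- (d/n) * real k))"
      by (intro mult_left_mono B'_le) auto
    also have "\<dots> = ennreal (C3 * (exp (d/n * S k powr q') * exp (- (d/n) * real k)))"
      using C3 by (simp add: ennreal_mult[symmetric] mult_ac)
    also have "exp (d/n * S k powr q') * exp (- (d/n) * real k) = exp (d/n * (S k powr q' - real k))"
      by (simp add: exp_add[symmetric] algebra_simps)
    finally show "ennreal (exp (d/n * S k powr q')) * emeasure \<nu> (B' k) \<le> ennreal (C3 * exp (d/n * (S k powr q' - real k)))" .
  qed auto
  also have "\<dots> \<le> ennreal (C3 * A0)"
    unfolding suminf_eq_SUP
  proof (rule SUP_least)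
    fix m
    have "(\<Sum>k<m. ennreal (C3 * exp (d/n * (S k powr q' - real k)))) = ennreal (C3 * (\<Sum>k<m. exp (d/n * (S k powr q' - real k))))"
      using C3 by (subst sum_ennreal) (auto simp: sum_distrib_left)
    also have "\<dots> \<le> ennreal (C3 * A0)" using A0 C3 unfolding S_def by (intro ennreal_leI mult_left_mono) auto
    finally show "(\<Sum>k<m. ennreal (C3 * exp (d/n * (S k powr q' - real k)))) \<le> ennreal (C3 * A0)" .
  qed
  finally show ?thesis unfolding C3_def .
qed

end

subsection \<open>The inequality at the critical exponent\<close>

lemma riesz_gamma_pos:
  assumes "0 < \<alpha>" "\<alpha> < real m" shows "0 < riesz_gamma m \<alpha>"
  unfolding riesz_gamma_def using assms by (auto intro!: mult_pos_pos divide_pos_pos Gamma_real_pos)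

lemma rearrangement_antimono:
  "z \<le> z' \<Longrightarrow> rearrangement \<Omega> f z' \<le> rearrangement \<Omega> f z"
  unfolding rearrangement_def by (rule INF_superset_mono) (auto intro: order_trans ennreal_leI)

lemma le_rearrangement:
  assumes meas: "\<And>l. 0 < l \<Longrightarrow> {x \<in> \<Omega>. l < \<bar>f x\<bar>} \<in> sets lebesgue"
    and less: "ennreal z < emeasure lebesgue {x \<in> \<Omega>. s < \<bar>f x\<bar>}"
  shows "ennreal s \<le> rearrangement \<Omega> f z"
  unfolding rearrangement_def
proof (rule INF_greatest)
  fix l assume l: "l \<in> {l. 0 < l \<and> emeasure lebesgue {x \<in> \<Omega>. l < \<bar>f x\<bar>} \<le> ennreal z}"
  show "ennreal s \<le> ennreal l"
  proof (rule ccontr)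
    assume "\<not> ennreal s \<le> ennreal l"
    then have "l < s" using ennreal_leI[of s l] by (meson not_le)
    then have "emeasure lebesgue {x \<in> \<Omega>. s < \<bar>f x\<bar>} \<le> emeasure lebesgue {x \<in> \<Omega>. l < \<bar>f x\<bar>}"
      using l meas by (intro emeasure_mono) auto
    then show False using less l by auto
  qed
qed

lemma lorentz_norm_le_one:
  assumes q: "0 < q" and le: "lorentz_norm p q \<Omega> f \<le> 1"
  shows "(\<integral>\<^sup>+ s \<in> {s. 0 < s \<and> ennreal s < emeasure lebesgue \<Omega>}.
          ennreal_pow (ennreal (s powr (1 / p)) * rearrangement \<Omega> f s) q * ennreal (1 / s) \<partial>lborel) \<le> 1" (is "?I \<le> 1")
proof (cases ?I)
  case (real x)
  have "x powr (1/q) \<le> 1" using le real unfolding lorentz_norm_def ennreal_pow_def by (simp add: ennreal_le_1)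
  have "x \<le> 1"
  proof (rule ccontr)
    assume "\<not> x \<le> 1"
    then have "1 powr (1/q) < x powr (1/q)" using q by (intro powr_less_mono2) auto
    then show False using \<open>x powr (1/q) \<le> 1\<close> by simp
  qed
  then show ?thesis using real by simp
next
  case top
  then show ?thesis using le unfolding lorentz_norm_def ennreal_pow_def by simp
qed

text \<open>By monotonicity an infinite value at z would persist on all of (0, z), and the Lorentz
  integral would diverge. This justifies treating the rearrangement as a real function.\<close>

lemma rearrangement_finite:
  assumes q: "0 < q" and V: "0 < V" "emeasure lebesgue \<Omega> = ennreal V"
    and le: "lorentz_norm p q \<Omega> f \<le> 1" and z: "0 < z"
  shows "rearrangement \<Omega> f z < \<infinity>"
proof (rule ccontr)
  assume "\<not> rearrangement \<Omega> f z < \<infinity>"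
  then have inf: "rearrangement \<Omega> f z = \<infinity>" by (simp add: less_top[symmetric])
  define m where "m = min z V"
  have m: "0 < m" "m \<le> z" "m \<le> V" unfolding m_def using z V by auto
  have "(\<integral>\<^sup>+ s. \<infinity> * indicator {0<..<m} s \<partial>lborel) \<le> 1"
  proof (rule order_trans[OF nn_integral_mono lorentz_norm_le_one[OF q le]])
    fix s
    show "\<infinity> * indicator {0<..<m} s \<le> ennreal_pow (ennreal (s powr (1 / p)) * rearrangement \<Omega> f s) q * ennreal (1 / s) * indicator {s. 0 < s \<and> ennreal s < emeasure lebesgue \<Omega>} s"
    proof (cases "s \<in> {0<..<m}")
      case True
      have "rearrangement \<Omega> f s = \<infinity>"
        using rearrangement_antimono[of s z \<Omega> f] inf True m by (simp add: top_unique)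
      moreover have "0 < s powr (1/p)" using True by simp
      ultimately have "ennreal (s powr (1 / p)) * rearrangement \<Omega> f s = \<infinity>"
        by (simp add: ennreal_mult_eq_top_iff)
      moreover have "\<infinity> * ennreal (1 / s) = \<infinity>" using True by (simp add: ennreal_mult_eq_top_iff)
      ultimately show ?thesis using True m V unfolding ennreal_pow_def by (auto simp: ennreal_less_iff)
    qed simp
  qed
  moreover have "(\<integral>\<^sup>+ s. \<infinity> * indicator {0<..<m} s \<partial>lborel) = \<infinity>"
    using m by (subst nn_integral_cmult_indicator) (auto simp: ennreal_mult_eq_top_iff)
  ultimately show False by (simp add: top_unique)
qed

text \<open>Joint measurability in the two variables of the potential needs a Borel representative of the density.\<close>

lemma borel_representative:
  fixes f :: "real ^ 'n \<Rightarrow> real"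
  assumes \<Omega>: "\<Omega> \<in> sets lebesgue" and f: "f \<in> borel_measurable (lebesgue_on \<Omega>)"
  obtains h where "h \<in> borel_measurable borel" "\<And>y. 0 \<le> h y" "AE y in lborel. \<bar>zero_ext \<Omega> f y\<bar> = h y"
    "\<And>s. 0 < s \<Longrightarrow> emeasure lborel {y. s < h y} = emeasure lebesgue {y \<in> \<Omega>. s < \<bar>f y\<bar>}"
    "\<And>s. 0 < s \<Longrightarrow> {y \<in> \<Omega>. s < \<bar>f y\<bar>} \<in> sets lebesgue"
proof -
  have g [measurable]: "zero_ext \<Omega> f \<in> borel_measurable lebesgue"
    unfolding zero_ext_def using \<Omega> f by (rule borel_measurable_if_I[rotated])
  then obtain h0 where h0: "h0 \<in> borel_measurable lborel" "AE y in lborel. zero_ext \<Omega> f y = h0 y"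
    using completion_ex_borel_measurable_real by blast
  define h where "h y = \<bar>h0 y\<bar>" for y
  have hb [measurable]: "h \<in> borel_measurable borel" unfolding h_def using h0(1) by simp
  have AE: "AE y in lborel. \<bar>zero_ext \<Omega> f y\<bar> = h y" using h0(2) by eventually_elim (simp add: h_def)
  have eq: "{y \<in> \<Omega>. s < \<bar>f y\<bar>} = {y. s < \<bar>zero_ext \<Omega> f y\<bar>}" if "0 < s" for s
    using that unfolding zero_ext_def by auto
  have sets: "{y \<in> \<Omega>. s < \<bar>f y\<bar>} \<in> sets lebesgue" if "0 < s" for s
  proof -
    have "{y \<in> space lebesgue. s < \<bar>zero_ext \<Omega> f y\<bar>} \<in> sets lebesgue" by measurable
    then show ?thesis unfolding eq[OF that] by simp
  qed
  have em: "emeasure lborel {y. s < h y} = emeasure lebesgue {y \<in> \<Omega>. s < \<bar>f y\<bar>}" if "0 < s" for s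
  proof -
    have B: "{y. s < h y} \<in> sets borel" using measurable_sets[OF hb, of "{s<..}"] by (simp add: vimage_def)
    have "emeasure lborel {y. s < h y} = emeasure lebesgue {y. s < h y}" using B by simp
    also have "\<dots> = emeasure lebesgue {y \<in> \<Omega>. s < \<bar>f y\<bar>}"
    proof (rule emeasure_eq_AE)
      have "AE y in lebesgue. \<bar>zero_ext \<Omega> f y\<bar> = h y" using AE by (rule AE_completion)
      then show "AE y in lebesgue. (y \<in> {y. s < h y}) = (y \<in> {y \<in> \<Omega>. s < \<bar>f y\<bar>})"
        unfolding eq[OF that] by eventually_elim simp
    qed (use sets[OF that] B in auto)
    finally show ?thesis .
  qed
  show ?thesis by (rule that[OF hb _ AE em sets]) (auto simp: h_def)
qed

lemma lorentz_majorant_of_norm: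
  fixes f :: "real ^ 'n \<Rightarrow> real"
  assumes \<alpha>: "0 < \<alpha>" "\<alpha> < real CARD('n)" and q: "1 < q"
    and V: "0 < V" "emeasure lebesgue \<Omega> = ennreal V" and \<Omega>: "\<Omega> \<in> sets lebesgue"
    and f: "f \<in> borel_measurable (lebesgue_on \<Omega>)" and le: "lorentz_norm (real CARD('n) / \<alpha>) q \<Omega> f \<le> 1"
  obtains h R where "lorentz_majorant h R (real CARD('n)) \<alpha> q (q / (q - 1)) V (unit_vol TYPE('n))"
    "AE y in lborel. \<bar>zero_ext \<Omega> f y\<bar> = h y"
proof -
  let ?n = "real CARD('n)"
  from borel_representative[OF \<Omega> f] obtain h where h: "h \<in> borel_measurable borel" "\<And>y. 0 \<le> h y" "AE y in lborel. \<bar>zero_ext \<Omega> f y\<bar> = h y"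
    "\<And>s. 0 < s \<Longrightarrow> emeasure lborel {y. s < h y} = emeasure lebesgue {y \<in> \<Omega>. s < \<bar>f y\<bar>}"
    "\<And>s. 0 < s \<Longrightarrow> {y \<in> \<Omega>. s < \<bar>f y\<bar>} \<in> sets lebesgue" by blast
  define \<rho> where "\<rho> = rearrangement \<Omega> f"
  define R where "R z = indicator {0<..} z *\<^sub>R enn2real (\<rho> z)" for z
  have fin: "\<rho> z < \<infinity>" if "0 < z" for z unfolding \<rho>_def using rearrangement_finite[OF _ V le that] q by simp
  have Rr: "ennreal (R z) = \<rho> z" if "0 < z" for z using that fin[OF that] unfolding R_def by simp
  have dec: "R z' \<le> R z" if "0 < z" "z \<le> z'" for z z'
    using rearrangement_antimono[OF that(2), of \<Omega> f] that fin[OF that(1)] unfolding R_def \<rho>_def[symmetric]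
    by (auto intro!: enn2real_mono)
  \<comment> \<open>Monotonicity is available on z > 0 only. Extending R by 0 reduces measurability
    to that of a monotone function on this half-line.\<close>
  have meas: "R \<in> borel_measurable borel"
  proof -
    have "mono_on {0<..} (\<lambda>z. - R z)" by (intro mono_onI) (use dec in auto)
    then have "(\<lambda>z. - R z) \<in> borel_measurable (restrict_space borel {0<..})" by (rule borel_measurable_mono_on_fnc)
    then have "(\<lambda>z. indicator {0<..} z *\<^sub>R (- R z)) \<in> borel_measurable borel" by (subst (asm) borel_measurable_restrict_space_iff) auto
    then have "(\<lambda>z. - (indicator {0<..} z *\<^sub>R (- R z))) \<in> borel_measurable borel" by simp
    also have "(\<lambda>z. - (indicator {0<..} z *\<^sub>R (- R z))) = R" by (auto simp: R_def indicator_def)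
    finally show ?thesis .
  qed
  have "lorentz_majorant h R ?n \<alpha> q (q / (q - 1)) V (unit_vol TYPE('n))"
  proof unfold_locales
    fix z s :: real assume z: "0 < z" and s: "0 < s" and less: "ennreal z < emeasure lborel {y. s < h y}"
    have "ennreal s \<le> ennreal (R z)" unfolding Rr[OF z] \<rho>_def
      by (rule le_rearrangement) (use h(4,5) s less in auto)
    moreover have "0 \<le> R z" by (simp add: R_def)
    ultimately show "s \<le> R z" by simp
  next
    fix s :: real assume s: "0 < s"
    have "emeasure lebesgue {y \<in> \<Omega>. s < \<bar>f y\<bar>} \<le> emeasure lebesgue \<Omega>"
      by (intro emeasure_mono) (use \<Omega> in auto)
    then show "emeasure lborel {y. s < h y} \<le> ennreal V" using h(4)[OF s] V by simp
  next
    have "(\<integral>\<^sup>+ z. ennreal ((z powr (\<alpha> / ?n) * R z) powr q / z) * indicator {0<..<V} z \<partial>lborel)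
      = (\<integral>\<^sup>+ s \<in> {s. 0 < s \<and> ennreal s < emeasure lebesgue \<Omega>}.
          ennreal_pow (ennreal (s powr (1 / (?n / \<alpha>))) * rearrangement \<Omega> f s) q * ennreal (1 / s) \<partial>lborel)"
    proof (intro nn_integral_cong)
      fix z
      show "ennreal ((z powr (\<alpha> / ?n) * R z) powr q / z) * indicator {0<..<V} z
        = ennreal_pow (ennreal (z powr (1 / (?n / \<alpha>))) * rearrangement \<Omega> f z) q * ennreal (1 / z) * indicator {s. 0 < s \<and> ennreal s < emeasure lebesgue \<Omega>} z"
      proof (cases "0 < z \<and> z < V")
        case True
        then have z: "0 < z" by simp
        have "ennreal (z powr (1 / (?n / \<alpha>))) * rearrangement \<Omega> f z = ennreal (z powr (\<alpha> / ?n) * R z)"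
          unfolding \<rho>_def[symmetric] Rr[OF z, symmetric] by (simp add: ennreal_mult R_def)
        moreover have "0 \<le> z powr (\<alpha> / ?n) * R z" by (simp add: R_def)
        ultimately show ?thesis using True V unfolding ennreal_pow_def
          by (simp add: ennreal_less_iff ennreal_mult[symmetric])
      next
        case False
        then show ?thesis using V by (auto simp: indicator_def ennreal_less_iff)
      qed
    qed
    also have "\<dots> \<le> 1" using lorentz_norm_le_one[OF _ le] q by simp
    finally show "(\<integral>\<^sup>+ z. ennreal ((z powr (\<alpha> / ?n) * R z) powr q / z) * indicator {0<..<V} z \<partial>lborel) \<le> 1" .
  qed (use \<alpha> q V h meas dec in \<open>auto simp: R_def\<close>)
  then show ?thesis using h(3) by (rule that)
qed

text \<open>Finiteness of the extended-valued integral yields absolute convergence first, so the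
  bound does not rest on the default value 0 of the Bochner integral.\<close>

lemma riesz_potential_le:
  fixes f h :: "real ^ 'n \<Rightarrow> real"
  assumes \<alpha>: "0 < \<alpha>" "\<alpha> < real CARD('n)" and g: "g \<in> borel_measurable lebesgue"
    and h: "AE y in lborel. \<bar>g y\<bar> = h y"
    and fin: "(\<integral>\<^sup>+ y. ennreal (h y * norm (x - y) powr (\<alpha> - real CARD('n))) \<partial>lborel) < \<infinity>"
  shows "riesz_converges \<alpha> g x"
    "\<bar>riesz_potential \<alpha> g x\<bar> \<le> enn2real (\<integral>\<^sup>+ y. ennreal (h y * norm (x - y) powr (\<alpha> - real CARD('n))) \<partial>lborel) / riesz_gamma CARD('n) \<alpha>"
proof -
  let ?U = "\<integral>\<^sup>+ y. ennreal (h y * norm (x - y) powr (\<alpha> - real CARD('n))) \<partial>lborel"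
  let ?I = "riesz_integrand \<alpha> g x"
  have [measurable]: "(\<lambda>y. norm (x - y) powr (real CARD('n) - \<alpha>)) \<in> borel_measurable lebesgue"
    by (rule measurable_completion) measurable
  have meas: "?I \<in> borel_measurable lebesgue" unfolding riesz_integrand_def using g by measurable
  have nI: "(\<integral>\<^sup>+ y. ennreal (norm (?I y)) \<partial>lebesgue) = ?U"
  proof -
    have "(\<integral>\<^sup>+ y. ennreal (norm (?I y)) \<partial>lebesgue) = (\<integral>\<^sup>+ y. ennreal (norm (?I y)) \<partial>lborel)"
      by (rule nn_integral_completion)
    also have "\<dots> = ?U"
    proof (rule nn_integral_cong_AE)
      show "AE y in lborel. ennreal (norm (?I y)) = ennreal (h y * norm (x - y) powr (\<alpha> - real CARD('n)))"
        using h
      proof eventually_elim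
        fix y assume "\<bar>g y\<bar> = h y"
        \<comment> \<open>True also at y = x, where both sides are 0 by the conventions for
          \<open>powr\<close> and division.\<close>
        moreover have "norm (x - y) powr (\<alpha> - real CARD('n)) = 1 / norm (x - y) powr (real CARD('n) - \<alpha>)"
          using powr_minus_divide[of "norm (x - y)" "real CARD('n) - \<alpha>"] by simp
        ultimately show "ennreal (norm (?I y)) = ennreal (h y * norm (x - y) powr (\<alpha> - real CARD('n)))"
          unfolding riesz_integrand_def by (simp add: abs_mult)
      qed
    qed
    finally show ?thesis .
  qed
  have int: "integrable lebesgue ?I" by (rule integrableI_bounded[OF meas]) (use nI fin in simp)
  then show "riesz_converges \<alpha> g x" unfolding riesz_converges_def .
  have "ennreal (norm (\<integral> y. ?I y \<partial>lebesgue)) \<le> ?U"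
    using integral_norm_bound_ennreal[OF int] nI by simp
  then have "norm (\<integral> y. ?I y \<partial>lebesgue) \<le> enn2real ?U" using fin
    by (metis enn2real_ennreal enn2real_mono infinity_ennreal_def norm_ge_zero)
  then show "\<bar>riesz_potential \<alpha> g x\<bar> \<le> enn2real ?U / riesz_gamma CARD('n) \<alpha>"
    using riesz_gamma_pos[OF \<alpha>] unfolding riesz_potential_def by (simp add: abs_mult divide_right_mono)
qed

section \<open>The uniform bound up to the critical exponent\<close>

lemma riesz_trace_inequality:
  fixes \<Omega> :: "(real ^ 'n) set" and \<alpha> q d C' :: real
  assumes \<Omega>: "open \<Omega>" "bounded \<Omega>"
    and \<alpha>: "0 < \<alpha>" "\<alpha> < real CARD('n)"
    and q: "1 < q" "q' = q / (q - 1)"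
    and d: "0 < d" "d \<le> real CARD('n)"
    and C': "0 < C'"
  shows "\<exists>C>0. \<forall>\<nu>. borel_measure_on \<Omega> \<nu> \<and> upper_growth d C' \<nu> \<and> \<Omega> \<noteq> {} \<longrightarrow>
        (\<forall>f \<in> lorentz_space (real CARD('n) / \<alpha>) q \<Omega>. lorentz_norm (real CARD('n) / \<alpha>) q \<Omega> f \<le> 1 \<longrightarrow>
           (AE x in \<nu>. riesz_converges \<alpha> (zero_ext \<Omega> f) x) \<and>
           (\<forall>\<beta> \<le> critical_beta TYPE('n) \<alpha> q' d.
              exp_integral \<Omega> \<nu> \<alpha> q' \<beta> f \<le> ennreal C))"
proof -
  let ?n = "real CARD('n)" and ?w = "unit_vol TYPE('n)"
  define V where "V = measure lebesgue \<Omega>"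
  \<comment> \<open>The interval of admissible Hoelder exponents is nonempty because \<alpha> < n
    and d > 0.\<close>
  have r0: "max 1 ((?n - d) / \<alpha>) < ?n / \<alpha>" using \<alpha> d by (simp add: divide_strict_right_mono)
  obtain r where r1: "max 1 ((?n - d) / \<alpha>) < r" "r < ?n / \<alpha>" using dense[OF r0] by blast
  then have r: "1 < r" "r * \<alpha> < ?n" "?n - d < r * \<alpha>" using \<alpha> by (auto simp: field_simps)
  obtain \<rho>0 where \<rho>0: "0 < \<rho>0" "\<Omega> \<subseteq> ball 0 \<rho>0" using \<Omega>(2) bounded_subset_ballD by blast
  define M0 where "M0 = C' * \<rho>0 powr d"
  have M0: "0 \<le> M0" unfolding M0_def using C' by simp
  have dn: "0 < d / ?n" using d by simp
  have lm: "\<Omega> \<in> lmeasurable" using \<Omega> by (intro lmeasurable_open)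
  \<comment> \<open>Obtained before nu and f are fixed, for an explicit D. This order of choices
    makes C uniform.\<close>
  obtain A0 where A0: "0 \<le> A0" "\<And>P E N. adams_seq q q' (lorentz_trace.D ?n \<alpha> ?w d r) P E \<Longrightarrow>
           (\<Sum>k<N. exp (d / ?n * ((P k + lorentz_trace.D ?n \<alpha> ?w d r * E k powr (1/q)) powr q' - real k))) \<le> A0"
    using adams_sum[OF dn, of q q' "lorentz_trace.D ?n \<alpha> ?w d r"] by blast
  define C where "C = max 1 ((M0 + lorentz_trace.C2 ?n \<alpha> d C' r * V powr (d / ?n) * exp (d / ?n)) * A0)"
  show ?thesis
  proof (intro exI[of _ C] conjI allI impI ballI)
    show "0 < C" unfolding C_def by simp
    fix \<nu> :: "(real ^ 'n) measure" and f
    assume \<nu>: "borel_measure_on \<Omega> \<nu> \<and> upper_growth d C' \<nu> \<and> \<Omega> \<noteq> {}"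
      and f: "f \<in> lorentz_space (?n / \<alpha>) q \<Omega>" and le: "lorentz_norm (?n / \<alpha>) q \<Omega> f \<le> 1"
    have fm: "f \<in> borel_measurable (lebesgue_on \<Omega>)" using f unfolding lorentz_space_def by simp
    have V: "0 < V" "emeasure lebesgue \<Omega> = ennreal V"
    proof -
      show 1: "emeasure lebesgue \<Omega> = ennreal V" unfolding V_def 
        by (rule emeasure_eq_ennreal_measure) (use fmeasurableD2[OF lm] in simp)
      have "\<not> negligible \<Omega>" using \<Omega> \<nu> open_not_negligible by blast
      then have "V \<noteq> 0" unfolding V_def using lm negligible_iff_measure by blast
      then show "0 < V" unfolding V_def by (simp add: zero_less_measure_iff)
    qed
    have sets_nu: "sets \<nu> = sets borel" using \<nu> unfolding borel_measure_on_def by simp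
    have growth: "emeasure \<nu> (ball y \<rho>) \<le> ennreal (C' * \<rho> powr d)" if "0 < \<rho>" for y \<rho>
      using \<nu> that unfolding upper_growth_def by simp
    \<comment> \<open>The growth condition on one ball containing the bounded domain bounds the
      whole mass.\<close>
    have total: "emeasure \<nu> UNIV \<le> ennreal M0"
    proof -
      have "emeasure \<nu> UNIV \<le> emeasure \<nu> (- \<Omega> \<union> ball 0 \<rho>0)" using \<rho>0 sets_nu \<Omega> by (intro emeasure_mono) auto
      also have "\<dots> \<le> emeasure \<nu> (- \<Omega>) + emeasure \<nu> (ball 0 \<rho>0)"
        using \<Omega> by (intro emeasure_subadditive) (auto simp: sets_nu)
      also have "\<dots> \<le> ennreal M0" using \<nu> growth[OF \<rho>0(1)] unfolding borel_measure_on_def M0_def by simp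
      finally show ?thesis .
    qed
    have "finite_measure \<nu>"
    proof (rule finite_measureI)
      have "space \<nu> = UNIV" using sets_eq_imp_space_eq[OF sets_nu] by simp
      then show "emeasure \<nu> (space \<nu>) \<noteq> \<infinity>" using total by (auto simp: top_unique)
    qed
    then have sf: "sigma_finite_measure \<nu>" by (simp add: finite_measure_def)
    obtain h R where hR: "lorentz_majorant h R ?n \<alpha> q (q / (q - 1)) V ?w"
      and hAE: "AE y in lborel. \<bar>zero_ext \<Omega> f y\<bar> = h y"
      using lorentz_majorant_of_norm[OF \<alpha> q(1) V fmeasurableD[OF lm] fm le] by blast
    interpret lorentz_trace h R ?n \<alpha> q q' V ?w \<nu> d C' r
      by (intro lorentz_trace.intro lorentz_trace_axioms.intro) (use hR q sets_nu sf growth d C' r in auto)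
    have g: "zero_ext \<Omega> f \<in> borel_measurable lebesgue"
      unfolding zero_ext_def by (rule borel_measurable_if_I[OF fm fmeasurableD[OF lm]])
    note pot = riesz_potential_le[OF \<alpha> g hAE, folded U_def]
    show "AE x in \<nu>. riesz_converges \<alpha> (zero_ext \<Omega> f) x"
      using AE_U_finite by eventually_elim (rule pot(1))
    fix \<beta> assume \<beta>: "\<beta> \<le> critical_beta TYPE('n) \<alpha> q' d"
    let ?g = "riesz_gamma CARD('n) \<alpha>"
    have gpos: "0 < ?g" by (rule riesz_gamma_pos[OF \<alpha>])
    \<comment> \<open>This identity singles out the critical value: the powers of the Riesz constant
      and of the unit ball volume cancel, and d/n is left in front.\<close>
    have crit: "critical_beta TYPE('n) \<alpha> q' d * (u / ?g) powr q' = d / ?n * (u / N) powr q'" if "0 \<le> u" for u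
    proof -
      have "?w powr (- ((?n - \<alpha>) / ?n) * q') = 1 / N powr q'"
        unfolding N_def by (simp add: powr_powr powr_minus_divide)
      then show ?thesis unfolding critical_beta_def unit_vol_def[of "TYPE('n)", symmetric] using that gpos N_pos by (simp add: powr_divide)
    qed
    have c0: "0 \<le> critical_beta TYPE('n) \<alpha> q' d" unfolding critical_beta_def using d by simp
    have "exp_integral \<Omega> \<nu> \<alpha> q' \<beta> f \<le> (\<integral>\<^sup>+ x. ennreal (exp (d / ?n * (enn2real (U x) / N) powr q')) \<partial>\<nu>)"
      unfolding exp_integral_def
    proof (rule nn_integral_mono_AE)
      show "AE x in \<nu>. ennreal (exp (\<beta> * \<bar>riesz_potential \<alpha> (zero_ext \<Omega> f) x\<bar> powr q')) * indicator \<Omega> x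
          \<le> ennreal (exp (d / ?n * (enn2real (U x) / N) powr q'))"
        using AE_U_finite
      proof eventually_elim
        fix x assume x: "U x < \<infinity>"
        let ?p = "\<bar>riesz_potential \<alpha> (zero_ext \<Omega> f) x\<bar>"
        \<comment> \<open>Negative beta is included, since only the nonnegativity of the power is
          used.\<close>
        have "\<beta> * ?p powr q' \<le> critical_beta TYPE('n) \<alpha> q' d * ?p powr q'" using \<beta> by (intro mult_right_mono) auto
        also have "\<dots> \<le> critical_beta TYPE('n) \<alpha> q' d * (enn2real (U x) / ?g) powr q'"
          using pot(2)[OF x] c0 conj_q by (intro mult_left_mono powr_mono2) auto
        also have "\<dots> = d / ?n * (enn2real (U x) / N) powr q'" by (rule crit) simp
        finally show "ennreal (exp (\<beta> * ?p powr q')) * indicator \<Omega> x \<le> ennreal (exp (d / ?n * (enn2real (U x) / N) powr q'))"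
          by (auto simp: indicator_def intro!: ennreal_leI)
      qed
    qed
    also have "\<dots> \<le> ennreal ((M0 + C2 * V powr (d / ?n) * exp (d / ?n)) * A0)"
      by (rule exp_bound[OF M0 total A0(2)[OF adams] A0(1)])
    also have "\<dots> \<le> ennreal C" unfolding C_def by (intro ennreal_leI) simp
    finally show "exp_integral \<Omega> \<nu> \<alpha> q' \<beta> f \<le> ennreal C" .
  qed
qed

subsection \<open>Extremal functions and sharpness\<close>

text \<open>The decay dist^(-\<alpha>) corresponds to a rearrangement of order z^(-\<alpha>/n), the
  equality case of Hoelder in \<open>main_interval\<close>. The inner cut-off keeps the Lorentz norm
  finite.\<close>

definition riesz_extremal :: "real ^ 'n \<Rightarrow> real \<Rightarrow> real \<Rightarrow> real \<Rightarrow> real ^ 'n \<Rightarrow> real" where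
  "riesz_extremal x0 \<alpha> \<rho> r y = dist x0 y powr (- \<alpha>) * indicator (ball x0 r - ball x0 \<rho>) y"

lemma riesz_extremal_measurable [measurable]: "riesz_extremal x0 \<alpha> \<rho> r \<in> borel_measurable borel"
  unfolding riesz_extremal_def by (intro borel_measurable_times borel_measurable_indicator) auto

lemma riesz_extremal_nonneg: "0 \<le> riesz_extremal x0 \<alpha> \<rho> r y"
  unfolding riesz_extremal_def by simp

lemma ennreal_pow_le_one:
  assumes "a \<le> 1" "0 < p" shows "ennreal_pow a p \<le> 1"
proof -
  obtain x where x: "a = ennreal x" "0 \<le> x" "x \<le> 1" using assms(1) by (cases a) (auto simp: top_unique)
  have "x powr p \<le> 1 powr p" using x assms(2) by (intro powr_mono2) auto
  then show ?thesis unfolding ennreal_pow_def x(1) using x by (simp add: ennreal_le_1)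
qed

lemma rearrangement_le:
  assumes "0 < l" "emeasure lebesgue {x \<in> \<Omega>. l < \<bar>f x\<bar>} \<le> ennreal z"
  shows "rearrangement \<Omega> f z \<le> ennreal l"
  unfolding rearrangement_def by (rule INF_lower) (use assms in auto)

text \<open>The three bounds match a plateau, a power range and the region beyond the support. Upper
  bounds suffice, since the norm only has to be at most 1.\<close>

lemma rearrangement_extremal:
  fixes x0 :: "real ^ 'n"
  assumes \<alpha>: "0 < \<alpha>" "\<alpha> < real CARD('n)" and \<rho>: "0 < \<rho>" "\<rho> < r" and c: "0 < c" and z: "0 < z"
  shows "rearrangement \<Omega> (\<lambda>y. c * riesz_extremal x0 \<alpha> \<rho> r y) z \<le> ennreal (c * \<rho> powr (- \<alpha>))"
    "rearrangement \<Omega> (\<lambda>y. c * riesz_extremal x0 \<alpha> \<rho> r y) z \<le> ennreal (c * (z / unit_vol TYPE('n)) powr (- (\<alpha> / real CARD('n))))"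
    "unit_vol TYPE('n) * r powr real CARD('n) \<le> z \<Longrightarrow> rearrangement \<Omega> (\<lambda>y. c * riesz_extremal x0 \<alpha> \<rho> r y) z = 0"
proof -
  let ?f = "\<lambda>y. c * riesz_extremal x0 \<alpha> \<rho> r y" and ?n = "real CARD('n)" and ?w = "unit_vol TYPE('n)"
  have w: "0 < ?w" by (rule unit_vol_pos)
  have supp: "y \<in> ball x0 r \<and> \<rho> \<le> dist x0 y \<and> ?f y = c * dist x0 y powr (- \<alpha>)" if "0 < ?f y" for y
    using that unfolding riesz_extremal_def by (cases "y \<in> ball x0 r - ball x0 \<rho>") auto
  have abs: "\<bar>?f y\<bar> = ?f y" for y using c riesz_extremal_nonneg[of x0 \<alpha> \<rho> r y] by simp
  have ball_le: "emeasure lebesgue A \<le> ennreal (?w * s powr ?n)" if "A \<subseteq> ball x0 s" "0 \<le> s" for A s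
  proof -
    have "emeasure lebesgue A \<le> emeasure lebesgue (ball x0 s)" using that by (intro emeasure_mono) auto
    then show ?thesis using emeasure_ball_unit_vol[OF that(2), of x0] by simp
  qed
  show "rearrangement \<Omega> ?f z \<le> ennreal (c * \<rho> powr (- \<alpha>))"
  proof (rule rearrangement_le)
    have "?f y \<le> c * \<rho> powr (- \<alpha>)" for y
    proof (cases "0 < ?f y")
      case True
      then have "dist x0 y powr (- \<alpha>) \<le> \<rho> powr (- \<alpha>)" using supp[OF True] \<rho> \<alpha> by (intro powr_mono2') auto
      then show ?thesis using supp[OF True] c by simp
    next
      case False
      moreover have "0 \<le> c * \<rho> powr (- \<alpha>)" using c by simp
      ultimately show ?thesis by linarith
    qed
    then have "{x \<in> \<Omega>. c * \<rho> powr (- \<alpha>) < \<bar>?f x\<bar>} = {}" unfolding abs by (auto simp: not_less)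
    then show "emeasure lebesgue {x \<in> \<Omega>. c * \<rho> powr (- \<alpha>) < \<bar>?f x\<bar>} \<le> ennreal z" by (simp only: emeasure_empty zero_le)
  qed (use c \<rho> in simp)
  show "rearrangement \<Omega> ?f z \<le> ennreal (c * (z / ?w) powr (- (\<alpha> / ?n)))"
  proof (rule rearrangement_le)
    let ?s = "(z / ?w) powr (1 / ?n)"
    have s: "0 < ?s" using z w by simp
    have "{x \<in> \<Omega>. c * (z / ?w) powr (- (\<alpha> / ?n)) < \<bar>?f x\<bar>} \<subseteq> ball x0 ?s"
    proof
      fix y assume "y \<in> {x \<in> \<Omega>. c * (z / ?w) powr (- (\<alpha> / ?n)) < \<bar>?f x\<bar>}"
      then have y: "c * (z / ?w) powr (- (\<alpha> / ?n)) < ?f y" unfolding abs by simp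
      moreover have "0 \<le> c * (z / ?w) powr (- (\<alpha> / ?n))" using c by simp
      ultimately have pos: "0 < ?f y" by linarith
      have "(z / ?w) powr (- (\<alpha> / ?n)) < dist x0 y powr (- \<alpha>)" using y supp[OF pos] c by simp
      moreover have "(z / ?w) powr (- (\<alpha> / ?n)) = ?s powr (- \<alpha>)" by (simp add: powr_powr)
      ultimately have less: "?s powr (- \<alpha>) < dist x0 y powr (- \<alpha>)" by simp
      show "y \<in> ball x0 ?s"
      proof (rule ccontr)
        assume "y \<notin> ball x0 ?s"
        then have "dist x0 y powr (- \<alpha>) \<le> ?s powr (- \<alpha>)" using s \<alpha> by (intro powr_mono2') auto
        then show False using less by simp
      qed
    qed
    then have "emeasure lebesgue {x \<in> \<Omega>. c * (z / ?w) powr (- (\<alpha> / ?n)) < \<bar>?f x\<bar>} \<le> ennreal (?w * ?s powr ?n)"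
      by (rule ball_le) (rule powr_ge_zero)
    also have "?w * ?s powr ?n = z" using z w by (simp add: powr_powr)
    finally show "emeasure lebesgue {x \<in> \<Omega>. c * (z / ?w) powr (- (\<alpha> / ?n)) < \<bar>?f x\<bar>} \<le> ennreal z" .
  qed (use c z w in simp)
  show "rearrangement \<Omega> ?f z = 0" if "?w * r powr ?n \<le> z"
  proof -
    have "rearrangement \<Omega> ?f z \<le> ennreal l" if l: "0 < l" for l
    proof (rule rearrangement_le[OF l])
      have "{x \<in> \<Omega>. l < \<bar>?f x\<bar>} \<subseteq> ball x0 r"
      proof
        fix y assume "y \<in> {x \<in> \<Omega>. l < \<bar>?f x\<bar>}"
        then have "0 < ?f y" using l unfolding abs by simp
        then show "y \<in> ball x0 r" using supp by blast
      qed
      then have "emeasure lebesgue {x \<in> \<Omega>. l < \<bar>?f x\<bar>} \<le> ennreal (?w * r powr ?n)"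
        by (rule ball_le) (use \<rho> in linarith)
      then show "emeasure lebesgue {x \<in> \<Omega>. l < \<bar>?f x\<bar>} \<le> ennreal z"
        by (rule order_trans) (rule ennreal_leI[OF \<open>?w * r powr ?n \<le> z\<close>])
    qed
    then have "rearrangement \<Omega> ?f z \<le> ennreal 0"
      by (rule ennreal_le_of_right_limit[where f="\<lambda>e. e"]) (auto intro: tendsto_ident_at)
    then show ?thesis by simp
  qed
qed

text \<open>In \<open>A\<close> the summand n / (\<alpha> q) comes from the plateau z < T1, and n
  ln(r/\<rho>) is the logarithmic length of [T1, T2), on which the integrand is bounded by a
  constant times 1/z.\<close>

lemma lorentz_norm_extremal:
  fixes x0 :: "real ^ 'n"
  assumes \<alpha>: "0 < \<alpha>" "\<alpha> < real CARD('n)" and q: "1 < q" and \<rho>: "0 < \<rho>" "\<rho> < r"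
    and A: "A = unit_vol TYPE('n) powr (\<alpha> / real CARD('n)) * (real CARD('n) / (\<alpha> * q) + real CARD('n) * ln (r / \<rho>)) powr (1/q)"
  shows "lorentz_norm (real CARD('n) / \<alpha>) q \<Omega> (\<lambda>y. 1 / A * riesz_extremal x0 \<alpha> \<rho> r y) \<le> 1"
proof -
  let ?n = "real CARD('n)" and ?w = "unit_vol TYPE('n)"
  let ?f = "\<lambda>y. 1 / A * riesz_extremal x0 \<alpha> \<rho> r y"
  have w: "0 < ?w" by (rule unit_vol_pos)
  have n: "0 < ?n" using \<alpha> by simp
  define J where "J = ?n / (\<alpha> * q) + ?n * ln (r / \<rho>)"
  have ln0: "0 < ln (r / \<rho>)" using \<rho> by simp
  have J: "0 < J" unfolding J_def using n \<alpha> q ln0 by (intro add_pos_pos) auto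
  have A0: "0 < A" unfolding A J_def[symmetric] using w J by simp
  have Aq: "A powr q = ?w powr (\<alpha> * q / ?n) * J" unfolding A J_def[symmetric] using J q by (simp add: powr_mult powr_powr)
  define T1 where "T1 = ?w * \<rho> powr ?n"
  define T2 where "T2 = ?w * r powr ?n"
  have T: "0 < T1" "T1 \<le> T2" unfolding T1_def T2_def using w \<rho> n by (auto intro!: mult_left_mono powr_mono2)
  let ?a = "1 - \<alpha> * q / ?n"
  have aq: "0 < \<alpha> * q / ?n" using \<alpha> q n by simp
  have pow: "ennreal_pow (ennreal u * v) q * ennreal (1 / z) \<le> ennreal ((u * k) powr q / z)"
    if "v \<le> ennreal k" "0 < z" "0 \<le> u" "0 \<le> k" for u k z and v :: ennreal
  proof -
    have le: "ennreal u * v \<le> ennreal (u * k)" using that by (simp add: ennreal_mult mult_left_mono)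
    have "\<exists>y. ennreal u * v = ennreal y \<and> 0 \<le> y \<and> y \<le> u * k"
    proof (cases "ennreal u * v")
      case (real y)
      have "0 \<le> u * k" using that by simp
      then show ?thesis using le real by (intro exI[of _ y]) simp
    next
      case top
      then show ?thesis using le by (simp add: top_unique)
    qed
    then obtain y where y: "ennreal u * v = ennreal y" "0 \<le> y" "y \<le> u * k" by blast
    have "y powr q / z \<le> (u * k) powr q / z" using y q that by (intro divide_right_mono powr_mono2) auto
    then show ?thesis unfolding ennreal_pow_def y(1) using y that by (simp add: ennreal_mult[symmetric] ennreal_leI)
  qed
  have "(\<integral>\<^sup>+ s \<in> {s. 0 < s \<and> ennreal s < emeasure lebesgue \<Omega>}.
          ennreal_pow (ennreal (s powr (1 / (?n / \<alpha>))) * rearrangement \<Omega> ?f s) q * ennreal (1 / s) \<partial>lborel)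
      \<le> (\<integral>\<^sup>+ z. ennreal ((1 / A * \<rho> powr (- \<alpha>)) powr q) * (ennreal (z powr (- ?a)) * indicator {0<..<T1} z)
             + ennreal ((1 / A * ?w powr (\<alpha> / ?n)) powr q) * (ennreal (1 / z) * indicator {T1..<T2} z) \<partial>lborel)"
  proof (intro nn_integral_mono)
    fix z
    let ?l = "ennreal_pow (ennreal (z powr (1 / (?n / \<alpha>))) * rearrangement \<Omega> ?f z) q * ennreal (1 / z) * indicator {s. 0 < s \<and> ennreal s < emeasure lebesgue \<Omega>} z"
    let ?r = "ennreal ((1 / A * \<rho> powr (- \<alpha>)) powr q) * (ennreal (z powr (- ?a)) * indicator {0<..<T1} z)
             + ennreal ((1 / A * ?w powr (\<alpha> / ?n)) powr q) * (ennreal (1 / z) * indicator {T1..<T2} z)"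
    note re = rearrangement_extremal[OF \<alpha> \<rho>, of "1 / A" z \<Omega> x0]
    have l_le: "?l \<le> ennreal_pow (ennreal (z powr (1 / (?n / \<alpha>))) * rearrangement \<Omega> ?f z) q * ennreal (1 / z)"
      by (simp add: indicator_def)
    consider "z \<le> 0" | "0 < z" "z < T1" | "0 < z" "T1 \<le> z" "z < T2" | "0 < z" "T2 \<le> z" by linarith
    then show "?l \<le> ?r"
    proof cases
      case 2
      have "?l \<le> ennreal ((z powr (1 / (?n / \<alpha>)) * (1 / A * \<rho> powr (- \<alpha>))) powr q / z)"
        by (rule order_trans[OF l_le pow[OF re(1)]]) (use 2 A0 in auto)
      also have "(z powr (1 / (?n / \<alpha>)) * (1 / A * \<rho> powr (- \<alpha>))) powr q / z = (1 / A * \<rho> powr (- \<alpha>)) powr q * z powr (- ?a)"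
      proof -
        have "z powr (- ?a) = z powr (\<alpha> * q / ?n) / z" using 2 by (simp add: powr_diff)
        moreover have "(z powr (1 / (?n / \<alpha>)) * (1 / A * \<rho> powr (- \<alpha>))) powr q = z powr (\<alpha> * q / ?n) * (1 / A * \<rho> powr (- \<alpha>)) powr q"
          by (subst powr_mult) (use A0 in \<open>auto simp: powr_powr\<close>)
        ultimately show ?thesis by simp
      qed
      finally show ?thesis using 2 by (simp add: ennreal_mult)
    next
      case 3
      have "?l \<le> ennreal ((z powr (1 / (?n / \<alpha>)) * (1 / A * (z / ?w) powr (- (\<alpha> / ?n)))) powr q / z)"
        by (rule order_trans[OF l_le pow[OF re(2)]]) (use 3 A0 in auto)
      also have "z powr (1 / (?n / \<alpha>)) * (1 / A * (z / ?w) powr (- (\<alpha> / ?n))) = 1 / A * ?w powr (\<alpha> / ?n)"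
        using 3 w by (simp add: powr_divide powr_minus divide_simps)
      also have "(1 / A * ?w powr (\<alpha> / ?n)) powr q / z = (1 / A * ?w powr (\<alpha> / ?n)) powr q * (1 / z)" by simp
      finally show ?thesis using 3 by (simp add: ennreal_mult[symmetric])
    next
      case 4
      have "rearrangement \<Omega> ?f z = 0" by (rule re(3)) (use 4 A0 T2_def in auto)
      then show ?thesis using q by (simp add: ennreal_pow_def)
    qed simp
  qed
  also have "\<dots> = ennreal ((1 / A * \<rho> powr (- \<alpha>)) powr q) * (\<integral>\<^sup>+ z. ennreal (z powr (- ?a)) * indicator {0<..<T1} z \<partial>lborel)
      + ennreal ((1 / A * ?w powr (\<alpha> / ?n)) powr q) * (\<integral>\<^sup>+ z. ennreal (1 / z) * indicator {T1..<T2} z \<partial>lborel)"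
    by (subst nn_integral_add) (auto simp: nn_integral_cmult)
  also have "\<dots> = ennreal ((1 / A * \<rho> powr (- \<alpha>)) powr q * (T1 powr (\<alpha> * q / ?n) / (\<alpha> * q / ?n)) + (1 / A * ?w powr (\<alpha> / ?n)) powr q * ln (T2 / T1))"
  proof -
    have 1: "(\<integral>\<^sup>+ z. ennreal (z powr (- ?a)) * indicator {0<..<T1} z \<partial>lborel) = ennreal (T1 powr (\<alpha> * q / ?n) / (\<alpha> * q / ?n))"
      using nn_integral_powr_0[of ?a T1] aq T by simp
    have 2: "(\<integral>\<^sup>+ z. ennreal (1 / z) * indicator {T1..<T2} z \<partial>lborel) = ennreal (ln (T2 / T1))"
      using T by (rule nn_integral_inverse_Ico)
    have "0 \<le> ln (T2 / T1)" using T by simp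
    moreover have "0 \<le> T1 powr (\<alpha> * q / ?n) / (\<alpha> * q / ?n)" by (rule divide_nonneg_nonneg[OF powr_ge_zero less_imp_le[OF aq]])
    ultimately show ?thesis unfolding 1 2
      by (simp only: ennreal_mult[symmetric] ennreal_plus[symmetric] powr_ge_zero mult_nonneg_nonneg)
  qed
  also have "(1 / A * \<rho> powr (- \<alpha>)) powr q * (T1 powr (\<alpha> * q / ?n) / (\<alpha> * q / ?n)) + (1 / A * ?w powr (\<alpha> / ?n)) powr q * ln (T2 / T1) = 1"
  proof -
    have "ln (T2 / T1) = ?n * ln (r / \<rho>)" unfolding T1_def T2_def using w \<rho> by (simp add: ln_div ln_powr algebra_simps)
    moreover have "T1 powr (\<alpha> * q / ?n) = ?w powr (\<alpha> * q / ?n) * \<rho> powr (\<alpha> * q)"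
      unfolding T1_def using w \<rho> n by (simp add: powr_mult powr_powr)
    moreover have "(1 / A * \<rho> powr (- \<alpha>)) powr q = 1 / A powr q * \<rho> powr (- (\<alpha> * q))"
      using A0 by (simp add: powr_mult powr_powr powr_divide)
    moreover have "(1 / A * ?w powr (\<alpha> / ?n)) powr q = 1 / A powr q * ?w powr (\<alpha> * q / ?n)"
      using A0 by (simp add: powr_mult powr_powr powr_divide)
    moreover have "\<rho> powr (- (\<alpha> * q)) * \<rho> powr (\<alpha> * q) = 1" unfolding powr_add[symmetric] using \<rho> by simp
    ultimately have "(1 / A * \<rho> powr (- \<alpha>)) powr q * (T1 powr (\<alpha> * q / ?n) / (\<alpha> * q / ?n)) + (1 / A * ?w powr (\<alpha> / ?n)) powr q * ln (T2 / T1)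
       = 1 / A powr q * ?w powr (\<alpha> * q / ?n) * (?n / (\<alpha> * q)) + 1 / A powr q * ?w powr (\<alpha> * q / ?n) * (?n * ln (r / \<rho>))"
      by simp
    also have "\<dots> = (?w powr (\<alpha> * q / ?n) * J) / A powr q" unfolding J_def by (simp add: distrib_left add_divide_distrib)
    also have "\<dots> = 1" unfolding Aq using w J by simp
    finally show ?thesis .
  qed
  finally have le1: "(\<integral>\<^sup>+ s \<in> {s. 0 < s \<and> ennreal s < emeasure lebesgue \<Omega>}.
          ennreal_pow (ennreal (s powr (1 / (?n / \<alpha>))) * rearrangement \<Omega> ?f s) q * ennreal (1 / s) \<partial>lborel) \<le> 1" by simp
  show ?thesis unfolding lorentz_norm_def by (rule ennreal_pow_le_one[OF le1]) (use q in simp)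
qed

text \<open>For x close to x0 the product of kernel and extremal is about |y - x0|^(-n), so annuli
  of equal ratio contribute equally. The factors (1 + e)^(\<alpha> - n) and 1 / (1 + n e) are the
  losses from moving the centre and from discretising the radius.\<close>

lemma riesz_potential_extremal:
  fixes x0 x :: "real ^ 'n"
  assumes \<alpha>: "0 < \<alpha>" "\<alpha> < real CARD('n)" and c: "0 < c" and \<rho>: "0 < \<rho>" and e: "0 < e" "e < 1"
    and r: "r = \<rho> * exp (e * real N)" and x: "x \<in> ball x0 (e * \<rho>)" and sub: "ball x0 r \<subseteq> \<Omega>"
  shows "c * unit_vol TYPE('n) * (1 + e) powr (\<alpha> - real CARD('n)) * (real CARD('n) * e * real N) / (1 + real CARD('n) * e) / riesz_gamma CARD('n) \<alpha>
    \<le> riesz_potential \<alpha> (zero_ext \<Omega> (\<lambda>y. c * riesz_extremal x0 \<alpha> \<rho> r y)) x"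
proof -
  let ?n = "real CARD('n)" and ?w = "unit_vol TYPE('n)"
  define g where "g y = c * riesz_extremal x0 \<alpha> \<rho> r y" for y
  have n: "0 < ?n" using \<alpha> by simp
  have w: "0 < ?w" by (rule unit_vol_pos)
  have ze: "zero_ext \<Omega> g = g" using sub unfolding zero_ext_def g_def riesz_extremal_def by (auto simp: indicator_def fun_eq_iff)
  define F where "F = riesz_integrand \<alpha> g x"
  have F_eq: "F y = c * riesz_extremal x0 \<alpha> \<rho> r y * norm (x - y) powr (\<alpha> - ?n)" for y
    unfolding F_def riesz_integrand_def g_def using powr_minus_divide[of "norm (x - y)" "?n - \<alpha>"] by simp
  have F_nn: "0 \<le> F y" for y unfolding F_eq using c riesz_extremal_nonneg[of x0 \<alpha> \<rho> r y] by simp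
  have [measurable]: "F \<in> borel_measurable borel"
    unfolding F_eq[abs_def] using riesz_extremal_measurable[of x0 \<alpha> \<rho> r] by measurable
  have dx: "dist x0 x < e * \<rho>" using x by simp
  define s where "s i = \<rho> * exp (e * real i)" for i
  have s0: "0 < s i" "\<rho> \<le> s i" for i unfolding s_def using \<rho> e by auto
  have s_mono: "s i \<le> s j" if "i \<le> j" for i j unfolding s_def using \<rho> e that by simp
  have s_N: "s N = r" unfolding s_def r ..
  define An where "An i = ball x0 (s (Suc i)) - ball x0 (s i)" for i
  define m where "m i = c * (1 + e) powr (\<alpha> - ?n) * s (Suc i) powr (- ?n)" for i
  have m0: "0 \<le> m i" for i unfolding m_def using c by simp
  have An_em: "emeasure lborel (An i) = ennreal (?w * s (Suc i) powr ?n * (1 - exp (- (?n * e))))" for i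
  proof -
    have "emeasure lborel (An i) = emeasure lborel (ball x0 (s (Suc i))) - emeasure lborel (ball x0 (s i))"
      unfolding An_def using s_mono[of i "Suc i"] s0[of i]
      by (intro emeasure_Diff) (auto simp: emeasure_ball_unit_vol)
    also have "\<dots> = ennreal (?w * s (Suc i) powr ?n) - ennreal (?w * s i powr ?n)"
      using s0 by (simp add: emeasure_ball_unit_vol less_imp_le)
    also have "\<dots> = ennreal (?w * s (Suc i) powr ?n - ?w * s i powr ?n)"
      using w by (intro ennreal_minus) auto
    also have "s i powr ?n = s (Suc i) powr ?n * exp (- (?n * e))"
    proof -
      have "s i = s (Suc i) * exp (- e)" unfolding s_def by (simp add: exp_add[symmetric] algebra_simps)
      then have "s i powr ?n = s (Suc i) powr ?n * exp (- e) powr ?n" using s0[of "Suc i"] by (simp add: powr_mult)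
      also have "exp (- e) powr ?n = exp (- (?n * e))" by (simp add: exp_powr_real mult.commute)
      finally show ?thesis .
    qed
    finally show ?thesis by (simp add: algebra_simps)
  qed
  have F_An: "m i \<le> F y" if "y \<in> An i" "i < N" for i y
  proof -
    have y: "s i \<le> dist x0 y" "dist x0 y < s (Suc i)" using that(1) unfolding An_def by auto
    have d: "\<rho> \<le> dist x0 y" "dist x0 y < r" using y s0(2)[of i] s_mono[of "Suc i" N] that(2) s_N by auto
    have "norm (x - y) = dist x y" by (simp add: dist_norm)
    then have up: "norm (x - y) \<le> (1 + e) * s (Suc i)"
    proof -
      have "dist x y \<le> dist x0 x + dist x0 y" using dist_triangle2[of x y x0] by (simp add: dist_commute)
      also have "\<dots> \<le> e * \<rho> + s (Suc i)" using dx y by simp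
      also have "\<dots> \<le> e * s (Suc i) + s (Suc i)" using s0(2)[of "Suc i"] e by simp
      finally show ?thesis by (simp add: algebra_simps dist_norm)
    qed
    \<comment> \<open>This keeps y away from x, where the kernel would have the default value 0 and
      the lower bound would fail.\<close>
    have "e * \<rho> < 1 * \<rho>" using e \<rho> by (intro mult_strict_right_mono) auto
    then have ne: "x \<noteq> y" using dx d by auto
    have "((1 + e) * s (Suc i)) powr (\<alpha> - ?n) \<le> norm (x - y) powr (\<alpha> - ?n)"
      using up ne \<alpha> by (intro powr_mono2') auto
    moreover have "s (Suc i) powr (- \<alpha>) \<le> dist x0 y powr (- \<alpha>)"
      using y s0[of i] \<alpha> d \<rho> by (intro powr_mono2') auto
    ultimately have "c * s (Suc i) powr (- \<alpha>) * ((1 + e) * s (Suc i)) powr (\<alpha> - ?n) \<le> c * dist x0 y powr (- \<alpha>) * norm (x - y) powr (\<alpha> - ?n)"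
      using c by (intro mult_mono) auto
    also have "\<dots> = F y" unfolding F_eq riesz_extremal_def using d by (simp add: indicator_def)
    also have "c * s (Suc i) powr (- \<alpha>) * ((1 + e) * s (Suc i)) powr (\<alpha> - ?n) = m i"
    proof -
      have "s (Suc i) powr (- \<alpha>) * s (Suc i) powr (\<alpha> - ?n) = s (Suc i) powr (- ?n)" unfolding powr_add[symmetric] by simp
      moreover have "((1 + e) * s (Suc i)) powr (\<alpha> - ?n) = (1 + e) powr (\<alpha> - ?n) * s (Suc i) powr (\<alpha> - ?n)"
        using e s0[of "Suc i"] by (simp add: powr_mult)
      ultimately show ?thesis unfolding m_def by (simp add: mult.assoc mult.left_commute)
    qed
    finally show ?thesis .
  qed
  have disj: "i = j" if "y \<in> An i" "y \<in> An j" for i j y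
  proof -
    have "\<not> i < j" "\<not> j < i" using that s_mono[of "Suc i" j] s_mono[of "Suc j" i] unfolding An_def by auto
    then show ?thesis by simp
  qed
  \<comment> \<open>A divergent Bochner integral would be 0, so the lower bound needs
    integrability.\<close>
  have fin: "(\<integral>\<^sup>+ y. ennreal (F y) \<partial>lborel) < \<infinity>"
  proof -
    define Bd where "Bd = c * \<rho> powr (- \<alpha>) * ((1 - e) * \<rho>) powr (\<alpha> - ?n)"
    have "ennreal (F y) \<le> ennreal Bd * indicator (ball x0 r) y" for y
    proof (cases "y \<in> ball x0 r - ball x0 \<rho>")
      case True
      then have y: "\<rho> \<le> dist x0 y" by auto
      have "dist x0 y \<le> dist x0 x + norm (x - y)" using dist_triangle[of x0 y x] by (simp add: dist_norm)
      then have "(1 - e) * \<rho> \<le> norm (x - y)" using dx y by (simp add: algebra_simps)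
      then have "norm (x - y) powr (\<alpha> - ?n) \<le> ((1 - e) * \<rho>) powr (\<alpha> - ?n)"
        using \<alpha> e \<rho> by (intro powr_mono2') auto
      moreover have "dist x0 y powr (- \<alpha>) \<le> \<rho> powr (- \<alpha>)" using y \<rho> \<alpha> by (intro powr_mono2') auto
      ultimately have "c * dist x0 y powr (- \<alpha>) * norm (x - y) powr (\<alpha> - ?n) \<le> Bd"
        unfolding Bd_def using c by (intro mult_mono) auto
      then show ?thesis unfolding F_eq riesz_extremal_def using True by (simp add: ennreal_leI)
    next
      case False
      then have "F y = 0" unfolding F_eq riesz_extremal_def by auto
      then show ?thesis by simp
    qed
    then have "(\<integral>\<^sup>+ y. ennreal (F y) \<partial>lborel) \<le> (\<integral>\<^sup>+ y. ennreal Bd * indicator (ball x0 r) y \<partial>lborel)"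
      by (intro nn_integral_mono)
    also have "\<dots> = ennreal Bd * emeasure lborel (ball x0 r)" by (intro nn_integral_cmult_indicator) auto
    also have "\<dots> < \<infinity>" using s0[of N] unfolding s_N by (simp add: emeasure_ball_unit_vol ennreal_mult_less_top)
    finally show ?thesis .
  qed
  have nl: "(\<integral>\<^sup>+ y. ennreal (F y) \<partial>lebesgue) = (\<integral>\<^sup>+ y. ennreal (F y) \<partial>lborel)" by (rule nn_integral_completion)
  have FM: "F \<in> borel_measurable lebesgue" by (rule measurable_completion) measurable
  have int: "integrable lebesgue F"
    by (rule integrableI_bounded[OF FM]) (use fin nl F_nn in simp)
  have "ennreal (real N * (c * (1 + e) powr (\<alpha> - ?n) * ?w * (1 - exp (- (?n * e))))) = (\<Sum>i<N. ennreal (m i) * emeasure lborel (An i))"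
  proof -
    have "ennreal (m i) * emeasure lborel (An i) = ennreal (c * (1 + e) powr (\<alpha> - ?n) * ?w * (1 - exp (- (?n * e))))" for i
    proof -
      have "s (Suc i) powr (- ?n) * s (Suc i) powr ?n = 1" unfolding powr_add[symmetric] using s0[of "Suc i"] by simp
      then have "m i * (?w * s (Suc i) powr ?n * (1 - exp (- (?n * e)))) = c * (1 + e) powr (\<alpha> - ?n) * ?w * (1 - exp (- (?n * e)))"
        unfolding m_def by (simp add: mult_ac)
      then show ?thesis unfolding An_em using m0[of i] by (simp only: ennreal_mult'[symmetric])
    qed
    moreover have "0 \<le> 1 - exp (- (?n * e))" using n e by simp
    ultimately show ?thesis using c w by (simp add: ennreal_mult ennreal_of_nat_eq_real_of_nat)
  qed
  also have "\<dots> = (\<integral>\<^sup>+ y. (\<Sum>i<N. ennreal (m i) * indicator (An i) y) \<partial>lborel)"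
  proof -
    have An_sets: "An i \<in> sets lborel" for i unfolding An_def by simp
    have "(\<integral>\<^sup>+ y. (\<Sum>i<N. ennreal (m i) * indicator (An i) y) \<partial>lborel) = (\<Sum>i<N. \<integral>\<^sup>+ y. ennreal (m i) * indicator (An i) y \<partial>lborel)"
      by (intro nn_integral_sum borel_measurable_times_ennreal borel_measurable_indicator borel_measurable_const An_sets)
    then show ?thesis by (simp only: nn_integral_cmult_indicator[OF An_sets])
  qed
  also have "\<dots> \<le> (\<integral>\<^sup>+ y. ennreal (F y) \<partial>lborel)"
  proof (intro nn_integral_mono)
    fix y
    show "(\<Sum>i<N. ennreal (m i) * indicator (An i) y) \<le> ennreal (F y)"
    proof (cases "\<exists>i<N. y \<in> An i")
      case True
      then obtain i where i: "i < N" "y \<in> An i" by blast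
      have "(\<Sum>j<N. ennreal (m j) * indicator (An j) y) = (\<Sum>j\<in>{i}. ennreal (m j) * indicator (An j) y)"
        using i disj by (intro sum.mono_neutral_right) (auto simp: indicator_def)
      also have "\<dots> = ennreal (m i)" using i by simp
      also have "\<dots> \<le> ennreal (F y)" using F_An[OF i(2,1)] by (rule ennreal_leI)
      finally show ?thesis .
    next
      case False
      then have "(\<Sum>i<N. ennreal (m i) * indicator (An i) y) = 0" by (intro sum.neutral) auto
      then show ?thesis by simp
    qed
  qed
  also have "\<dots> = ennreal (\<integral> y. F y \<partial>lebesgue)"
    unfolding nl[symmetric] by (rule nn_integral_eq_integral[OF int]) (simp add: F_nn)
  finally have low: "real N * (c * (1 + e) powr (\<alpha> - ?n) * ?w * (1 - exp (- (?n * e)))) \<le> (\<integral> y. F y \<partial>lebesgue)"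
    using F_nn by (simp add: integral_nonneg_AE)
  \<comment> \<open>A lower bound for the relative volume of an annulus that is still n e to first
    order.\<close>
  have "?n * e / (1 + ?n * e) \<le> 1 - exp (- (?n * e))"
  proof -
    have "1 + ?n * e \<le> exp (?n * e)" by (rule exp_ge_add_one_self)
    moreover have "0 < 1 + ?n * e" using n e by (simp add: add_pos_pos)
    ultimately have "exp (- (?n * e)) \<le> 1 / (1 + ?n * e)" unfolding exp_minus by (simp add: inverse_eq_divide divide_left_mono)
    then show ?thesis using \<open>0 < 1 + ?n * e\<close> by (simp add: field_simps)
  qed
  then have "real N * (c * (1 + e) powr (\<alpha> - ?n) * ?w) * (?n * e / (1 + ?n * e)) \<le> real N * (c * (1 + e) powr (\<alpha> - ?n) * ?w) * (1 - exp (- (?n * e)))"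
    using c w by (intro mult_left_mono) auto
  also have "\<dots> \<le> (\<integral> y. F y \<partial>lebesgue)" using low by (simp add: mult.assoc)
  finally have "real N * (c * (1 + e) powr (\<alpha> - ?n) * ?w) * (?n * e / (1 + ?n * e)) / riesz_gamma CARD('n) \<alpha> \<le> (\<integral> y. F y \<partial>lebesgue) / riesz_gamma CARD('n) \<alpha>"
    using riesz_gamma_pos[OF \<alpha>] by (intro divide_right_mono) auto
  also have "\<dots> = riesz_potential \<alpha> (zero_ext \<Omega> g) x" unfolding riesz_potential_def ze F_def by simp
  finally show ?thesis unfolding g_def by (simp add: mult_ac)
qed

section \<open>Divergence above the critical exponent\<close>

text \<open>As e tends to 0 the losses of \<open>riesz_potential_extremal\<close> disappear. An
  excess factor B > 1 therefore survives for some fixed e, chosen before \<rho> tends to 0.\<close>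

lemma exists_concentration_rate:
  fixes B a n p :: real
  assumes "1 < B"
  obtains e where "0 < e" "e < 1" "1 < B * ((1 + e) powr a / (1 + n * e)) powr p"
proof -
  have "((\<lambda>e. B * ((1 + e) powr a / (1 + n * e)) powr p) \<longlongrightarrow> B * ((1 + 0) powr a / (1 + n * 0)) powr p) (at_right 0)"
    by (intro tendsto_intros) auto
  then have "((\<lambda>e. B * ((1 + e) powr a / (1 + n * e)) powr p) \<longlongrightarrow> B) (at_right 0)" by simp
  then have "\<forall>\<^sub>F e in at_right 0. 1 < B * ((1 + e) powr a / (1 + n * e)) powr p"
    using assms by (rule order_tendstoD(1))
  moreover have "\<forall>\<^sub>F e in at_right (0::real). e < 1"
    by (auto simp: eventually_at_right_field intro!: exI[of _ 1])
  moreover have "\<forall>\<^sub>F e in at_right (0::real). 0 < e" by (simp add: eventually_at_right_less)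
  ultimately have "\<forall>\<^sub>F e in at_right 0. 0 < e \<and> e < 1 \<and> 1 < B * ((1 + e) powr a / (1 + n * e)) powr p"
    by eventually_elim auto
  then show ?thesis using that eventually_happens'[OF trivial_limit_at_right_real] by blast
qed

text \<open>The constant m, the share of the plateau in the norm, is negligible: y / (m + y) tends
  to 1, and the exponent grows like c (K - 1) y.\<close>

lemma supercritical_divergence:
  fixes K c m s b :: real
  assumes K: "1 < K" and c: "0 < c" and b: "0 < b" and m: "0 < m" and s: "0 < s"
  shows "filterlim (\<lambda>N. b * exp (c * (K * (real N * s * (real N * s / (m + real N * s)) powr p) - real N * s))) at_top sequentially"
proof -
  have "filterlim (\<lambda>N. s * real N) at_top sequentially"
    by (rule filterlim_tendsto_pos_mult_at_top[OF tendsto_const s filterlim_real_sequentially])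
  then have Y: "filterlim (\<lambda>N. real N * s) at_top sequentially" by (simp add: mult.commute)
  have "((\<lambda>y. 1 / (m / y + 1)) \<longlongrightarrow> 1 / (0 + 1)) (at_top :: real filter)"
    by (intro tendsto_intros tendsto_divide_0[OF tendsto_const] filterlim_at_top_imp_at_infinity filterlim_ident) auto
  then have "((\<lambda>y. (1 / (m / y + 1)) powr p) \<longlongrightarrow> (1 / (0 + 1)) powr p) (at_top :: real filter)"
    by (intro tendsto_powr tendsto_const) auto
  then have "((\<lambda>y. K * (1 / (m / y + 1)) powr p - 1) \<longlongrightarrow> K * (1 / (0 + 1)) powr p - 1) (at_top :: real filter)"
    by (intro tendsto_diff tendsto_mult tendsto_const)
  then have "((\<lambda>y. K * (1 / (m / y + 1)) powr p - 1) \<longlongrightarrow> K - 1) (at_top :: real filter)" by simp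
  from filterlim_tendsto_pos_mult_at_top[OF this _ filterlim_ident]
  have 1: "filterlim (\<lambda>y. (K * (1 / (m / y + 1)) powr p - 1) * y) at_top at_top" using K by simp
  have 2: "filterlim (\<lambda>y. K * (y * (y / (m + y)) powr p) - y) at_top at_top"
  proof (rule filterlim_mono_eventually[OF 1 order_refl order_refl])
    show "\<forall>\<^sub>F y in at_top. (K * (1 / (m / y + 1)) powr p - 1) * y = K * (y * (y / (m + y)) powr p) - y"
      using eventually_gt_at_top[of 0]
    proof eventually_elim
      fix y :: real assume "0 < y"
      then have "1 / (m / y + 1) = y / (m + y)" using m by (simp add: field_simps)
      then show "(K * (1 / (m / y + 1)) powr p - 1) * y = K * (y * (y / (m + y)) powr p) - y"
        by (simp add: algebra_simps)
    qed
  qed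
  have "filterlim (\<lambda>y. b * exp (c * (K * (y * (y / (m + y)) powr p) - y))) at_top at_top"
    using b c by (intro filterlim_tendsto_pos_mult_at_top[OF tendsto_const] filterlim_compose[OF exp_at_top] 2)
  from filterlim_compose[OF this Y] show ?thesis by simp
qed

lemma riesz_trace_sharp:
  fixes \<Omega> :: "(real ^ 'n) set" and \<alpha> q d \<beta> :: real
  assumes \<Omega>: "open \<Omega>"
    and \<alpha>: "0 < \<alpha>" "\<alpha> < real CARD('n)"
    and q: "1 < q" "q' = q / (q - 1)"
    and d: "0 < d"
    and \<nu>: "sets \<nu> = sets borel" "lower_growth_somewhere d \<Omega> \<nu>"
    and \<beta>: "critical_beta TYPE('n) \<alpha> q' d < \<beta>"
    and bound: "\<And>f. f \<in> lorentz_space (real CARD('n) / \<alpha>) q \<Omega> \<Longrightarrow> lorentz_norm (real CARD('n) / \<alpha>) q \<Omega> f \<le> 1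
        \<Longrightarrow> exp_integral \<Omega> \<nu> \<alpha> q' \<beta> f \<le> ennreal C"
  shows False
proof -
  let ?n = "real CARD('n)" and ?w = "unit_vol TYPE('n)" and ?g = "riesz_gamma CARD('n) \<alpha>"
  let ?\<beta>c = "critical_beta TYPE('n) \<alpha> q' d"
  have n: "0 < ?n" using \<alpha> by simp
  have w: "0 < ?w" by (rule unit_vol_pos)
  have g: "0 < ?g" by (rule riesz_gamma_pos[OF \<alpha>])
  have qq: "1 < q'" "q' / q = q' - 1" unfolding q(2) using q(1) by (auto simp: field_simps)
  have \<beta>c: "?\<beta>c = d / ?n * (?g * ?w powr (- ((?n - \<alpha>) / ?n))) powr q'" "0 < ?\<beta>c"
  proof -
    have e: "?\<beta>c = d / ?n * ?g powr q' * ?w powr (- ((?n - \<alpha>) / ?n) * q')"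
      unfolding critical_beta_def unit_vol_def[of "TYPE('n)"] by (rule refl)
    show "?\<beta>c = d / ?n * (?g * ?w powr (- ((?n - \<alpha>) / ?n))) powr q'"
      unfolding e using g w by (simp add: powr_mult powr_powr)
    show "0 < ?\<beta>c" unfolding e using d n g w by simp
  qed
  have "1 < \<beta> / ?\<beta>c" using \<beta> \<beta>c(2) by simp
  then obtain e where e: "0 < e" "e < 1" "1 < \<beta> / ?\<beta>c * ((1 + e) powr (\<alpha> - ?n) / (1 + ?n * e)) powr q'"
    by (rule exists_concentration_rate)
  define b where "b = (1 + e) powr (\<alpha> - ?n) / (1 + ?n * e)"
  define K where "K = \<beta> / ?\<beta>c * b powr q'"
  have b: "0 < b" unfolding b_def using e n by (simp add: add_pos_pos)
  have K: "1 < K" unfolding K_def b_def using e by simp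
  have \<beta>0: "0 < \<beta>" using \<beta> \<beta>c by simp
  obtain x0 \<rho>0 C0 where x0: "x0 \<in> \<Omega>" "0 < \<rho>0" "0 < C0"
    and low: "\<And>\<rho>. 0 < \<rho> \<Longrightarrow> \<rho> \<le> \<rho>0 \<Longrightarrow> ennreal (C0 * \<rho> powr d) \<le> emeasure \<nu> (ball x0 \<rho> \<inter> \<Omega>)"
    using \<nu>(2) unfolding lower_growth_somewhere_def by blast
  obtain r0 where r0: "0 < r0" "ball x0 r0 \<subseteq> \<Omega>" using \<Omega> x0(1) open_contains_ball by blast
  define r where "r = min r0 \<rho>0"
  have r: "0 < r" "r \<le> \<rho>0" "ball x0 r \<subseteq> \<Omega>" unfolding r_def using r0 x0 by auto
  define m where "m = ?n / (\<alpha> * q)"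
  have m: "0 < m" unfolding m_def using n \<alpha> q by simp
  define s where "s = ?n * e"
  have s: "0 < s" unfolding s_def using n e by simp
  \<comment> \<open>A lower bound for the exponential integral of the N-th test function: the
    exponential of beta times the potential bound to the power q', times the nu-mass C0 (e
    \<rho>)^d, with \<rho> = r exp(-e N).\<close>
  define Z where "Z N = C0 * (e * r) powr d * exp (d / ?n * (K * (real N * s * (real N * s / (m + real N * s)) powr (q' - 1)) - real N * s))" for N
  have Z_le: "ennreal (Z N) \<le> ennreal C" if N: "0 < N" for N
  proof -
    define \<rho> where "\<rho> = r * exp (- (e * real N))"
    define Y where "Y = real N * s"
    have Y: "0 < Y" unfolding Y_def using N s by simp
    have \<rho>: "0 < \<rho>" "\<rho> < r" "\<rho> \<le> r" unfolding \<rho>_def using r N e by auto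
    have r\<rho>: "r = \<rho> * exp (e * real N)" unfolding \<rho>_def by (simp add: exp_minus)
    have L: "?n * ln (r / \<rho>) = Y" unfolding r\<rho> Y_def s_def using \<rho> by simp
    define A where "A = ?w powr (\<alpha> / ?n) * (m + Y) powr (1/q)"
    have A: "A = ?w powr (\<alpha> / ?n) * (?n / (\<alpha> * q) + ?n * ln (r / \<rho>)) powr (1/q)" unfolding A_def L m_def ..
    have A0: "0 < A" unfolding A_def using w m Y by simp
    define f where "f = (\<lambda>y. 1 / A * riesz_extremal x0 \<alpha> \<rho> r y)"
    have norm: "lorentz_norm (?n / \<alpha>) q \<Omega> f \<le> 1"
      unfolding f_def by (rule lorentz_norm_extremal[OF \<alpha> q(1) \<rho>(1,2) A])
    have fb: "f \<in> borel_measurable borel"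
      unfolding f_def using riesz_extremal_measurable[of x0 \<alpha> \<rho> r] by measurable
    have "f \<in> borel_measurable lebesgue" by (rule measurable_completion) (use fb in simp)
    then have "f \<in> borel_measurable (lebesgue_on \<Omega>)" by (rule measurable_restrict_space1)
    then have "f \<in> lorentz_space (?n / \<alpha>) q \<Omega>"
      unfolding lorentz_space_def using norm by (auto intro: order_le_less_trans)
    then have up: "exp_integral \<Omega> \<nu> \<alpha> q' \<beta> f \<le> ennreal C" using norm by (rule bound)
    define X where "X = 1 / A * ?w * b * Y / ?g"
    have X0: "0 \<le> X" unfolding X_def using A0 w b Y g by simp
    have pot: "X \<le> riesz_potential \<alpha> (zero_ext \<Omega> f) x" if "x \<in> ball x0 (e * \<rho>)" for x
    proof -
      have "1 / A * ?w * (1 + e) powr (\<alpha> - ?n) * (?n * e * real N) / (1 + ?n * e) / ?g \<le> riesz_potential \<alpha> (zero_ext \<Omega> f) x"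
        unfolding f_def by (rule riesz_potential_extremal[OF \<alpha> _ \<rho>(1) e(1,2) r\<rho> that r(3)]) (use A0 in simp)
      moreover have "X = 1 / A * ?w * (1 + e) powr (\<alpha> - ?n) * (?n * e * real N) / (1 + ?n * e) / ?g"
        unfolding X_def b_def Y_def s_def by (simp add: mult_ac)
      ultimately show ?thesis by simp
    qed
    have X_eq: "\<beta> * X powr q' = d / ?n * (K * (Y * (Y / (m + Y)) powr (q' - 1)))"
    proof -
      \<comment> \<open>The critical value is d/n times u^q', and the potential bound X equals b Y
        (m + Y)^(-1/q) / u. Since q'/q = q' - 1, its power q' is linear in Y up to a factor tending
        to a constant.\<close>
      define u where "u = ?g * ?w powr (- ((?n - \<alpha>) / ?n))"
      have u: "0 < u" unfolding u_def using g w by simp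
      have "?w = ?w powr ((?n - \<alpha>) / ?n) * ?w powr (\<alpha> / ?n)"
        unfolding powr_add[symmetric] add_divide_distrib[symmetric] using w n by simp
      then have "?w / ?w powr (\<alpha> / ?n) = ?w powr ((?n - \<alpha>) / ?n)" using w
        by (metis nonzero_mult_div_cancel_right powr_eq_0_iff less_irrefl)
      then have "?w / ?w powr (\<alpha> / ?n) / ?g = 1 / u" unfolding u_def powr_minus_divide by simp
      moreover have "X = ?w / ?w powr (\<alpha> / ?n) / ?g * (b * (Y / (m + Y) powr (1/q)))"
        unfolding X_def A_def by (simp add: mult_ac)
      ultimately have "X = b * (Y / (m + Y) powr (1/q)) / u" by simp
      then have "X powr q' = b powr q' * (Y powr q' / (m + Y) powr (q' - 1)) / u powr q'"
        using b Y m u qq by (simp add: powr_mult powr_divide powr_powr)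
      moreover have "Y powr q' = Y * Y powr (q' - 1)" using Y powr_add[of Y 1 "q' - 1"] by simp
      ultimately have "X powr q' = b powr q' * (Y * (Y / (m + Y)) powr (q' - 1)) / u powr q'"
        using Y m by (simp add: powr_divide)
      moreover have "\<beta> / u powr q' = d / ?n * (\<beta> / ?\<beta>c)"
        unfolding \<beta>c(1) u_def[symmetric] using u d n by simp
      ultimately have "\<beta> * X powr q' = d / ?n * (\<beta> / ?\<beta>c) * (b powr q' * (Y * (Y / (m + Y)) powr (q' - 1)))"
        by (metis (no_types, lifting) times_divide_eq_left times_divide_eq_right mult.commute)
      then show ?thesis unfolding K_def by (simp add: mult_ac)
    qed
    have "e * \<rho> \<le> \<rho>0"
    proof -
      have "e * \<rho> \<le> 1 * r" using e \<rho> by (intro mult_mono) auto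
      then show ?thesis using r by simp
    qed
    then have "ennreal (C0 * (e * \<rho>) powr d) \<le> emeasure \<nu> (ball x0 (e * \<rho>) \<inter> \<Omega>)" using e \<rho> by (intro low) auto
    then have "ennreal (exp (\<beta> * X powr q')) * ennreal (C0 * (e * \<rho>) powr d) \<le> ennreal (exp (\<beta> * X powr q')) * emeasure \<nu> (ball x0 (e * \<rho>) \<inter> \<Omega>)"
      by (intro mult_left_mono) auto
    also have "\<dots> = (\<integral>\<^sup>+ x. ennreal (exp (\<beta> * X powr q')) * indicator (ball x0 (e * \<rho>) \<inter> \<Omega>) x \<partial>\<nu>)"
      using \<nu>(1) \<Omega> by (intro nn_integral_cmult_indicator[symmetric]) auto
    also have "\<dots> \<le> exp_integral \<Omega> \<nu> \<alpha> q' \<beta> f"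
      unfolding exp_integral_def
    proof (intro nn_integral_mono)
      fix x
      show "ennreal (exp (\<beta> * X powr q')) * indicator (ball x0 (e * \<rho>) \<inter> \<Omega>) x
          \<le> ennreal (exp (\<beta> * \<bar>riesz_potential \<alpha> (zero_ext \<Omega> f) x\<bar> powr q')) * indicator \<Omega> x"
      proof (cases "x \<in> ball x0 (e * \<rho>) \<inter> \<Omega>")
        case True
        then have "X \<le> \<bar>riesz_potential \<alpha> (zero_ext \<Omega> f) x\<bar>" using pot[of x] by auto
        then have "X powr q' \<le> \<bar>riesz_potential \<alpha> (zero_ext \<Omega> f) x\<bar> powr q'" using X0 qq by (intro powr_mono2) auto
        then show ?thesis using True \<beta>0 by (simp add: ennreal_leI)
      qed simp
    qed
    also have "\<dots> \<le> ennreal C" by (rule up)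
    also have "ennreal (exp (\<beta> * X powr q')) * ennreal (C0 * (e * \<rho>) powr d) = ennreal (Z N)"
    proof -
      have "\<rho> powr d = r powr d * exp (- (d / ?n * Y))"
        unfolding \<rho>_def Y_def s_def using r n by (simp add: powr_mult exp_powr_real mult_ac)
      then have "(e * \<rho>) powr d = (e * r) powr d * exp (- (d / ?n * Y))" using e \<rho> r by (simp add: powr_mult)
      moreover have "exp (d / ?n * (K * (Y * (Y / (m + Y)) powr (q' - 1)) - Y)) = exp (\<beta> * X powr q') * exp (- (d / ?n * Y))"
        unfolding X_eq exp_add[symmetric] by (simp add: right_diff_distrib)
      ultimately have "exp (\<beta> * X powr q') * (C0 * (e * \<rho>) powr d) = Z N" unfolding Z_def Y_def[symmetric] by simp
      then show ?thesis using x0 by (simp add: ennreal_mult[symmetric])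
    qed
    finally show ?thesis .
  qed
  have "filterlim Z at_top sequentially"
    unfolding Z_def using K d n m s x0 e r by (intro supercritical_divergence) auto
  \<comment> \<open>The maximum covers negative C, for which \<open>ennreal C\<close> is 0.\<close>
  then have "\<forall>\<^sub>F N in sequentially. max 0 C < Z N" unfolding filterlim_at_top_dense by blast
  then obtain N where N: "0 < N" "max 0 C < Z N"
    using eventually_happens'[OF trivial_limit_sequentially eventually_conj[OF eventually_gt_at_top[of 0]]] by blast
  then show False using Z_le[OF N(1)] by (auto simp: ennreal_le_iff2)
qed

theorem theorem1p2:
  fixes \<Omega> :: "(real ^ 'n) set" and \<alpha> q q' d C' :: real
  assumes "CARD('n) \<ge> 2"
    and "open \<Omega>" and "bounded \<Omega>"
    and "0 < \<alpha>" and "\<alpha> < real CARD('n)"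
    and "1 < q" and "q' = q / (q - 1)"
    and "0 < d" and "d \<le> real CARD('n)"
    and "0 < C'"
  shows
    "(\<exists>C>0. \<forall>\<nu>. borel_measure_on \<Omega> \<nu> \<and> upper_growth d C' \<nu> \<and> lower_growth_somewhere d \<Omega> \<nu> \<longrightarrow>
        (\<forall>f \<in> lorentz_space (real CARD('n) / \<alpha>) q \<Omega>. lorentz_norm (real CARD('n) / \<alpha>) q \<Omega> f \<le> 1 \<longrightarrow>
           (AE x in \<nu>. riesz_converges \<alpha> (zero_ext \<Omega> f) x) \<and>
           (\<forall>\<beta> \<le> critical_beta TYPE('n) \<alpha> q' d.
              exp_integral \<Omega> \<nu> \<alpha> q' \<beta> f \<le> ennreal C))) \<and>
     (\<forall>\<nu>. borel_measure_on \<Omega> \<nu> \<and> upper_growth d C' \<nu> \<and> lower_growth_somewhere d \<Omega> \<nu> \<longrightarrow>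
        (\<forall>\<beta> > critical_beta TYPE('n) \<alpha> q' d.
           \<not> (\<exists>C::real. \<forall>f \<in> lorentz_space (real CARD('n) / \<alpha>) q \<Omega>.
                  lorentz_norm (real CARD('n) / \<alpha>) q \<Omega> f \<le> 1 \<longrightarrow>
                  exp_integral \<Omega> \<nu> \<alpha> q' \<beta> f \<le> ennreal C)))"
proof (intro conjI allI impI)
  \<comment> \<open>The lower growth condition supplies a point of the domain, which therefore has
    positive volume, as the logarithmic scales require.\<close>
  have nonempty: "\<Omega> \<noteq> {}" if "lower_growth_somewhere d \<Omega> \<nu>" for \<nu>
    using that unfolding lower_growth_somewhere_def by blast
  obtain C where C: "0 < C" "\<forall>\<nu>. borel_measure_on \<Omega> \<nu> \<and> upper_growth d C' \<nu> \<and> \<Omega> \<noteq> {} \<longrightarrow>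
        (\<forall>f \<in> lorentz_space (real CARD('n) / \<alpha>) q \<Omega>. lorentz_norm (real CARD('n) / \<alpha>) q \<Omega> f \<le> 1 \<longrightarrow>
           (AE x in \<nu>. riesz_converges \<alpha> (zero_ext \<Omega> f) x) \<and>
           (\<forall>\<beta> \<le> critical_beta TYPE('n) \<alpha> q' d. exp_integral \<Omega> \<nu> \<alpha> q' \<beta> f \<le> ennreal C))"
    using riesz_trace_inequality[OF assms(2-10)] by blast
  show "\<exists>C>0. \<forall>\<nu>. borel_measure_on \<Omega> \<nu> \<and> upper_growth d C' \<nu> \<and> lower_growth_somewhere d \<Omega> \<nu> \<longrightarrow>
        (\<forall>f \<in> lorentz_space (real CARD('n) / \<alpha>) q \<Omega>. lorentz_norm (real CARD('n) / \<alpha>) q \<Omega> f \<le> 1 \<longrightarrow>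
           (AE x in \<nu>. riesz_converges \<alpha> (zero_ext \<Omega> f) x) \<and>
           (\<forall>\<beta> \<le> critical_beta TYPE('n) \<alpha> q' d. exp_integral \<Omega> \<nu> \<alpha> q' \<beta> f \<le> ennreal C))"
    using C nonempty by (intro exI[of _ C]) blast
next
  fix \<nu> :: "(real ^ 'n) measure" and \<beta>
  assume \<nu>: "borel_measure_on \<Omega> \<nu> \<and> upper_growth d C' \<nu> \<and> lower_growth_somewhere d \<Omega> \<nu>"
    and \<beta>: "critical_beta TYPE('n) \<alpha> q' d < \<beta>"
  have sets: "sets \<nu> = sets borel" and low: "lower_growth_somewhere d \<Omega> \<nu>"
    using \<nu> unfolding borel_measure_on_def by auto
  show "\<not> (\<exists>C::real. \<forall>f \<in> lorentz_space (real CARD('n) / \<alpha>) q \<Omega>.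
                  lorentz_norm (real CARD('n) / \<alpha>) q \<Omega> f \<le> 1 \<longrightarrow>
                  exp_integral \<Omega> \<nu> \<alpha> q' \<beta> f \<le> ennreal C)"
    using riesz_trace_sharp[OF assms(2,4-8) sets low \<beta>] by blast
qed

end
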